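(* In the setting described in the context, assume that $p=N_{J_p}$ for some $J_p\in\{1,\dots,d_\infty-1\}$ (equivalently, $\lambda_p^{(\infty)}>\lambda_{p+1}^{(\infty)}$), and that Condition (B) holds: there exists $\varepsilon>0$ such that for all $s\in[1-\varepsilon,1+\varepsilon]$ $$\big\|\mathbb{E}_{s t_{n,k}}(\Theta\Theta^\top)-\Sigma_{n,k}\big\|_{op}=o(k^{-1/2}).$$ Then $$k\big(M_{n,k}(\mathbf{\Pi}_{V_{n,k}^*})-M_{n,k}(\mathbf{\Pi}_{\hat V_{n,k}})\big)\to\sum_{j=1}^{J_p}\sum_{m=J_p+1}^{d_\infty}\frac1{\mu_j-\mu_m}\Big\|\mathbf{\Pi}_{W_j^{(\infty)}}\mathbf{U}\,\mathbf{\Pi}_{W_m^{(\infty)}}\Big\|_{HS}^2$$ weakly.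
   Context: Let $\|\cdot\|$ be the Euclidean norm on $\mathbb{R}^d$. The random vector $X\in\mathbb{R}^d$ is regularly varying: there is a non-degenerate measure $\mu$ on $\mathbb{R}^d\setminus\{0\}$ such that for all Borel $\mu$-continuity sets $B$ bounded away from $0$, $\lim_{t\to\infty}\mathbb{P}\{X/t\in B\}/\mathbb{P}\{\|X\|>t\}=\mu(B)<\infty$. (Then $\mu$ is homogeneous of order $-\alpha$ for some $\alpha>0$ and $\mu\{\|x\|>1\}=1$.) Let $X_1,\dots,X_n$ be i.i.d. copies of $X$. Scaling: $\omega:\mathbb{R}^d\to(0,\infty)$ is a measurable scaling function that ensures that $\omega(X)X$ is bounded (the most common choice being $\omega(x)=1/\|x\|$ for $x\neq0$). Put $R=\|X\|$, $\Theta=\omega(X)X$, $R_i=\|X_i\|$, $\Theta_i=\omega(X_i)X_i$. $\mathbb{E}_t$ denotes conditional expectation given $R>t$. $\mathbb{E}_\infty$ (and $\mathrm{Cov}_\infty$) denotes expectation (covariance) in the limit model, i.e. with respect to $\mu$ restricted to the complement of the unit ball. Here $k=k_n$ is a sequence with $k\to\infty$ and $k/n\to0$ as $n\to\infty$, and all asymptotics are for $n\to\infty$. $t_{n,k}$ is the $(1-k/n)$-quantile of $R$, and $\hat t_{n,k}$ is the $(k+1)$-th largest order statistic of $R_1,\dots,R_n$. Define $$\hat\Sigma_{n,k}=\frac1k\sum_{i=1}^n\Theta_i\Theta_i^\top\mathbf{1}_{\{R_i>\hat t_{n,k}\}},\quad \Sigma_{n,k}=\mathbb{E}_{t_{n,k}}(\Theta\Theta^\top),\quad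 \Sigma_\infty=\mathbb{E}_\infty(\Theta\Theta^\top).$$ $\|A\|_{op}=\sup_{\|x\|=1}\|Ax\|$ is the operator norm, $\|A\|_{HS}^2=\mathrm{tr}(AA^\top)$ the squared Hilbert-Schmidt norm; $\mathbf{\Pi}_V$ is the orthogonal projection matrix onto the subspace $V$. $\mathbf{U}=(U_{ij})_{1\le i,j\le d}$ is a symmetric centered Gaussian random matrix with $\mathrm{Cov}(U_{ij},U_{\ell m})=\mathrm{Cov}_\infty(\theta_i\theta_j,\theta_\ell\theta_m)$ for all $1\le i,j,\ell,m\le d$, where $\theta_1,\dots,\theta_d$ are the components of $\Theta$. Eigenstructure: $\lambda_1^{(\infty)}\ge\dots\ge\lambda_d^{(\infty)}$ are the eigenvalues of $\Sigma_\infty$, $\mu_1>\dots>\mu_{d_\infty}$ its distinct eigenvalues, and $0=N_0<N_1<\dots<N_{d_\infty}=d$ are such that $\lambda_m^{(\infty)}=\mu_j$ for $N_{j-1}<m\le N_j$. $W_j^{(\infty)}$ is the eigenspace of $\Sigma_\infty$ for $\mu_j$. Projections: $\mathcal{V}_p$ is the set of $p$-dimensional linear subspaces of $\mathbb{R}^d$. For $V\in\mathcal{V}_p$, $M_{n,k}(\mathbf{\Pi}_V)=\mathbb{E}_{t_{n,k}}(\Theta^\top\mathbf{\Pi}_V\Theta)=\mathrm{tr}(\Sigma_{n,k}\mathbf{\Pi}_V)$; for a random subspace this function is evaluated at the random argument. $V_{n,k}^*$ is the maximizer over $V\in\mathcal{V}_p$ of $M_{n,k}(\mathbf{\Pi}_V)$;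 it is spanned by orthonormal eigenvectors of $\Sigma_{n,k}$ for its $p$ largest eigenvalues. $\hat V_{n,k}$ is the maximizer over $V\in\mathcal{V}_p$ of $\hat M_{n,k}(\mathbf{\Pi}_V)=\frac1k\sum_{i=1}^n\Theta_i^\top\mathbf{\Pi}_V\Theta_i\mathbf{1}_{\{R_i>\hat t_{n,k}\}}$; it is spanned by orthonormal eigenvectors of $\hat\Sigma_{n,k}$ for its $p$ largest eigenvalues. Under the assumptions of the claim, $V_{n,k}^*$ is unique for sufficiently large $n$ and $\hat V_{n,k}$ is unique with probability tending to $1$.
   Formalization: The formal theorem also assumes that the law of Θ given R>t converges weakly to the law of ω(x)x in the limit model (automatic for ω(x)=1/‖x‖), and reads the o(k^{-1/2}) in Condition (B) as uniform in s∈[1-ε,1+ε]; without these the claim can fail. *)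

theory Defs
  imports "HOL-Probability.Probability"
begin

text \<open>\<open>\<nu>\<close> lives on the punctured space. Nothing but finiteness away from the origin excludes
  pathological \<open>\<nu>\<close> (such as infinite mass at every point) without any nontrivial continuity set.\<close>

definition regularly_varying ::
  "'a measure \<Rightarrow> ('a \<Rightarrow> 'b::euclidean_space) \<Rightarrow> 'b measure \<Rightarrow> bool" where
  "regularly_varying M X \<nu> \<longleftrightarrow>
     X \<in> borel_measurable M \<and>
     sets \<nu> = sets (restrict_space borel (- {0})) \<and>
     emeasure \<nu> (space \<nu>) \<noteq> 0 \<and>
     (\<forall>e>0. emeasure \<nu> {x. e \<le> norm x} < \<infinity>) \<and>
     (\<forall>B\<in>sets \<nu>. 0 \<notin> closure B \<longrightarrow> emeasure \<nu> (frontier B) = 0 \<longrightarrow>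
       ((\<lambda>t::real. measure M {w\<in>space M. (1 / t) *\<^sub>R X w \<in> B} / measure M {w\<in>space M. t < norm (X w)})
          \<longlongrightarrow> measure \<nu> B) at_top)"

definition theta :: "('b \<Rightarrow> real) \<Rightarrow> 'b \<Rightarrow> 'b::real_vector" where
  "theta \<omega> x = \<omega> x *\<^sub>R x"

definition cond_above :: "'a measure \<Rightarrow> ('a \<Rightarrow> 'b::real_normed_vector) \<Rightarrow> real \<Rightarrow> 'a measure" where
  "cond_above M X t = uniform_measure M {w\<in>space M. t < norm (X w)}"

definition limit_model :: "'b::real_normed_vector measure \<Rightarrow> 'b measure" where
  "limit_model \<nu> = restrict_space \<nu> {x. 1 < norm x}"

text \<open>The laws of \<open>\<Theta>\<close> given \<open>R > t\<close> converge weakly to the law of \<open>\<omega>(x) x\<close> in the limit model,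
  i.e. the limit model is the limit of the conditional models for \<open>\<Theta>\<close> and not only for \<open>X / t\<close>.
  By the mapping theorem this is automatic for \<open>\<omega>(x) = 1 / norm x\<close>, but it can fail for a
  merely measurable (or continuous) \<open>\<omega>\<close>.\<close>

definition theta_limit ::
  "'a measure \<Rightarrow> ('a \<Rightarrow> 'b::euclidean_space) \<Rightarrow> 'b measure \<Rightarrow> ('b \<Rightarrow> real) \<Rightarrow> bool" where
  "theta_limit M X \<nu> \<omega> \<longleftrightarrow>
     (\<forall>f::'b \<Rightarrow> real. continuous_on UNIV f \<longrightarrow> bounded (range f) \<longrightarrow>
       ((\<lambda>t. \<integral>w. f (theta \<omega> (X w)) \<partial>cond_above M X t)
          \<longlongrightarrow> (\<integral>x. f (theta \<omega> x) \<partial>limit_model \<nu>)) at_top)"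

definition outer :: "real^'d \<Rightarrow> real^'d^'d" where
  "outer v = (\<chi> i j. v $ i * v $ j)"

definition Sigma_above ::
  "'a measure \<Rightarrow> ('a \<Rightarrow> real^'d) \<Rightarrow> (real^'d \<Rightarrow> real) \<Rightarrow> real \<Rightarrow> real^'d^'d" where
  "Sigma_above M X \<omega> t = (\<integral>w. outer (theta \<omega> (X w)) \<partial>cond_above M X t)"

definition Sigma_inf :: "(real^'d) measure \<Rightarrow> (real^'d \<Rightarrow> real) \<Rightarrow> real^'d^'d" where
  "Sigma_inf \<nu> \<omega> = (\<integral>x. outer (theta \<omega> x) \<partial>limit_model \<nu>)"

definition cov :: "'a measure \<Rightarrow> ('a \<Rightarrow> real) \<Rightarrow> ('a \<Rightarrow> real) \<Rightarrow> real" where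
  "cov M f g = (\<integral>x. (f x - (\<integral>y. f y \<partial>M)) * (g x - (\<integral>y. g y \<partial>M)) \<partial>M)"

definition norm_quantile :: "'a measure \<Rightarrow> ('a \<Rightarrow> 'b::real_normed_vector) \<Rightarrow> real \<Rightarrow> real" where
  "norm_quantile M X q = Inf {r. q \<le> measure M {w\<in>space M. norm (X w) \<le> r}}"

text \<open>The zero-based index \<open>k\<close> of the decreasingly sorted list is the \<open>(k+1)\<close>-th largest value.\<close>

definition norm_order_stat :: "nat \<Rightarrow> nat \<Rightarrow> (nat \<Rightarrow> 'b::real_normed_vector) \<Rightarrow> real" where
  "norm_order_stat n k x = rev (sort (map (\<lambda>i. norm (x i)) [0..<n])) ! k"

definition orth_proj :: "(real^'d) set \<Rightarrow> real^'d^'d" where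
  "orth_proj V = (THE P. \<forall>x. P *v x \<in> V \<and> (\<forall>v\<in>V. orthogonal (x - P *v x) v))"

definition true_risk ::
  "'a measure \<Rightarrow> ('a \<Rightarrow> real^'d) \<Rightarrow> (real^'d \<Rightarrow> real) \<Rightarrow> real \<Rightarrow> real^'d^'d \<Rightarrow> real" where
  "true_risk M X \<omega> t P = (\<integral>w. theta \<omega> (X w) \<bullet> (P *v theta \<omega> (X w)) \<partial>cond_above M X t)"

definition emp_risk ::
  "nat \<Rightarrow> nat \<Rightarrow> (real^'d \<Rightarrow> real) \<Rightarrow> (nat \<Rightarrow> real^'d) \<Rightarrow> real^'d^'d \<Rightarrow> real" where
  "emp_risk n k \<omega> x P =
     1 / real k * (\<Sum>i<n. theta \<omega> (x i) \<bullet> (P *v theta \<omega> (x i)) * of_bool (norm_order_stat n k x < norm (x i)))"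

definition subspaces_dim :: "nat \<Rightarrow> (real^'d) set set" where
  "subspaces_dim p = {V. subspace V \<and> dim V = p}"

definition eigenspace :: "real^'d^'d \<Rightarrow> real \<Rightarrow> (real^'d) set" where
  "eigenspace A c = {x. A *v x = c *\<^sub>R x}"

text \<open>Intended for symmetric \<open>A\<close>, where algebraic and geometric multiplicities agree.\<close>

definition ordered_eigenvalues :: "real^'d^'d \<Rightarrow> (nat \<Rightarrow> real) \<Rightarrow> bool" where
  "ordered_eigenvalues A l \<longleftrightarrow>
     (\<forall>i\<in>{1..CARD('d)}. \<forall>j\<in>{1..CARD('d)}. i \<le> j \<longrightarrow> l j \<le> l i) \<and>
     (\<forall>c. card {m\<in>{1..CARD('d)}. l m = c} = dim (eigenspace A c))"

definition hs_norm :: "real^'d^'d \<Rightarrow> real" where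
  "hs_norm A = sqrt (trace (A ** transpose A))"

text \<open>Degenerate normal laws are allowed, because the limiting covariance may be singular.\<close>

definition centered_normal :: "'a measure \<Rightarrow> ('a \<Rightarrow> real) \<Rightarrow> bool" where
  "centered_normal M Z \<longleftrightarrow> Z \<in> borel_measurable M \<and>
     ((AE w in M. Z w = 0) \<or> (\<exists>\<sigma>>0. distributed M lborel Z (normal_density 0 \<sigma>)))"

definition centered_gaussian :: "'a measure \<Rightarrow> ('a \<Rightarrow> 'b::euclidean_space) \<Rightarrow> bool" where
  "centered_gaussian M Y \<longleftrightarrow> Y \<in> borel_measurable M \<and> (\<forall>a. centered_normal M (\<lambda>w. Y w \<bullet> a))"

lemma orth_proj_unique:
  assumes "subspace V"
  shows "\<exists>!P::real^'d^'d. \<forall>x. P *v x \<in> V \<and> (\<forall>v\<in>V. orthogonal (x - P *v x) v)"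
proof -
  have dec: "y = z" if "y \<in> V" "z \<in> V" "\<forall>v\<in>V. orthogonal (x - y) v" "\<forall>v\<in>V. orthogonal (x - z) v"
    for x y z :: "real^'d"
  proof -
    have "y - z \<in> V" using assms that subspace_diff by blast
    then have "(x - y) \<bullet> (y - z) = 0" "(x - z) \<bullet> (y - z) = 0"
      using that by (auto simp: orthogonal_def)
    then have "(y - z) \<bullet> (y - z) = 0" by (simp add: inner_diff_left)
    then show ?thesis by simp
  qed
  have "\<exists>y. y \<in> V \<and> (\<forall>v\<in>V. orthogonal (x - y) v)" for x :: "real^'d"
  proof -
    obtain y z where "y \<in> span V" "\<And>w. w \<in> span V \<Longrightarrow> orthogonal z w" "x = y + z"
      using orthogonal_subspace_decomp_exists[of V x] by metis
    moreover have "span V = V" using assms by (simp add: span_eq_iff)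
    ultimately show ?thesis by (metis add_diff_cancel_left')
  qed
  then obtain f where f: "\<And>x. f x \<in> V" "\<And>x v. v \<in> V \<Longrightarrow> orthogonal (x - f x) v" by metis
  have "linear f"
  proof (rule linearI)
    fix b1 b2
    have "(b1 - f b1) \<bullet> v = 0" "(b2 - f b2) \<bullet> v = 0" if "v \<in> V" for v
      using f(2)[OF that] by (simp_all add: orthogonal_def)
    then have "\<forall>v\<in>V. orthogonal (b1 + b2 - (f b1 + f b2)) v"
      by (simp add: orthogonal_def inner_diff_left inner_add_left)
    then show "f (b1 + b2) = f b1 + f b2"
      using f assms by (intro dec[of _ _ "b1 + b2"]) (simp_all add: subspace_add)
  next
    fix r b
    have "(b - f b) \<bullet> v = 0" if "v \<in> V" for v
      using f(2)[OF that] by (simp add: orthogonal_def)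
    then have "\<forall>v\<in>V. orthogonal (r *\<^sub>R b - r *\<^sub>R f b) v"
      by (simp add: orthogonal_def inner_diff_left)
    then show "f (r *\<^sub>R b) = r *\<^sub>R f b"
      using f assms by (intro dec[of _ _ "r *\<^sub>R b"]) (simp_all add: subspace_scale)
  qed
  then have mf: "matrix f *v x = f x" for x by (simp add: matrix_works)
  show ?thesis
  proof (rule ex1I[of _ "matrix f"])
    show "\<forall>x. matrix f *v x \<in> V \<and> (\<forall>v\<in>V. orthogonal (x - matrix f *v x) v)"
      using f mf by simp
    fix P :: "real^'d^'d"
    assume P: "\<forall>x. P *v x \<in> V \<and> (\<forall>v\<in>V. orthogonal (x - P *v x) v)"
    have "P *v x = matrix f *v x" for x
      by (rule dec[of _ _ x]) (use P f mf in simp_all)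
    then show "P = matrix f" by (simp add: matrix_eq)
  qed
qed

end

theory Submission
  imports Defs
begin

text \<open>Let \<open>T\<close> be the \<open>(k + 1)\<close>-th largest norm. Summing over the possible sets of exceedances gives
  the exact identity \<open>E exp (i a \<Sum> (f(X\<^sub>i) - m(T))) = E \<psi>\<^sub>T(a)\<^sup>K\<close>, where \<open>K\<close> is the number of
  exceedances of \<open>T\<close> and \<open>m(s)\<close>, \<open>\<psi>\<^sub>s\<close> are the mean of \<open>f(X)\<close> and the characteristic function of
  \<open>f(X) - m(s)\<close> given \<open>\<parallel>X\<parallel> > s\<close>. Regular variation and Chebyshev's inequality yield \<open>T \<rightarrow> \<infinity>\<close>,
  \<open>T / t\<^sub>n \<rightarrow> 1\<close> and \<open>K / k \<rightarrow> 1\<close> in probability, so a second-order expansion of \<open>\<psi>\<^sub>s\<close> gives a central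
  limit theorem for every linear functional of the matrix of exceedances centered at \<open>T\<close>. Condition (B)
  allows to replace the centering by the one at the quantile \<open>t\<^sub>n\<close>.

  On the deterministic side, projections \<open>P\<close>, \<open>Q\<close> of equal rank with \<open>P\<close> maximal for \<open>A\<close> satisfy
  \<open>tr (A (P - Q)) = tr (A (2 P - I) (P - Q)\<^sup>2)\<close>. If \<open>Q\<close> is maximal for \<open>A + \<delta> E\<close>, then
  \<open>(P - Q) / \<delta>\<close> stays bounded and its limit points solve the Sylvester equation \<open>[A, D] = [E, P]\<close>, which
  determines the limit of the loss as a quadratic form in \<open>E\<close>.

  This quadratic form is a sum of squares of linear functionals, so its Laplace transform is a Gaussian
  mixture of characteristic functions of linear functionals. Hence the Laplace transforms converge,
  and on \<open>[0, \<infinity>)\<close> this implies weak convergence.\<close>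

section \<open>Projections and the loss of perturbed eigenspaces\<close>

text \<open>Centering at the random \<open>T\<close> keeps the probability elementary: above its own
  threshold each exceedance is a fresh draw from the conditional law, so the sum is conditionally
  centered whatever \<open>T\<close> does. The price is the drift between the two centerings, which
  is exactly what Condition (B) controls. The norm may have atoms, so the tail at the quantile need
  not be k/n and fewer than k points may exceed \<open>T\<close>; hence the sum over exceedance sets
  and the estimates for K/k. The perturbation of the matrix is random and only tight, so an
  expansion along one convergent sequence does not suffice; compactness makes it uniform over
  bounded perturbations. The reflection 2P - I appears because A commutes with its maximal P: the
  term of first order in P - Q cancels, which explains the factor k instead of sqrt k. Squares are
  linearised by exp(-x^2/2) = E exp(i g x) with g standard normal, so that single linear functionals
  of the matrix suffice.\<close>

lemma bounded_bilinear_matrix_mult: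
  "bounded_bilinear ((**) :: real^'n^'m \<Rightarrow> real^'k^'n \<Rightarrow> real^'k^'m)"
proof -
  have *: "linear (\<lambda>A. (A::real^'n^'m) ** B)" "linear (\<lambda>B. (A::real^'n^'m) ** B)"
    for A and B :: "real^'k^'n"
    by (auto intro!: linearI simp: matrix_matrix_mult_def vec_eq_iff algebra_simps sum.distrib
        sum_distrib_left)
  have "bilinear ((**) :: real^'n^'m \<Rightarrow> real^'k^'n \<Rightarrow> real^'k^'m)"
    unfolding bilinear_def using * by auto
  then show ?thesis by (simp add: bilinear_conv_bounded_bilinear)
qed

interpretation mm: bounded_bilinear "(**) :: real^'n^'m \<Rightarrow> real^'k^'n \<Rightarrow> real^'k^'m"
  by (rule bounded_bilinear_matrix_mult)

lemmas matrix_mult_simps = mm.add_left mm.add_right mm.diff_left mm.diff_right mm.minus_left mm.minus_right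
  mm.zero_left mm.zero_right mm.scaleR_left mm.scaleR_right matrix_mul_assoc

lemma bounded_linear_transpose: "bounded_linear (transpose :: real^'n^'m \<Rightarrow> real^'m^'n)"
  by (intro linear_conv_bounded_linear[THEN iffD1] linearI)
    (auto simp: transpose_def vec_eq_iff)

lemmas transpose_linear = linear_add linear_diff linear_sum linear_scale linear_0 linear_neg
lemmas transpose_simps = transpose_linear[OF bounded_linear.linear[OF bounded_linear_transpose]]

text \<open>The inner product that matrices inherit as vectors of vectors is the Frobenius one.
  Hence \<open>norm\<close> is the Hilbert-Schmidt norm, and risks become inner products with a
  projection.\<close>

lemma inner_matrix_trace: "(A::real^'n^'m) \<bullet> B = trace (transpose A ** B)"
  unfolding trace_def inner_vec_def matrix_matrix_mult_def transpose_def
  by (simp add: sum.swap[of _ "UNIV::'n set"])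

lemma inner_transpose: "transpose A \<bullet> transpose B = (A::real^'n^'m) \<bullet> B"
  unfolding inner_matrix_trace by (metis inner_commute inner_matrix_trace trace_mul_sym transpose_transpose)

lemma inner_mult_left: "((A::real^'n^'m) ** B) \<bullet> C = B \<bullet> (transpose A ** C)"
  unfolding inner_matrix_trace by (simp add: matrix_transpose_mul matrix_mul_assoc)

lemma inner_mult_right: "((A::real^'n^'m) ** B) \<bullet> C = A \<bullet> (C ** transpose B)"
proof -
  have "(A ** B) \<bullet> C = transpose (A ** B) \<bullet> transpose C" by (simp add: inner_transpose)
  also have "\<dots> = transpose A \<bullet> (B ** transpose C)"
    unfolding matrix_transpose_mul by (simp add: inner_mult_left)
  also have "\<dots> = A \<bullet> transpose (B ** transpose C)"
    by (metis inner_transpose transpose_transpose)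
  finally show ?thesis by (simp add: matrix_transpose_mul)
qed

lemma norm_transpose: "norm (transpose (A::real^'n^'m)) = norm A"
  unfolding norm_eq_sqrt_inner by (simp add: inner_transpose)

lemma hs_norm_eq_norm: "hs_norm A = norm A"
proof -
  have "trace (A ** transpose A) = transpose A \<bullet> transpose A"
    by (simp add: inner_matrix_trace)
  then show ?thesis unfolding hs_norm_def norm_eq_sqrt_inner by (simp add: inner_transpose)
qed

lemma outer_mult: "outer a *v x = (a \<bullet> x) *\<^sub>R a"
  by (simp add: outer_def matrix_vector_mult_def vec_eq_iff inner_vec_def sum_distrib_left
      sum_distrib_right algebra_simps)

lemma transpose_outer [simp]: "transpose (outer a) = outer a"
  by (simp add: transpose_def outer_def vec_eq_iff mult.commute)

lemma trace_outer: "trace (outer a) = a \<bullet> a"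
  by (simp add: trace_def outer_def inner_vec_def)

lemma inner_outer: "A \<bullet> outer v = v \<bullet> (A *v v)"
  by (simp add: inner_vec_def outer_def matrix_vector_mult_def sum_distrib_left mult_ac)

section \<open>Projections of rank \<open>p\<close> and maximisation over them\<close>

definition proj_rank :: "nat \<Rightarrow> (real^'d^'d) set" where
  "proj_rank p = {P. P ** P = P \<and> transpose P = P \<and> trace P = real p}"

text \<open>For an idempotent the trace is the rank, which is why \<open>proj_rank\<close> fixes the
  trace. The fourth fact is the first in the left-associated normal form produced by
  \<open>matrix_mul_assoc\<close>.\<close>

lemma proj_rankD:
  assumes "P \<in> proj_rank p"
  shows "P ** P = P" "transpose P = P" "trace P = real p" "X ** P ** P = X ** P"
  using assms by (auto simp: proj_rank_def matrix_mul_assoc[symmetric])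

lemma orth_proj_eqI:
  assumes "subspace V" "\<And>x. P *v x \<in> V" "\<And>x v. v \<in> V \<Longrightarrow> orthogonal (x - P *v x) v"
  shows "orth_proj V = P"
  unfolding orth_proj_def using orth_proj_unique[OF assms(1)] assms(2,3) by (intro the1_equality) auto

lemma orth_proj_props:
  assumes "subspace V"
  shows "orth_proj V *v x \<in> V" "v \<in> V \<Longrightarrow> orthogonal (x - orth_proj V *v x) v"
  using theI'[OF orth_proj_unique[OF assms]] unfolding orth_proj_def by auto

lemma symmetric_idempotentD:
  assumes "transpose P = P"
  shows "(P *v x) \<bullet> y = x \<bullet> (P *v (y::real^'d))"
  by (metis assms dot_lmul_matrix transpose_matrix_vector)

text \<open>In an orthonormal basis the projection is the sum of the matrices
  \<open>outer b\<close>, each symmetric with trace one. Idempotence holds because the vectors of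
  \<open>V\<close> are fixed.\<close>

lemma orth_proj_in_proj_rank:
  assumes V: "subspace (V :: (real^'d) set)"
  shows "orth_proj V \<in> proj_rank (dim V)"
proof -
  obtain B where B: "B \<subseteq> V" "pairwise orthogonal B" "\<And>x. x \<in> B \<Longrightarrow> norm x = 1"
    "independent B" "card B = dim V" "span B = V"
    using orthonormal_basis_subspace[OF V] by metis
  have fin: "finite B" using B(4) by (rule finiteI_independent)
  let ?P = "\<Sum>b\<in>B. outer b"
  have Px: "?P *v x = (\<Sum>b\<in>B. (b \<bullet> x) *\<^sub>R b)" for x
    using fin by (induction B rule: finite_induct)
     (auto simp: matrix_vector_mult_add_rdistrib outer_mult)
  have bb: "b \<bullet> c = (if b = c then 1 else 0)" if "b \<in> B" "c \<in> B" for b c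
    using that B(2,3) by (auto simp: pairwise_def orthogonal_def norm_eq_1)
  have orth: "orthogonal (x - ?P *v x) b" if "b \<in> B" for x b
  proof -
    have "(\<Sum>c\<in>B. (c \<bullet> x) *\<^sub>R c) \<bullet> b = (\<Sum>c\<in>B. (c \<bullet> x) * (if c = b then 1 else 0))"
      using that by (simp add: inner_sum_left bb)
    also have "\<dots> = b \<bullet> x" using that fin by (simp add: if_distrib cong: if_cong)
    finally have "(\<Sum>c\<in>B. (c \<bullet> x) *\<^sub>R c) \<bullet> b = x \<bullet> b" by (simp add: inner_commute)
    then show ?thesis unfolding orthogonal_def Px inner_diff_left by simp
  qed
  have eq: "orth_proj V = ?P"
  proof (rule orth_proj_eqI[OF V])
    show "?P *v x \<in> V" for x
      unfolding Px B(6)[symmetric] by (intro span_sum span_scale span_base)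
    show "orthogonal (x - ?P *v x) v" if "v \<in> V" for x v
      using orthogonal_to_span[of v B "x - ?P *v x"] orth that B(6) by blast
  qed
  have fixV: "orth_proj V *v x = x" if "x \<in> V" for x
  proof -
    let ?y = "x - orth_proj V *v x"
    have "?y \<in> V" using that V orth_proj_props(1)[OF V] by (simp add: subspace_diff)
    then have "orthogonal ?y ?y" using orth_proj_props(2)[OF V] by blast
    then show ?thesis by (simp add: orthogonal_self)
  qed
  have "orth_proj V ** orth_proj V = orth_proj V"
    unfolding matrix_eq by (simp add: matrix_vector_mul_assoc[symmetric] fixV orth_proj_props(1)[OF V])
  moreover have "transpose (orth_proj V) = orth_proj V"
    unfolding eq by (simp add: transpose_simps)
  moreover have "trace (\<Sum>b\<in>B. outer b) = (\<Sum>b\<in>B. trace (outer b))"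
    by (simp add: trace_def sum.swap[of _ _ B])
  then have "trace (orth_proj V) = real (dim V)"
    unfolding eq using bb B(5) by (simp add: trace_outer)
  ultimately show ?thesis by (simp add: proj_rank_def)
qed

text \<open>Converse to \<open>orth_proj_in_proj_rank\<close>: maximising over subspaces and over
  projection matrices is the same problem.\<close>

lemma orth_proj_range:
  assumes P: "P \<in> proj_rank p"
  shows "range ((*v) P) \<in> subspaces_dim p" "orth_proj (range ((*v) P)) = P"
proof -
  have sub: "subspace (range ((*v) P))"
    by (intro linear_subspace_image matrix_vector_mul_linear subspace_UNIV)
  show eq: "orth_proj (range ((*v) P)) = P"
  proof (rule orth_proj_eqI[OF sub])
    fix x v assume "v \<in> range ((*v) P)"
    then obtain y where v: "v = P *v y" by auto
    have "(P *v x) \<bullet> (P *v y) = x \<bullet> (P *v y)"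
      using symmetric_idempotentD[OF proj_rankD(2)[OF P], of x "P *v y"] proj_rankD(1)[OF P]
      by (simp add: matrix_vector_mul_assoc)
    then show "orthogonal (x - P *v x) v"
      by (simp add: v orthogonal_def inner_diff_left)
  qed auto
  have "real (dim (range ((*v) P))) = real p"
    using orth_proj_in_proj_rank[OF sub] P unfolding eq proj_rank_def by simp
  then show "range ((*v) P) \<in> subspaces_dim p"
    using sub by (simp add: subspaces_dim_def)
qed

definition max_proj :: "nat \<Rightarrow> real^'d^'d \<Rightarrow> real^'d^'d \<Rightarrow> bool" where
  "max_proj p A P \<longleftrightarrow> P \<in> proj_rank p \<and> (\<forall>Q\<in>proj_rank p. A \<bullet> Q \<le> A \<bullet> P)"

text \<open>The positive factor \<open>c\<close> absorbs the normalisation of the risk: it is 1 for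
  the true risk and \<open>k\<close> for the empirical one, which is thereby replaced by the raw sum
  over the exceedances.\<close>

lemma is_arg_max_max_proj:
  fixes A :: "real^'d^'d"
  assumes "is_arg_max (\<lambda>V. f (orth_proj V)) (\<lambda>V. V \<in> subspaces_dim p) V"
    and "\<And>P. c * f P = A \<bullet> P" "c > 0"
  shows "max_proj p A (orth_proj V)"
  unfolding max_proj_def
proof (intro conjI ballI)
  have V: "V \<in> subspaces_dim p" using assms(1) by (simp add: is_arg_max_def)
  then show "orth_proj V \<in> proj_rank p"
    using orth_proj_in_proj_rank[of V] by (auto simp: subspaces_dim_def)
  fix Q :: "real^'d^'d" assume Q: "Q \<in> proj_rank p"
  have "\<not> f (orth_proj V) < f (orth_proj (range ((*v) Q)))"
    using assms(1) orth_proj_range(1)[OF Q] by (auto simp: is_arg_max_def)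
  then have "f Q \<le> f (orth_proj V)" using orth_proj_range(2)[OF Q] by simp
  then show "A \<bullet> Q \<le> A \<bullet> orth_proj V"
    using assms(2,3) by (metis mult_le_cancel_left_pos)
qed

text \<open>Supplies the competitors for the first-order condition: the direction \<open>v\<close>
  of the range is turned into \<open>u\<close>. The last assumption says that \<open>u\<close> lies
  in the span of \<open>v\<close> and the kernel of \<open>P\<close>, hence is orthogonal to the
  rest of the range.\<close>

lemma proj_exchange:
  fixes P :: "real^'d^'d"
  assumes P: "P \<in> proj_rank p" and v: "P *v v = v" "norm v = 1" and u: "norm u = 1"
    and "P *v u - (v \<bullet> u) *\<^sub>R v = 0"
  shows "P - outer v + outer u \<in> proj_rank p"
proof -
  have vv: "v \<bullet> v = 1" "u \<bullet> u = 1" using v u by (simp_all add: norm_eq_1)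
  have Pu: "P *v u = (v \<bullet> u) *\<^sub>R v" using assms by simp
  have uP: "u \<bullet> (P *v x) = (v \<bullet> u) * (v \<bullet> x)" for x
    using symmetric_idempotentD[OF proj_rankD(2)[OF P], of u x] Pu by simp
  have vP: "v \<bullet> (P *v x) = v \<bullet> x" for x
    using symmetric_idempotentD[OF proj_rankD(2)[OF P], of v x] v by simp
  let ?Q = "P - outer v + outer u"
  have Qx: "?Q *v x = P *v x - (v \<bullet> x) *\<^sub>R v + (u \<bullet> x) *\<^sub>R u" for x
    by (simp add: matrix_vector_mult_add_rdistrib matrix_vector_mult_diff_rdistrib outer_mult)
  have PP: "P *v (P *v x) = P *v x" for x
    by (simp add: matrix_vector_mul_assoc proj_rankD(1)[OF P])
  have "?Q *v (?Q *v x) = ?Q *v x" for x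
    unfolding Qx
    by (simp add: matrix_vector_right_distrib matrix_vector_mult_diff_distrib PP Pu v(1) vv
        matrix_vector_mult_scaleR inner_add_right inner_diff_right uP vP inner_commute[of u v]
        algebra_simps)
  then have "?Q ** ?Q = ?Q" by (simp add: matrix_eq matrix_vector_mul_assoc[symmetric])
  moreover have "transpose ?Q = ?Q"
    by (simp add: transpose_simps proj_rankD(2)[OF P])
  moreover have "trace ?Q = real p"
    by (simp add: trace_add trace_sub trace_outer vv proj_rankD(3)[OF P])
  ultimately show ?thesis by (simp add: proj_rank_def)
qed

text \<open>First-order condition at a maximum: tilting \<open>v\<close> in the range towards
  \<open>w\<close> in the kernel changes the objective at a rate proportional to this entry of
  \<open>A\<close>.\<close>

lemma max_proj_offdiag:
  fixes A P :: "real^'d^'d"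
  assumes mp: "max_proj p A P" and A: "transpose A = A"
    and v: "P *v v = v" and w: "P *v w = 0"
  shows "v \<bullet> (A *v w) = 0"
proof (cases "v = 0 \<or> w = 0")
  case True
  then show ?thesis by auto
next
  case False
  have P: "P \<in> proj_rank p" using mp by (simp add: max_proj_def)
  define v' w' where "v' = v /\<^sub>R norm v" and "w' = w /\<^sub>R norm w"
  have nv: "norm v' = 1" "norm w' = 1" using False by (auto simp: v'_def w'_def)
  then have vv: "v' \<bullet> v' = 1" "w' \<bullet> w' = 1" by (simp_all only: norm_eq_1)
  have Pv: "P *v v' = v'" "P *v w' = 0" by (simp_all add: v'_def w'_def matrix_vector_mult_scaleR v w)
  have vw: "v' \<bullet> w' = 0"
  proof -
    have "v' \<bullet> w' = (P *v v') \<bullet> w'" using Pv by simp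
    also have "\<dots> = v' \<bullet> (P *v w')" by (rule symmetric_idempotentD[OF proj_rankD(2)[OF P]])
    finally show ?thesis using Pv by simp
  qed
  define a where "a = v' \<bullet> (A *v w')"
  define b where "b = w' \<bullet> (A *v w') - v' \<bullet> (A *v v')"
  have wAv: "w' \<bullet> (A *v v') = a"
    using symmetric_idempotentD[OF A, of w' v'] by (simp add: a_def inner_commute)
  \<comment> \<open>The competitor replaces \<open>v'\<close> by the normalised
    \<open>v' + s *\<^sub>R w'\<close>; its gain times \<open>1 + s^2\<close> is the left-hand
    side.\<close>
  have key: "2 * s * a + s^2 * b \<le> 0" for s :: real
  proof -
    let ?x = "v' + s *\<^sub>R w'"
    let ?u = "?x /\<^sub>R sqrt (1 + s^2)"
    have pos: "1 + s^2 > 0" by (smt (verit) zero_le_power2)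
    have "?x \<bullet> ?x = 1 + s^2"
      using vv vw by (simp only: inner_add_left inner_add_right inner_scaleR_left inner_scaleR_right
          inner_commute[of w' v']) (simp add: power2_eq_square)
    then have nx: "norm ?x = sqrt (1 + s^2)" by (simp only: norm_eq_sqrt_inner)
    have nu: "norm ?u = 1" unfolding norm_scaleR nx using pos by (simp add: abs_of_pos)
    have vu: "v' \<bullet> ?u = 1 / sqrt (1 + s^2)"
      using vv vw by (simp only: inner_add_right inner_scaleR_right) (simp add: inverse_eq_divide)
    have "P *v ?u - (v' \<bullet> ?u) *\<^sub>R v' = 0"
      unfolding vu matrix_vector_mult_scaleR matrix_vector_right_distrib Pv
      by (simp add: inverse_eq_divide)
    then have "P - outer v' + outer ?u \<in> proj_rank p"
      using proj_exchange[OF P Pv(1) nv(1) nu] by simp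
    then have "A \<bullet> (P - outer v' + outer ?u) \<le> A \<bullet> P" using mp by (simp add: max_proj_def)
    then have "?u \<bullet> (A *v ?u) \<le> v' \<bullet> (A *v v')"
      by (simp only: inner_add_right inner_diff_right inner_outer)
    moreover have "?u \<bullet> (A *v ?u) = (?x \<bullet> (A *v ?x)) / (1 + s^2)"
      using pos by (simp only: matrix_vector_mult_scaleR inner_scaleR_left inner_scaleR_right)
        (simp add: field_simps flip: real_sqrt_mult)
    ultimately have "?x \<bullet> (A *v ?x) \<le> v' \<bullet> (A *v v') * (1 + s^2)"
      using pos by (simp only: pos_divide_le_eq)
    moreover have "?x \<bullet> (A *v ?x) = v' \<bullet> (A *v v') + 2 * s * a + s^2 * (w' \<bullet> (A *v w'))"
      using wAv by (simp only: matrix_vector_mult_scaleR matrix_vector_right_distrib inner_add_left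
          inner_add_right inner_scaleR_left inner_scaleR_right a_def[symmetric])
        (simp add: power2_eq_square algebra_simps)
    ultimately show ?thesis by (simp only: b_def) (simp add: algebra_simps)
  qed
  have "a = 0"
  proof (rule ccontr)
    assume "a \<noteq> 0"
    \<comment> \<open>With this step length the quadratic term is less than half of the linear one
      in absolute value, so the sign of \<open>2 * s * a\<close> prevails.\<close>
    define s where "s = a / (1 + \<bar>b\<bar>)"
    have bp: "1 + \<bar>b\<bar> > 0" by simp
    have "2 * s * a + s^2 * b = a^2 / (1 + \<bar>b\<bar>) * (2 + b / (1 + \<bar>b\<bar>))"
      by (simp add: s_def power2_eq_square algebra_simps)
    moreover have "b / (1 + \<bar>b\<bar>) > - 1"
      using bp by (simp add: pos_less_divide_eq)
    ultimately have "2 * s * a + s^2 * b > 0"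
      using bp \<open>a \<noteq> 0\<close> by (simp add: zero_less_mult_iff)
    then show False using key[of s] by simp
  qed
  then have "(1 / norm v) * (1 / norm w) * (v \<bullet> (A *v w)) = 0"
    by (auto simp add: a_def v'_def w'_def matrix_vector_mult_scaleR divide_inverse)
  then show ?thesis using False by simp
qed

text \<open>The off-diagonal block vanishes by \<open>max_proj_offdiag\<close>, so
  \<open>P ** A\<close> equals the symmetric matrix \<open>P ** A ** P\<close>; transposing gives
  the claim.\<close>

lemma max_proj_commute:
  fixes A P :: "real^'d^'d"
  assumes mp: "max_proj p A P" and A: "transpose A = A"
  shows "A ** P = P ** A"
proof -
  have P: "P \<in> proj_rank p" using mp by (simp add: max_proj_def)
  have off: "P ** A ** (mat 1 - P) = 0"
  proof -
    have "x \<bullet> ((P ** A ** (mat 1 - P)) *v y) = 0" for x y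
    proof -
      have "x \<bullet> ((P ** A ** (mat 1 - P)) *v y) = (P *v x) \<bullet> (A *v ((mat 1 - P) *v y))"
        using symmetric_idempotentD[OF proj_rankD(2)[OF P]]
        by (simp add: matrix_vector_mul_assoc[symmetric])
      also have "\<dots> = 0"
        using mp A
      proof (rule max_proj_offdiag)
        show "P *v (P *v x) = P *v x" by (simp add: matrix_vector_mul_assoc proj_rankD[OF P])
        show "P *v ((mat 1 - P) *v y) = 0"
          by (simp add: matrix_vector_mul_assoc matrix_mult_simps proj_rankD[OF P])
      qed
      finally show ?thesis .
    qed
    then have "(P ** A ** (mat 1 - P)) *v y = 0 *v y" for y
      by (metis inner_eq_zero_iff matrix_vector_mult_0)
    then show ?thesis unfolding matrix_eq by blast
  qed
  then have *: "P ** A = P ** A ** P" by (simp add: matrix_mult_simps)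
  have "transpose (P ** A) = transpose (P ** A ** P)" using * by simp
  then have "A ** P = P ** A ** P"
    by (simp add: matrix_transpose_mul A proj_rankD[OF P] matrix_mul_assoc)
  with * show ?thesis by simp
qed

text \<open>Expanding the square, commutation reduces every mixed term to
  \<open>(A ** P) \<bullet> Q\<close>, and these cancel. The reflection
  \<open>2 *\<^sub>R P - mat 1\<close> is +1 on the range of \<open>P\<close> and -1 on its
  complement.\<close>

lemma loss_quadratic:
  fixes A P Q :: "real^'d^'d"
  assumes P: "P \<in> proj_rank p" and Q: "Q \<in> proj_rank p"
    and A: "transpose A = A" and comm: "A ** P = P ** A"
  shows "A \<bullet> (P - Q) = (A ** (2 *\<^sub>R P - mat 1)) \<bullet> ((P - Q) ** (P - Q))"
proof -
  note PQ = proj_rankD[OF P] proj_rankD[OF Q]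
  have sq: "(P - Q) ** (P - Q) = P - P ** Q - Q ** P + Q" by (simp add: matrix_mult_simps PQ)
  have 1: "(A ** P) \<bullet> P = A \<bullet> P" by (simp add: inner_mult_right PQ)
  have 2: "(A ** P) \<bullet> (Q ** P) = (A ** P) \<bullet> Q"
    using inner_mult_right[of "A ** P" P Q] by (simp add: PQ)
  have 3: "(A ** P) \<bullet> (P ** Q) = (A ** P) \<bullet> Q"
    using inner_mult_left[of P "P ** A" Q] comm by (simp add: PQ matrix_mul_assoc)
  have 4: "A \<bullet> (Q ** P) = (A ** P) \<bullet> Q" by (simp add: inner_mult_right PQ)
  have 5: "A \<bullet> (P ** Q) = (A ** P) \<bullet> Q"
    using inner_mult_left[of P A Q] comm by (simp add: PQ)
  show ?thesis
    unfolding sq by (simp add: matrix_mult_simps inner_diff_left inner_diff_right inner_add_right inner_add_left 1 2 3 4 5)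
qed

lemma inner_square_eq_norm:
  fixes P X :: "real^'d^'d"
  assumes "P ** P = P" "transpose P = P" "transpose X = X"
  shows "P \<bullet> (X ** X) = (norm (P ** X))\<^sup>2"
proof -
  have "(P ** X) \<bullet> (P ** X) = P \<bullet> (P ** (X ** X))"
    using inner_mult_right[of P X "P ** X"] assms by (simp add: matrix_mul_assoc)
  also have "\<dots> = P \<bullet> (X ** X)" using inner_mult_left[of P P "X ** X"] assms by simp
  finally show ?thesis by (simp add: power2_norm_eq_inner)
qed

text \<open>Equality of the ranks is what makes the squared distance split evenly between the range
  of \<open>P\<close> and its complement.\<close>

lemma proj_diff_half:
  fixes P Q :: "real^'d^'d"
  assumes P: "P \<in> proj_rank p" and Q: "Q \<in> proj_rank p"
  shows "P \<bullet> ((P - Q) ** (P - Q)) = (norm (P - Q))\<^sup>2 / 2"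
    "mat 1 \<bullet> ((P - Q) ** (P - Q)) = (norm (P - Q))\<^sup>2"
proof -
  note PQ = proj_rankD[OF P] proj_rankD[OF Q]
  have sq: "(P - Q) ** (P - Q) = P - P ** Q - Q ** P + Q" by (simp add: matrix_mult_simps PQ)
  have self: "P \<bullet> P = p" "Q \<bullet> Q = p" by (simp_all add: inner_matrix_trace PQ)
  have 1: "P \<bullet> (P ** Q) = P \<bullet> Q" using inner_mult_left[of P P Q] by (simp add: PQ)
  have 2: "P \<bullet> (Q ** P) = P \<bullet> Q" using inner_mult_right[of P P Q] by (simp add: PQ)
  have "(norm (P - Q))\<^sup>2 = 2 * (p - P \<bullet> Q)"
    by (simp add: power2_norm_eq_inner inner_diff_left inner_diff_right self inner_commute)
  then show "P \<bullet> ((P - Q) ** (P - Q)) = (norm (P - Q))\<^sup>2 / 2"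
    unfolding sq by (simp add: inner_add_right inner_diff_right 1 2 self)
  show "mat 1 \<bullet> ((P - Q) ** (P - Q)) = (norm (P - Q))\<^sup>2"
    by (subst inner_square_eq_norm) (simp_all add: transpose_simps PQ)
qed

section \<open>Perturbation of the leading eigenspace\<close>

locale spectral_decomposition =
  fixes S :: "real^'d^'d" and Pr :: "nat \<Rightarrow> real^'d^'d" and \<mu> :: "nat \<Rightarrow> real" and D J p :: nat
  assumes Pr_sym: "j \<in> {1..D} \<Longrightarrow> transpose (Pr j) = Pr j"
    and Pr_mult: "j \<in> {1..D} \<Longrightarrow> m \<in> {1..D} \<Longrightarrow> Pr j ** Pr m = (if j = m then Pr j else 0)"
    and Pr_sum: "(\<Sum>j=1..D. Pr j) = mat 1"
    and S_eq: "S = (\<Sum>j=1..D. \<mu> j *\<^sub>R Pr j)"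
    and \<mu>_dec: "1 \<le> i \<Longrightarrow> i < j \<Longrightarrow> j \<le> D \<Longrightarrow> \<mu> j < \<mu> i"
    and J: "1 \<le> J" "J < D"
    and trace_top: "trace (\<Sum>j=1..J. Pr j) = real p"
begin

definition top :: "real^'d^'d" where "top = (\<Sum>j=1..J. Pr j)"

definition loss_form :: "real^'d^'d \<Rightarrow> real" where
  "loss_form E = (\<Sum>j=1..J. \<Sum>m=J+1..D. 1 / (\<mu> j - \<mu> m) * (norm (Pr j ** E ** Pr m))\<^sup>2)"

text \<open>Half the spectral gap at the cut; the factor 1/2 is the one in
  \<open>proj_diff_half\<close>.\<close>

definition gap :: real where "gap = (\<mu> J - \<mu> (Suc J)) / 2"

lemma gap_pos: "gap > 0"
  using \<mu>_dec[of J "Suc J"] J by (simp add: gap_def)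

lemma Pr_top: "j \<in> {1..D} \<Longrightarrow> Pr j ** top = (if j \<le> J then Pr j else 0)"
  "j \<in> {1..D} \<Longrightarrow> top ** Pr j = (if j \<le> J then Pr j else 0)"
proof -
  assume j: "j \<in> {1..D}"
  have "Pr j ** top = (\<Sum>m=1..J. if j = m then Pr j else 0)"
    unfolding top_def mm.sum_right using j J by (intro sum.cong) (auto simp: Pr_mult)
  then show "Pr j ** top = (if j \<le> J then Pr j else 0)" using j by simp
  have "top ** Pr j = (\<Sum>m=1..J. if j = m then Pr j else 0)"
    unfolding top_def mm.sum_left using j J by (intro sum.cong) (auto simp: Pr_mult)
  then show "top ** Pr j = (if j \<le> J then Pr j else 0)" using j by simp
qed

lemma top_proj: "top \<in> proj_rank p"
proof -
  have "top ** top = (\<Sum>j=1..J. Pr j ** top)" by (subst (1) top_def) (simp add: mm.sum_left)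
  also have "\<dots> = top" unfolding top_def[symmetric] using J
    by (subst (2) top_def) (intro sum.cong, auto simp: Pr_top)
  moreover have "transpose top = top"
    unfolding top_def using J unfolding transpose_simps by (intro sum.cong refl) (simp add: transpose_simps Pr_sym)
  ultimately show ?thesis using trace_top by (simp add: proj_rank_def top_def)
qed

lemma S_sym: "transpose S = S"
  unfolding S_eq unfolding transpose_simps by (intro sum.cong refl) (simp add: transpose_simps Pr_sym)

lemma Pr_S: "j \<in> {1..D} \<Longrightarrow> Pr j ** S = \<mu> j *\<^sub>R Pr j"
  "j \<in> {1..D} \<Longrightarrow> S ** Pr j = \<mu> j *\<^sub>R Pr j"
proof -
  assume j: "j \<in> {1..D}"
  have "Pr j ** S = (\<Sum>m=1..D. if j = m then \<mu> j *\<^sub>R Pr j else 0)"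
    unfolding S_eq mm.sum_right using j by (intro sum.cong) (auto simp: Pr_mult mm.scaleR_right)
  then show "Pr j ** S = \<mu> j *\<^sub>R Pr j" using j by simp
  have "S ** Pr j = (\<Sum>m=1..D. if j = m then \<mu> j *\<^sub>R Pr j else 0)"
    unfolding S_eq mm.sum_left using j by (intro sum.cong) (auto simp: Pr_mult mm.scaleR_left)
  then show "S ** Pr j = \<mu> j *\<^sub>R Pr j" using j by simp
qed

lemma S_top_commute: "S ** top = top ** S"
  unfolding top_def mm.sum_left mm.sum_right using J by (intro sum.cong) (auto simp: Pr_S)

lemma S_reflect: "S ** (2 *\<^sub>R top - mat 1) = (\<Sum>j=1..D. ((if j \<le> J then 1 else - 1) * \<mu> j) *\<^sub>R Pr j)"
proof -
  have "S ** (2 *\<^sub>R top - mat 1) = (\<Sum>j=1..D. \<mu> j *\<^sub>R (Pr j ** (2 *\<^sub>R top - mat 1)))"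
    by (subst S_eq) (simp add: mm.sum_left mm.scaleR_left)
  also have "\<dots> = (\<Sum>j=1..D. ((if j \<le> J then 1 else - 1) * \<mu> j) *\<^sub>R Pr j)"
  proof (intro sum.cong refl)
    fix j assume j: "j \<in> {1..D}"
    have "Pr j ** (2 *\<^sub>R top - mat 1) = 2 *\<^sub>R (Pr j ** top) - Pr j"
      by (simp only: mm.diff_right mm.scaleR_right matrix_mul_rid)
    also have "\<dots> = (if j \<le> J then 1 else - 1) *\<^sub>R Pr j" using j by (simp add: Pr_top scaleR_2)
    finally show "\<mu> j *\<^sub>R (Pr j ** (2 *\<^sub>R top - mat 1)) = ((if j \<le> J then 1 else - 1) * \<mu> j) *\<^sub>R Pr j"
      by simp
  qed
  finally show ?thesis .
qed

lemma sum_split: "(\<Sum>j=1..D. f j) = (\<Sum>j=1..J. f j) + (\<Sum>j=J+1..D. (f j :: 'b::comm_monoid_add))"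
  using sum.ub_add_nat[of 1 J f "D - J"] J by simp

text \<open>The weights \<open>x j\<close> are nonnegative and add up to
  \<open>(norm X)\<^sup>2\<close>. The eigenvalues above the cut are bounded below by
  \<open>\<mu> J\<close>, those beyond it above by \<open>\<mu> (Suc J)\<close>. If each side
  carried half of the weight, the result would be the \<open>gap\<close> term alone; the second term
  corrects for \<open>P\<close> being merely close to \<open>top\<close>.\<close>

lemma reflect_lower:
  fixes X :: "real^'d^'d"
  assumes X: "transpose X = X" and P: "P \<bullet> (X ** X) = (norm X)\<^sup>2 / 2"
  shows "(S ** (2 *\<^sub>R top - mat 1)) \<bullet> (X ** X) \<ge>
    gap * (norm X)\<^sup>2 + (\<mu> J + \<mu> (Suc J)) * ((top - P) \<bullet> (X ** X))"
proof -
  define x where "x j = Pr j \<bullet> (X ** X)" for j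
  have x0: "x j \<ge> 0" if "j \<in> {1..D}" for j
    unfolding x_def using inner_square_eq_norm[of "Pr j" X] that Pr_mult Pr_sym X by simp
  have tot: "(\<Sum>j=1..D. x j) = (norm X)\<^sup>2"
    unfolding x_def inner_sum_left[symmetric] Pr_sum
    by (subst inner_square_eq_norm) (simp_all add: X)
  have top: "(\<Sum>j=1..J. x j) = top \<bullet> (X ** X)"
    unfolding x_def top_def by (simp add: inner_sum_left)
  have "(S ** (2 *\<^sub>R top - mat 1)) \<bullet> (X ** X) = (\<Sum>j=1..D. (if j \<le> J then 1 else - 1) * \<mu> j * x j)"
    unfolding S_reflect by (simp add: inner_sum_left x_def)
  also have "\<dots> = (\<Sum>j=1..J. \<mu> j * x j) - (\<Sum>j=J+1..D. \<mu> j * x j)"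
    unfolding sum_split diff_conv_add_uminus sum_negf[symmetric]
    by (intro arg_cong2[of _ _ _ _ "(+)"] sum.cong) auto
  finally have eq: "(S ** (2 *\<^sub>R top - mat 1)) \<bullet> (X ** X) = \<dots>" .
  have "(\<Sum>j=1..J. \<mu> j * x j) \<ge> (\<Sum>j=1..J. \<mu> J * x j)"
    using \<mu>_dec[of _ J] J by (intro sum_mono mult_right_mono x0) (auto simp: le_less)
  moreover have "(\<Sum>j=J+1..D. \<mu> j * x j) \<le> (\<Sum>j=J+1..D. \<mu> (Suc J) * x j)"
    using \<mu>_dec[of "Suc J"] J by (intro sum_mono mult_right_mono x0) (auto simp: le_less Suc_le_eq)
  moreover have "(\<Sum>j=J+1..D. x j) = (norm X)\<^sup>2 - top \<bullet> (X ** X)"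
    using tot top sum_split[of x] by simp
  ultimately have "(S ** (2 *\<^sub>R top - mat 1)) \<bullet> (X ** X) \<ge>
      \<mu> J * (top \<bullet> (X ** X)) - \<mu> (Suc J) * ((norm X)\<^sup>2 - top \<bullet> (X ** X))"
    unfolding eq by (simp only: sum_distrib_left[symmetric] top)
  moreover have "gap * n + (a + b) * (t - n / 2) = a * t - b * (n - t)"
    if "a = \<mu> J" "b = \<mu> (Suc J)" for a b n t
    using that by (simp add: gap_def field_simps)
  ultimately show ?thesis unfolding inner_diff_left P by simp
qed

text \<open>A bound of Davis-Kahan type: the loss of \<open>R\<close> under \<open>S\<close> grows
  at least quadratically in its distance from \<open>top\<close>, while maximality of
  \<open>R\<close> for \<open>B\<close> and the Cauchy-Schwarz inequality bound it linearly.\<close>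

lemma max_proj_dist_top:
  assumes R: "max_proj p B R"
  shows "gap * norm (top - R) \<le> norm (S - B)"
proof (cases "top = R")
  case False
  have Rp: "R \<in> proj_rank p" using R by (simp add: max_proj_def)
  have sym: "transpose (top - R) = top - R" using proj_rankD[OF Rp] proj_rankD[OF top_proj] by (simp add: transpose_simps)
  have "gap * (norm (top - R))\<^sup>2 \<le> S \<bullet> (top - R)"
    using reflect_lower[OF sym proj_diff_half(1)[OF top_proj Rp]]
    by (simp add: loss_quadratic[OF top_proj Rp S_sym S_top_commute])
  also have "\<dots> = (S - B) \<bullet> (top - R) + B \<bullet> (top - R)" by (simp add: inner_diff_left)
  also have "B \<bullet> (top - R) \<le> 0" using R top_proj by (simp add: max_proj_def inner_diff_right)
  also have "(S - B) \<bullet> (top - R) \<le> norm (S - B) * norm (top - R)" by (rule norm_cauchy_schwarz)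
  finally show ?thesis using False by (simp add: power2_eq_square)
qed simp

text \<open>In block coordinates the assumption \<open>off\<close> removes the blocks on one side of
  the cut, and the Sylvester equation determines the remaining ones as those of \<open>E\<close>
  divided by \<open>\<mu> j - \<mu> m\<close>. The squared denominator loses one factor to the
  weight of the block.\<close>

lemma loss_form_eq:
  assumes X: "transpose X = X" and off: "top ** X + X ** top = X"
    and syl: "S ** X - X ** S = top ** E - E ** top"
  shows "(S ** (2 *\<^sub>R top - mat 1)) \<bullet> (X ** X) = loss_form E"
proof -
  define F where "F j m = Pr j ** X ** Pr m" for j m
  define a where "a j m = (norm (F j m))\<^sup>2" for j m
  have a_sym: "a j m = a m j" if "j \<in> {1..D}" "m \<in> {1..D}" for j m
  proof -
    have "transpose (F j m) = F m j"
      using that by (simp add: F_def matrix_transpose_mul Pr_sym X matrix_mul_assoc)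
    then show ?thesis unfolding a_def using norm_transpose[of "F j m"] by simp
  qed
  \<comment> \<open>For both indices on the same side of the cut, \<open>off\<close> reads F = 2F or
    F = 0.\<close>
  have F_off: "F j m = 0" if "j \<in> {1..D}" "m \<in> {1..D}" "j \<le> J \<longleftrightarrow> m \<le> J" for j m
  proof -
    have "F j m = Pr j ** (top ** X + X ** top) ** Pr m" unfolding off F_def ..
    also have "\<dots> = Pr j ** top ** X ** Pr m + Pr j ** X ** (top ** Pr m)"
      by (simp add: matrix_mult_simps)
    also have "\<dots> = (if j \<le> J then F j m else 0) + (if m \<le> J then F j m else 0)"
      using that(1,2) by (simp add: Pr_top F_def matrix_mult_simps)
    finally show ?thesis using that(3) by (auto split: if_splits)
  qed
  have F_eq: "(\<mu> j - \<mu> m) *\<^sub>R F j m = Pr j ** E ** Pr m"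
    if "j \<in> {1..J}" "m \<in> {J+1..D}" for j m
  proof -
    have jm: "j \<in> {1..D}" "m \<in> {1..D}" "j \<le> J" "\<not> m \<le> J" using that J by auto
    have "Pr j ** (S ** X - X ** S) ** Pr m = Pr j ** S ** X ** Pr m - Pr j ** X ** (S ** Pr m)"
      by (simp add: matrix_mult_simps)
    also have "\<dots> = (\<mu> j - \<mu> m) *\<^sub>R F j m"
      using jm by (simp add: Pr_S F_def matrix_mult_simps scaleR_diff_left)
    finally have 1: "Pr j ** (S ** X - X ** S) ** Pr m = \<dots>" .
    have "Pr j ** (top ** E - E ** top) ** Pr m = Pr j ** top ** E ** Pr m - Pr j ** E ** (top ** Pr m)"
      by (simp add: matrix_mult_simps)
    also have "\<dots> = Pr j ** E ** Pr m"
      using jm by (simp add: Pr_top matrix_mult_simps)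
    finally show ?thesis using 1 syl by simp
  qed
  have sum_a: "Pr j \<bullet> (X ** X) = (\<Sum>m=1..D. a j m)" if "j \<in> {1..D}" for j
  proof -
    have "Pr j \<bullet> (X ** X) = (Pr j ** X) \<bullet> (Pr j ** X ** (\<Sum>m=1..D. Pr m))"
      unfolding Pr_sum matrix_mul_rid power2_norm_eq_inner[symmetric]
      using that by (intro inner_square_eq_norm) (simp_all add: Pr_mult Pr_sym X)
    also have "\<dots> = (\<Sum>m=1..D. (Pr j ** X) \<bullet> (Pr j ** X ** Pr m))"
      by (simp add: mm.sum_right inner_sum_right)
    also have "\<dots> = (\<Sum>m=1..D. a j m)"
    proof (intro sum.cong refl)
      fix m assume m: "m \<in> {1..D}"
      have "a j m = (Pr j ** X ** Pr m) \<bullet> (Pr j ** X ** Pr m)"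
        by (simp add: a_def F_def power2_norm_eq_inner)
      also have "\<dots> = (Pr j ** X) \<bullet> (Pr j ** X ** (Pr m ** Pr m))"
        using inner_mult_right[of "Pr j ** X" "Pr m" "Pr j ** X ** Pr m"] m
        by (simp add: Pr_sym matrix_mul_assoc)
      finally show "(Pr j ** X) \<bullet> (Pr j ** X ** Pr m) = a j m" using m by (simp add: Pr_mult)
    qed
    finally show ?thesis .
  qed
  have "(S ** (2 *\<^sub>R top - mat 1)) \<bullet> (X ** X) = (\<Sum>j=1..D. (if j \<le> J then 1 else - 1) * \<mu> j * (\<Sum>m=1..D. a j m))"
    unfolding S_reflect unfolding inner_sum_left by (intro sum.cong refl) (simp add: sum_a)
  also have "\<dots> = (\<Sum>j=1..J. \<mu> j * (\<Sum>m=1..D. a j m)) - (\<Sum>j=J+1..D. \<mu> j * (\<Sum>m=1..D. a j m))"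
    unfolding sum_split[of "\<lambda>j. (if j \<le> J then 1 else - 1) * \<mu> j * (\<Sum>m=1..D. a j m)"]
      diff_conv_add_uminus sum_negf[symmetric]
    by (intro arg_cong2[of _ _ _ _ "(+)"] sum.cong) auto
  also have "(\<Sum>j=1..J. \<mu> j * (\<Sum>m=1..D. a j m)) = (\<Sum>j=1..J. \<Sum>m=J+1..D. \<mu> j * a j m)"
    unfolding sum_split sum_distrib_left[symmetric]
    using J F_off by (intro sum.cong) (auto simp: a_def)
  also have "(\<Sum>j=J+1..D. \<mu> j * (\<Sum>m=1..D. a j m)) = (\<Sum>j=J+1..D. \<Sum>m=1..J. \<mu> j * a j m)"
    unfolding sum_split[of "a _"] sum_distrib_left[symmetric]
    using J F_off by (intro sum.cong) (auto simp: a_def)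
  \<comment> \<open>Symmetry of \<open>X\<close> matches block (j, m) with block (m, j), so each
    pair across the cut carries the weight \<open>\<mu> j - \<mu> m\<close>.\<close>
  also have "\<dots> = (\<Sum>j=1..J. \<Sum>m=J+1..D. \<mu> m * a j m)"
    using J by (subst sum.swap) (auto intro!: sum.cong simp: a_sym)
  also have "(\<Sum>j=1..J. \<Sum>m=J+1..D. \<mu> j * a j m) - \<dots> = (\<Sum>j=1..J. \<Sum>m=J+1..D. (\<mu> j - \<mu> m) * a j m)"
    by (simp add: sum_subtractf left_diff_distrib)
  also have "\<dots> = loss_form E"
    unfolding loss_form_def
  proof (intro sum.cong refl)
    fix j m assume jm: "j \<in> {1..J}" "m \<in> {J+1..D}"
    have pos: "\<mu> j - \<mu> m > 0" using \<mu>_dec[of j m] jm J by auto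
    have "norm (Pr j ** E ** Pr m) = (\<mu> j - \<mu> m) * norm (F j m)"
      using pos by (simp flip: F_eq[OF jm])
    then show "(\<mu> j - \<mu> m) * a j m = 1 / (\<mu> j - \<mu> m) * (norm (Pr j ** E ** Pr m))\<^sup>2"
      using pos by (simp add: a_def power_mult_distrib power2_eq_square)
  qed
  finally show ?thesis .
qed

lemma tendsto_loss_form [tendsto_intros]: "(f \<longlongrightarrow> E) F \<Longrightarrow> ((\<lambda>x. loss_form (f x)) \<longlongrightarrow> loss_form E) F"
  unfolding loss_form_def by (intro tendsto_intros mm.tendsto)

text \<open>The directions \<open>E n\<close> are only bounded, so the loss is compared with
  \<open>loss_form (E n)\<close> along a subsequence; this is enough for the contradiction in
  \<open>loss_uniform\<close>.\<close>

lemma loss_sequence: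
  assumes A: "A \<longlonglongrightarrow> S" "\<And>n. transpose (A n) = A n"
    and d: "d \<longlonglongrightarrow> 0" "\<And>n. d n > 0"
    and E: "\<And>n. norm (E n) \<le> K" "\<And>n. transpose (E n) = E n"
    and P: "\<And>n. max_proj p (A n) (P n)" and Q: "\<And>n. max_proj p (A n + d n *\<^sub>R E n) (Q n)"
  shows "\<exists>r. strict_mono r \<and> (\<lambda>n. A (r n) \<bullet> (P (r n) - Q (r n)) / (d (r n))\<^sup>2 - loss_form (E (r n))) \<longlonglongrightarrow> 0"
proof -
  have K0: "K \<ge> 0" using E(1)[of 0] norm_ge_zero order_trans by blast
  have Pp: "P n \<in> proj_rank p" and Qp: "Q n \<in> proj_rank p" for n
    using P Q by (auto simp: max_proj_def)
  note PQ = proj_rankD[OF Pp] proj_rankD[OF Qp]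
  define X where "X n = P n - Q n" for n
  have Xs: "transpose (X n) = X n" for n by (simp add: X_def transpose_simps PQ)
  have dE: "(\<lambda>n. d n *\<^sub>R E n) \<longlonglongrightarrow> 0"
  proof (rule Lim_null_comparison)
    show "eventually (\<lambda>n. norm (d n *\<^sub>R E n) \<le> d n * K) sequentially"
      using d(2) E(1) by (intro always_eventually allI) (simp add: abs_of_pos mult_left_mono)
    show "(\<lambda>n. d n * K) \<longlonglongrightarrow> 0" using d(1) by (auto intro: tendsto_eq_intros)
  qed
  have to_top: "R \<longlonglongrightarrow> top" if R: "\<And>n. max_proj p (B n) (R n)" "B \<longlonglongrightarrow> S" for B R
  proof -
    have "(\<lambda>n. top - R n) \<longlonglongrightarrow> 0"
    proof (rule Lim_null_comparison)
      show "eventually (\<lambda>n. norm (top - R n) \<le> norm (S - B n) / gap) sequentially"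
        using max_proj_dist_top[OF R(1)] gap_pos by (intro always_eventually allI) (simp add: field_simps)
      show "(\<lambda>n. norm (S - B n) / gap) \<longlonglongrightarrow> 0"
        using tendsto_divide[OF tendsto_norm[OF tendsto_diff[OF tendsto_const R(2)]] tendsto_const, of gap S]
          gap_pos by simp
    qed
    from tendsto_diff[OF tendsto_const[of top] this] show ?thesis by simp
  qed
  have Plim: "P \<longlonglongrightarrow> top" using to_top[OF P A(1)] .
  have Qlim: "Q \<longlonglongrightarrow> top" using to_top[OF Q] tendsto_add[OF A(1) dE] by simp
  have loss: "A n \<bullet> X n = (A n ** (2 *\<^sub>R P n - mat 1)) \<bullet> (X n ** X n)" for n
    unfolding X_def by (rule loss_quadratic[OF Pp Qp A(2) max_proj_commute[OF P A(2)]])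
  obtain C where C: "\<And>(a::real^'d^'d) (b::real^'d^'d). norm (a ** b) \<le> norm a * norm b * C" "C > 0"
    using mm.pos_bounded by blast
  define \<kappa> where "\<kappa> n = norm (S ** (2 *\<^sub>R top - mat 1) - A n ** (2 *\<^sub>R P n - mat 1)) * C
    + \<bar>\<mu> J + \<mu> (Suc J)\<bar> * norm (top - P n) * C" for n
  have "\<kappa> \<longlonglongrightarrow> norm (S ** (2 *\<^sub>R top - mat 1) - S ** (2 *\<^sub>R top - mat 1)) * C
    + \<bar>\<mu> J + \<mu> (Suc J)\<bar> * norm (top - top) * C"
    unfolding \<kappa>_def by (intro tendsto_intros mm.tendsto A Plim)
  then have \<kappa>: "\<kappa> \<longlonglongrightarrow> 0" by simp
  have XX: "\<bar>Y \<bullet> (X n ** X n)\<bar> \<le> norm Y * C * (norm (X n))\<^sup>2" for Y n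
  proof -
    have "\<bar>Y \<bullet> (X n ** X n)\<bar> \<le> norm Y * norm (X n ** X n)" by (rule Cauchy_Schwarz_ineq2)
    also have "\<dots> \<le> norm Y * (norm (X n) * norm (X n) * C)" using C(1)[of "X n" "X n"] by (intro mult_left_mono) simp_all
    finally show ?thesis by (simp add: power2_eq_square mult_ac)
  qed
  \<comment> \<open>The lower bound at \<open>S\<close> and \<open>top\<close> passes to
    \<open>A n\<close> and \<open>P n\<close> up to the vanishing error \<open>\<kappa> n\<close>.
    Together with the linear bound \<open>up\<close> it forces \<open>norm (X n)\<close> to be of
    order \<open>d n\<close>.\<close>
  have low: "(gap - \<kappa> n) * (norm (X n))\<^sup>2 \<le> A n \<bullet> X n" for n
  proof -
    let ?G = "S ** (2 *\<^sub>R top - mat 1)" and ?H = "A n ** (2 *\<^sub>R P n - mat 1)"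
    have 1: "gap * (norm (X n))\<^sup>2 + (\<mu> J + \<mu> (Suc J)) * ((top - P n) \<bullet> (X n ** X n)) \<le> ?G \<bullet> (X n ** X n)"
      using reflect_lower[OF Xs] proj_diff_half(1)[OF Pp Qp] by (simp add: X_def)
    have 2: "?G \<bullet> (X n ** X n) - A n \<bullet> X n = (?G - ?H) \<bullet> (X n ** X n)"
      by (simp add: loss inner_diff_left)
    have "\<bar>(\<mu> J + \<mu> (Suc J)) * ((top - P n) \<bullet> (X n ** X n))\<bar> \<le>
      \<bar>\<mu> J + \<mu> (Suc J)\<bar> * (norm (top - P n) * C * (norm (X n))\<^sup>2)"
      unfolding abs_mult by (intro mult_left_mono XX) simp
    with 1 2 XX[of "?G - ?H" n] show ?thesis
      by (simp add: \<kappa>_def algebra_simps abs_le_iff)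
  qed
  \<comment> \<open>\<open>Q n\<close> is optimal for the perturbed matrix, so its loss under
    \<open>A n\<close> is at most what the perturbation gains on the difference.\<close>
  have up: "A n \<bullet> X n \<le> d n * K * norm (X n)" for n
  proof -
    have "(A n + d n *\<^sub>R E n) \<bullet> P n \<le> (A n + d n *\<^sub>R E n) \<bullet> Q n"
      using Q[of n] Pp by (simp add: max_proj_def)
    then have "A n \<bullet> X n \<le> d n * (E n \<bullet> (- X n))"
      by (simp add: X_def inner_diff_right inner_add_left algebra_simps)
    also have "\<dots> \<le> d n * (norm (E n) * norm (- X n))"
      using d(2)[of n] by (intro mult_left_mono norm_cauchy_schwarz) simp
    also have "\<dots> \<le> d n * (K * norm (X n))"
      using d(2)[of n] E(1)[of n] by (intro mult_left_mono) (auto intro: mult_right_mono)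
    finally show ?thesis by (simp add: mult_ac)
  qed
  define Y where "Y n = (1 / d n) *\<^sub>R X n" for n
  have Xd: "X n = d n *\<^sub>R Y n" for n using d(2)[of n] by (simp add: Y_def)
  have "eventually (\<lambda>n. \<kappa> n < gap / 2) sequentially"
    using order_tendstoD(2)[OF \<kappa>, of "gap / 2"] gap_pos by simp
  then have "eventually (\<lambda>n. norm (Y n) \<le> 2 * K / gap) sequentially"
  proof eventually_elim
    case (elim n)
    have "gap / 2 * (norm (X n))\<^sup>2 \<le> (gap - \<kappa> n) * (norm (X n))\<^sup>2"
      using elim by (intro mult_right_mono) auto
    also have "\<dots> \<le> d n * K * norm (X n)" using low[of n] up[of n] by simp
    finally have "norm (X n) * (gap / 2 * norm (X n)) \<le> norm (X n) * (d n * K)"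
      by (simp add: power2_eq_square mult_ac)
    moreover have "d n * K \<ge> 0" using d(2)[of n] K0 by simp
    ultimately have "gap / 2 * norm (X n) \<le> d n * K"
      by (cases "norm (X n) = 0") auto
    then show ?case using d(2)[of n] gap_pos by (simp add: Y_def field_simps)
  qed
  then have "Bseq Y" unfolding Bseq_eq_bounded[symmetric] by (rule BfunI)
  moreover have "Bseq E" using E(1) by (intro BseqI'[of _ K]) auto
  ultimately have "Bseq (\<lambda>n. (E n, Y n))"
    unfolding Bseq_def by (meson add_mono add_pos_pos norm_Pair_le order_trans)
  then have "bounded (range (\<lambda>n. (E n, Y n)))" by (simp add: Bseq_eq_bounded)
  then obtain l r where r: "strict_mono r" and "((\<lambda>n. (E n, Y n)) \<circ> r) \<longlonglongrightarrow> l"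
    using bounded_imp_convergent_subsequence by blast
  then have lim: "(\<lambda>n. E (r n)) \<longlonglongrightarrow> fst l" "(\<lambda>n. Y (r n)) \<longlonglongrightarrow> snd l"
    by (auto simp: o_def dest: tendsto_fst tendsto_snd)
  define E' Y' where "E' = fst l" and "Y' = snd l"
  note lim = lim[folded E'_def Y'_def]
  have sub: "(\<lambda>n. u (r n)) \<longlonglongrightarrow> v" if "u \<longlonglongrightarrow> v" for u :: "nat \<Rightarrow> 'c::topological_space" and v
    using LIMSEQ_subseq_LIMSEQ[OF that r] by (simp add: o_def)
  note lims = lim sub[OF Plim] sub[OF Qlim] sub[OF A(1)] sub[OF d(1)] sub[OF dE]
  have Ysym: "transpose (Y n) = Y n" for n by (simp add: Y_def transpose_simps Xs)
  have Y'sym: "transpose Y' = Y'"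
    using LIMSEQ_unique[OF bounded_linear.tendsto[OF bounded_linear_transpose lim(2)]] lim(2) by (simp add: Ysym)
  \<comment> \<open>Both projections are idempotent. The quadratic term disappears in the limit,
    which leaves the equation of the tangent space of the projections at \<open>top\<close>.\<close>
  have off: "P n ** Y n + Y n ** P n - d n *\<^sub>R (Y n ** Y n) = Y n" for n
  proof -
    have "P n ** X n + X n ** P n - X n ** X n = X n"
      by (simp add: X_def matrix_mult_simps PQ)
    then have "d n *\<^sub>R (P n ** Y n + Y n ** P n - d n *\<^sub>R (Y n ** Y n)) = d n *\<^sub>R Y n"
      by (simp add: Xd matrix_mult_simps scaleR_diff_right scaleR_add_right)
    then show ?thesis using d(2)[of n] by simp
  qed
  have "(\<lambda>n. P (r n) ** Y (r n) + Y (r n) ** P (r n) - d (r n) *\<^sub>R (Y (r n) ** Y (r n)))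
      \<longlonglongrightarrow> top ** Y' + Y' ** top - 0 *\<^sub>R (Y' ** Y')"
    by (intro tendsto_intros mm.tendsto lims)
  then have Y'off: "top ** Y' + Y' ** top = Y'"
    unfolding off using LIMSEQ_unique lim(2) by fastforce
  \<comment> \<open>Difference of two commutation relations: \<open>P n\<close> with
    \<open>A n\<close>, and \<open>Q n\<close> with the perturbed matrix.\<close>
  have syl: "A n ** Y n - Y n ** A n = E n ** Q n - Q n ** E n" for n
  proof -
    have s: "transpose (A n + d n *\<^sub>R E n) = A n + d n *\<^sub>R E n" by (simp add: transpose_simps A E)
    have 1: "A n ** P n = P n ** A n" by (rule max_proj_commute[OF P A(2)])
    have "(A n + d n *\<^sub>R E n) ** Q n = Q n ** (A n + d n *\<^sub>R E n)"
      by (rule max_proj_commute[OF Q s])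
    then have 2: "A n ** Q n + d n *\<^sub>R (E n ** Q n) = Q n ** A n + d n *\<^sub>R (Q n ** E n)"
      by (simp only: mm.add_left mm.add_right mm.scaleR_left mm.scaleR_right)
    have "A n ** X n - X n ** A n = Q n ** A n - A n ** Q n"
      unfolding X_def mm.diff_left mm.diff_right 1 by simp
    also have "\<dots> = d n *\<^sub>R (E n ** Q n - Q n ** E n)"
      using 2 by (simp add: scaleR_diff_right algebra_simps)
    finally have "d n *\<^sub>R (A n ** Y n - Y n ** A n) = d n *\<^sub>R (E n ** Q n - Q n ** E n)"
      by (simp add: Xd mm.scaleR_left mm.scaleR_right scaleR_diff_right)
    then show ?thesis using d(2)[of n] by simp
  qed
  have "(\<lambda>n. A (r n) ** Y (r n) - Y (r n) ** A (r n)) \<longlonglongrightarrow> S ** Y' - Y' ** S"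
    by (intro tendsto_intros mm.tendsto lims)
  moreover have "(\<lambda>n. A (r n) ** Y (r n) - Y (r n) ** A (r n)) \<longlonglongrightarrow> E' ** top - top ** E'"
    unfolding syl by (intro tendsto_intros mm.tendsto lims)
  ultimately have Y'syl: "S ** Y' - Y' ** S = E' ** top - top ** E'" by (rule LIMSEQ_unique)
  have eq: "(S ** (2 *\<^sub>R top - mat 1)) \<bullet> (Y' ** Y') = loss_form E'"
  proof -
    \<comment> \<open>\<open>Y'\<close> is the limit of P - Q, whereas \<open>loss_form_eq\<close>
      has the sign convention of Q - P; the quadratic form does not see the sign.\<close>
    have "top ** (- Y') + (- Y') ** top = - Y'"
      using Y'off by (simp only: mm.minus_left mm.minus_right flip: minus_add_distrib)
    moreover have "S ** (- Y') - (- Y') ** S = top ** E' - E' ** top"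
      using arg_cong[OF Y'syl, of uminus] by (simp add: mm.minus_left mm.minus_right)
    moreover have "transpose (- Y') = - Y'" by (simp add: transpose_simps Y'sym)
    ultimately have "(S ** (2 *\<^sub>R top - mat 1)) \<bullet> ((- Y') ** (- Y')) = loss_form E'"
      by (intro loss_form_eq)
    then show ?thesis by (simp only: mm.minus_left mm.minus_right minus_minus)
  qed
  have "(\<lambda>n. (A (r n) ** (2 *\<^sub>R P (r n) - mat 1)) \<bullet> (Y (r n) ** Y (r n)) - loss_form (E (r n)))
      \<longlonglongrightarrow> (S ** (2 *\<^sub>R top - mat 1)) \<bullet> (Y' ** Y') - loss_form E'"
    by (intro tendsto_intros mm.tendsto lims)
  moreover have "(A n ** (2 *\<^sub>R P n - mat 1)) \<bullet> (Y n ** Y n) = A n \<bullet> (P n - Q n) / (d n)\<^sup>2" for n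
    using loss[of n] d(2)[of n] unfolding X_def[symmetric]
    by (simp add: Xd mm.scaleR_left mm.scaleR_right power2_eq_square)
  ultimately show ?thesis using r unfolding eq by auto
qed

text \<open>A violation at every scale \<open>1 / Suc n\<close> would give sequences contradicting
  \<open>loss_sequence\<close>. Uniformity in \<open>E\<close> is needed because the random matrix
  \<open>S n w\<close> is substituted for it approximately, pointwise on an event of large
  probability.\<close>

lemma loss_uniform:
  assumes "\<eta> > 0"
  shows "\<exists>\<gamma>>0. \<forall>A d E P Q. norm (A - S) < \<gamma> \<longrightarrow> 0 < d \<longrightarrow> d < \<gamma> \<longrightarrow> norm E \<le> K \<longrightarrow>
    transpose A = A \<longrightarrow> transpose E = E \<longrightarrow> max_proj p A P \<longrightarrow> max_proj p (A + d *\<^sub>R E) Q \<longrightarrow>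
    \<bar>A \<bullet> (P - Q) / d\<^sup>2 - loss_form E\<bar> \<le> \<eta>"
proof (rule ccontr)
  assume neg: "\<not> ?thesis"
  have "\<forall>n::nat. \<exists>A d E P Q. norm (A - S) < 1 / Suc n \<and> 0 < d \<and> d < 1 / Suc n \<and> norm E \<le> K \<and>
    transpose A = A \<and> transpose E = E \<and> max_proj p A P \<and> max_proj p (A + d *\<^sub>R E) Q \<and>
    \<not> \<bar>A \<bullet> (P - Q) / d\<^sup>2 - loss_form E\<bar> \<le> \<eta>"
  proof
    fix n :: nat
    have "0 < 1 / real (Suc n)" by simp
    with neg have "\<not> (\<forall>A d E P Q. norm (A - S) < 1 / Suc n \<longrightarrow> 0 < d \<longrightarrow> d < 1 / Suc n \<longrightarrow> norm E \<le> K \<longrightarrow>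
      transpose A = A \<longrightarrow> transpose E = E \<longrightarrow> max_proj p A P \<longrightarrow> max_proj p (A + d *\<^sub>R E) Q \<longrightarrow>
      \<bar>A \<bullet> (P - Q) / d\<^sup>2 - loss_form E\<bar> \<le> \<eta>)" by blast
    then show "\<exists>A d E P Q. norm (A - S) < 1 / Suc n \<and> 0 < d \<and> d < 1 / Suc n \<and> norm E \<le> K \<and>
      transpose A = A \<and> transpose E = E \<and> max_proj p A P \<and> max_proj p (A + d *\<^sub>R E) Q \<and>
      \<not> \<bar>A \<bullet> (P - Q) / d\<^sup>2 - loss_form E\<bar> \<le> \<eta>"
      by (simp only: not_all not_imp conj_assoc)
  qed
  then obtain A d E P Q where *: "\<And>n::nat. norm (A n - S) < 1 / Suc n" "\<And>n. 0 < d n" "\<And>n. d n < 1 / Suc n"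
    "\<And>n. norm (E n) \<le> K" "\<And>n. transpose (A n) = A n" "\<And>n. transpose (E n) = E n"
    "\<And>n. max_proj p (A n) (P n)" "\<And>n. max_proj p (A n + d n *\<^sub>R E n) (Q n)"
    "\<And>n. \<not> \<bar>A n \<bullet> (P n - Q n) / (d n)\<^sup>2 - loss_form (E n)\<bar> \<le> \<eta>"
    by metis
  have z: "(\<lambda>n. 1 / real (Suc n)) \<longlonglongrightarrow> 0" using LIMSEQ_inverse_real_of_nat by (simp add: inverse_eq_divide)
  have d0: "d \<longlonglongrightarrow> 0"
    by (rule tendsto_sandwich[OF _ _ tendsto_const z])
      (use *(2,3) less_imp_le in \<open>auto intro!: always_eventually\<close>)
  have "(\<lambda>n. A n - S) \<longlonglongrightarrow> 0"
    by (rule Lim_null_comparison[OF _ z]) (use *(1) less_imp_le in \<open>auto intro!: always_eventually\<close>)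
  then have "A \<longlonglongrightarrow> S" by (simp add: LIM_zero_iff)
  from loss_sequence[OF this *(5) d0 *(2,4,6,7,8)] obtain r where
    "(\<lambda>n. A (r n) \<bullet> (P (r n) - Q (r n)) / (d (r n))\<^sup>2 - loss_form (E (r n))) \<longlonglongrightarrow> 0" by blast
  from LIMSEQ_D[OF this assms] obtain n where
    "\<bar>A (r n) \<bullet> (P (r n) - Q (r n)) / (d (r n))\<^sup>2 - loss_form (E (r n))\<bar> < \<eta>" by auto
  then show False using *(9)[of "r n"] by simp
qed

lemma loss_form_nonneg: "loss_form E \<ge> 0"
  unfolding loss_form_def
proof (intro sum_nonneg mult_nonneg_nonneg)
  show "0 \<le> 1 / (\<mu> j - \<mu> m)" if "j \<in> {1..J}" "m \<in> {J+1..D}" for j m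
    using \<mu>_dec[of j m] that by auto
qed simp

end

section \<open>Eigenspaces with ordered eigenvalues as a spectral decomposition\<close>

lemma block_exists:
  fixes N :: "nat \<Rightarrow> nat"
  assumes "N 0 = 0" "1 \<le> m" "m \<le> N D"
  shows "\<exists>j\<in>{1..D}. N (j - 1) < m \<and> m \<le> N j"
  using assms(3)
proof (induction D)
  case 0
  then show ?case using assms by simp
next
  case (Suc D)
  show ?case
  proof (cases "m \<le> N D")
    case True
    then show ?thesis using Suc.IH by force
  next
    case False
    then show ?thesis using Suc.prems by (intro bexI[of _ "Suc D"]) auto
  qed
qed

lemma eigenspace_subspace: "subspace (eigenspace A c)"
  unfolding eigenspace_def
  by (auto simp: subspace_def matrix_vector_right_distrib matrix_vector_mult_scaleR scaleR_add_right)

lemma eigen_proj_absorb: "A ** orth_proj (eigenspace A c) = c *\<^sub>R orth_proj (eigenspace A c)"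
proof -
  have "A *v (orth_proj (eigenspace A c) *v x) = c *\<^sub>R (orth_proj (eigenspace A c) *v x)" for x
    using orth_proj_props(1)[OF eigenspace_subspace[of A c], of x] unfolding eigenspace_def by blast
  then show ?thesis
    unfolding matrix_eq by (simp add: matrix_vector_mul_assoc[symmetric] scaleR_matrix_vector_assoc)
qed

text \<open>Orthogonality of the eigenprojections comes from symmetry of \<open>S\<close>.
  Completeness comes from counting: \<open>ordered_eigenvalues\<close> makes the dimensions of the
  eigenspaces add up to the dimension of the space.\<close>

lemma spectral_decomposition_eigenspaces:
  fixes S :: "real^'d^'d" and ev \<mu> :: "nat \<Rightarrow> real" and N :: "nat \<Rightarrow> nat" and D J p :: nat
  assumes S: "transpose S = S"
    and ev: "ordered_eigenvalues S ev"
    and distinct: "\<And>i j. 1 \<le> i \<Longrightarrow> i < j \<Longrightarrow> j \<le> D \<Longrightarrow> \<mu> j < \<mu> i"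
    and N: "N 0 = 0" "\<And>j. j < D \<Longrightarrow> N j < N (Suc j)" "N D = CARD('d)"
      "\<And>j m. 1 \<le> j \<Longrightarrow> j \<le> D \<Longrightarrow> N (j - 1) < m \<Longrightarrow> m \<le> N j \<Longrightarrow> ev m = \<mu> j"
    and J: "1 \<le> J" "J < D" "p = N J"
  shows "spectral_decomposition S (\<lambda>j. orth_proj (eigenspace S (\<mu> j))) \<mu> D J p"
proof
  let ?P = "\<lambda>j. orth_proj (eigenspace S (\<mu> j))"
  let ?d = "\<lambda>j. dim (eigenspace S (\<mu> j))"
  have Nmono: "N i \<le> N j" if "i \<le> j" "j \<le> D" for i j
    using that
  proof (induction j)
    case (Suc j)
    then show ?case using N(2)[of j] by (cases "i = Suc j") auto
  qed simp
  have inj: "i = j" if "\<mu> i = \<mu> j" "i \<in> {1..D}" "j \<in> {1..D}" for i j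
    using distinct[of i j] distinct[of j i] that by (cases i j rule: linorder_cases) auto
  have dimW: "?d j = N j - N (j - 1)" if j: "j \<in> {1..D}" for j
  proof -
    have "{m\<in>{1..CARD('d)}. ev m = \<mu> j} = {N (j - 1)<..N j}"
    proof (intro equalityI subsetI)
      fix m assume m: "m \<in> {m\<in>{1..CARD('d)}. ev m = \<mu> j}"
      then obtain i where i: "i \<in> {1..D}" "N (i - 1) < m" "m \<le> N i"
        using block_exists[of N m D] N by auto
      then have "\<mu> i = \<mu> j" using N(4)[of i m] m by auto
      then show "m \<in> {N (j - 1)<..N j}" using inj[of i j] i j by auto
    next
      fix m assume m: "m \<in> {N (j - 1)<..N j}"
      then show "m \<in> {m\<in>{1..CARD('d)}. ev m = \<mu> j}"
        using N(4)[of j m] Nmono[of j D] N(3) j by auto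
    qed
    then show ?thesis using ev unfolding ordered_eigenvalues_def by (metis card_greaterThanAtMost)
  qed
  have proj: "?P j \<in> proj_rank (?d j)" for j
    by (rule orth_proj_in_proj_rank[OF eigenspace_subspace])
  show sym: "transpose (?P j) = ?P j" for j using proj_rankD[OF proj] by blast
  have PS: "S ** ?P j = \<mu> j *\<^sub>R ?P j" for j by (rule eigen_proj_absorb)
  have SP: "?P j ** S = \<mu> j *\<^sub>R ?P j" for j
    using arg_cong[OF PS[of j], of transpose] by (simp add: matrix_transpose_mul S sym transpose_simps)
  show mult: "?P j ** ?P m = (if j = m then ?P j else 0)" if "j \<in> {1..D}" "m \<in> {1..D}" for j m
  proof (cases "j = m")
    case False
    then have "\<mu> j \<noteq> \<mu> m" using inj that by blast
    moreover have "\<mu> j *\<^sub>R (?P j ** ?P m) = ?P j ** S ** ?P m" by (simp add: SP mm.scaleR_left)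
    moreover have "?P j ** S ** ?P m = \<mu> m *\<^sub>R (?P j ** ?P m)"
      by (simp add: PS mm.scaleR_right flip: matrix_mul_assoc)
    ultimately have "\<mu> j *\<^sub>R (?P j ** ?P m) = \<mu> m *\<^sub>R (?P j ** ?P m)" by simp
    with \<open>\<mu> j \<noteq> \<mu> m\<close> show ?thesis using False by simp
  qed (simp add: proj_rankD[OF proj])
  have trace_sum: "trace (\<Sum>j\<in>I. ?P j) = (\<Sum>j\<in>I. trace (?P j))" for I
    by (simp add: trace_def sum.swap[of _ _ I])
  have tr: "trace (\<Sum>j=1..i. ?P j) = real (N i)" if "i \<le> D" for i
    using that
  proof (induction i)
    case (Suc i)
    have "trace (\<Sum>j=1..Suc i. ?P j) = trace (\<Sum>j=1..i. ?P j) + trace (?P (Suc i))"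
      by (simp add: trace_add)
    also have "\<dots> = real (N i) + real (?d (Suc i))"
      using Suc proj_rankD(3)[OF proj] by simp
    also have "\<dots> = real (N (Suc i))" using dimW[of "Suc i"] Suc N(2)[of i] by simp
    finally show ?case .
  qed (simp add: N trace_def)
  show "trace (\<Sum>j=1..J. ?P j) = real p" using tr[of J] J by simp
  define T where "T = (\<Sum>j=1..D. ?P j)"
  have Tsym: "transpose T = T" unfolding T_def by (simp add: transpose_simps sym)
  have PT: "?P j ** T = ?P j" if "j \<in> {1..D}" for j
  proof -
    have "?P j ** T = (\<Sum>m=1..D. if j = m then ?P j else 0)"
      unfolding T_def mm.sum_right using that by (intro sum.cong) (auto simp: mult)
    then show ?thesis using that by simp
  qed
  have TT: "T ** T = T"
  proof -
    have "T ** T = (\<Sum>j=1..D. ?P j ** T)" by (subst (1) T_def) (simp add: mm.sum_left)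
    also have "\<dots> = (\<Sum>j=1..D. ?P j)" by (intro sum.cong refl PT)
    finally show ?thesis by (simp add: T_def)
  qed
  \<comment> \<open>The complement of \<open>T\<close> is a symmetric idempotent, so its squared
    norm is its trace, and the count of dimensions makes that zero.\<close>
  have "(mat 1 - T) \<bullet> (mat 1 - T) = trace (mat 1 - T)"
    by (simp add: inner_matrix_trace transpose_simps Tsym matrix_mult_simps TT)
  also have "\<dots> = 0" using tr[of D] N(3) unfolding T_def[symmetric] by (simp add: trace_sub trace_I)
  finally show "(\<Sum>j=1..D. ?P j) = mat 1" by (simp add: T_def)
  then have "S = S ** (\<Sum>j=1..D. ?P j)" by simp
  also have "\<dots> = (\<Sum>j=1..D. \<mu> j *\<^sub>R ?P j)" by (simp only: mm.sum_right PS)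
  finally show "S = (\<Sum>j=1..D. \<mu> j *\<^sub>R ?P j)" .
qed (use distinct J in auto)

section \<open>Weak convergence from Laplace transforms\<close>

lemma (in prob_space) expectation_diff_le:
  fixes X Y :: "'a \<Rightarrow> real"
  assumes "integrable M X" "integrable M Y" "AE w in M. \<bar>X w - Y w\<bar> \<le> e"
  shows "\<bar>expectation X - expectation Y\<bar> \<le> e"
proof -
  have "\<bar>expectation X - expectation Y\<bar> = \<bar>expectation (\<lambda>w. X w - Y w)\<bar>"
    using assms by simp
  also have "\<dots> \<le> expectation (\<lambda>w. \<bar>X w - Y w\<bar>)" by (rule integral_abs_bound)
  also have "\<dots> \<le> e" using assms by (intro integral_le_const) auto
  finally show ?thesis .
qed

text \<open>Weierstrass approximation on the unit interval reduces continuous test functions to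
  powers.\<close>

lemma moments_conv_continuous:
  fixes Y :: "nat \<Rightarrow> 'a \<Rightarrow> real" and Z :: "'b \<Rightarrow> real" and f :: "real \<Rightarrow> real"
  assumes M: "prob_space M" and M': "prob_space M'"
    and Y[measurable]: "\<And>n. Y n \<in> borel_measurable M" and Z[measurable]: "Z \<in> borel_measurable M'"
    and Yb: "\<And>n. AE w in M. Y n w \<in> {0..1}" and Zb: "AE w in M'. Z w \<in> {0..1}"
    and lim: "\<And>m. (\<lambda>n. \<integral>w. Y n w ^ m \<partial>M) \<longlonglongrightarrow> (\<integral>w. Z w ^ m \<partial>M')"
    and f: "continuous_on UNIV f"
  shows "(\<lambda>n. \<integral>w. f (Y n w) \<partial>M) \<longlonglongrightarrow> (\<integral>w. f (Z w) \<partial>M')"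
proof -
  interpret M: prob_space M by fact
  interpret M': prob_space M' by fact
  have [measurable]: "f \<in> borel_measurable borel" using f by (rule borel_measurable_continuous_onI)
  have int: "integrable M (\<lambda>w. h (Y n w))" "integrable M' (\<lambda>w. h (Z w))"
    if "continuous_on UNIV h" for h :: "real \<Rightarrow> real" and n
  proof -
    have [measurable]: "h \<in> borel_measurable borel" using that by (rule borel_measurable_continuous_onI)
    have "bounded (h ` {0..1})"
      by (intro compact_imp_bounded compact_continuous_image continuous_on_subset[OF that]) auto
    then obtain B where B: "\<And>x. x \<in> {0..1} \<Longrightarrow> norm (h x) \<le> B" unfolding bounded_iff by (meson imageI)
    show "integrable M (\<lambda>w. h (Y n w))"
      by (rule M.integrable_const_bound[of _ B]) (use Yb[of n] B in auto)
    show "integrable M' (\<lambda>w. h (Z w))"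
      by (rule M'.integrable_const_bound[of _ B]) (use Zb B in auto)
  qed
  show ?thesis
  proof (rule LIMSEQ_I)
    fix e :: real assume e: "0 < e"
    obtain g where g: "real_polynomial_function g" "\<And>x. x \<in> {0..1} \<Longrightarrow> \<bar>f x - g x\<bar> < e / 3"
      using Stone_Weierstrass_real_polynomial_function[of "{0..1}" f "e/3"] f e continuous_on_subset
      by (metis compact_Icc subset_UNIV zero_less_divide_iff zero_less_numeral)
    obtain a N where a: "g = (\<lambda>x. \<Sum>i\<le>N. a i * x ^ i)"
      using g(1) unfolding real_polynomial_function_iff_sum by blast
    have gc: "continuous_on UNIV g" unfolding a by (intro continuous_intros)
    have pow: "integrable M (\<lambda>w. a i * Y n w ^ i)" "integrable M' (\<lambda>w. a i * Z w ^ i)" for i n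
      by (intro int[of "\<lambda>x. a i * x ^ i"] continuous_intros)+
    have "(\<lambda>n. \<Sum>i\<le>N. a i * (\<integral>w. Y n w ^ i \<partial>M)) \<longlonglongrightarrow> (\<Sum>i\<le>N. a i * (\<integral>w. Z w ^ i \<partial>M'))"
      by (intro tendsto_intros lim)
    then have "(\<lambda>n. \<integral>w. g (Y n w) \<partial>M) \<longlonglongrightarrow> (\<integral>w. g (Z w) \<partial>M')"
      unfolding a using pow by simp
    from LIMSEQ_D[OF this, of "e/3"] obtain n0 where
      n0: "\<And>n. n \<ge> n0 \<Longrightarrow> \<bar>(\<integral>w. g (Y n w) \<partial>M) - (\<integral>w. g (Z w) \<partial>M')\<bar> < e / 3"
      using e by auto
    have 1: "\<bar>(\<integral>w. f (Y n w) \<partial>M) - (\<integral>w. g (Y n w) \<partial>M)\<bar> \<le> e / 3" for n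
    proof (intro M.expectation_diff_le int f gc)
      show "AE w in M. \<bar>f (Y n w) - g (Y n w)\<bar> \<le> e / 3"
        using Yb[of n] by eventually_elim (rule less_imp_le[OF g(2)])
    qed
    have 2: "\<bar>(\<integral>w. f (Z w) \<partial>M') - (\<integral>w. g (Z w) \<partial>M')\<bar> \<le> e / 3"
    proof (intro M'.expectation_diff_le int f gc)
      show "AE w in M'. \<bar>f (Z w) - g (Z w)\<bar> \<le> e / 3"
        using Zb by eventually_elim (rule less_imp_le[OF g(2)])
    qed
    show "\<exists>n0. \<forall>n\<ge>n0. norm ((\<integral>w. f (Y n w) \<partial>M) - (\<integral>w. f (Z w) \<partial>M')) < e"
    proof (intro exI[of _ n0] allI impI)
      fix n assume "n \<ge> n0"
      from n0[OF this] 1[of n] 2 show "norm ((\<integral>w. f (Y n w) \<partial>M) - (\<integral>w. f (Z w) \<partial>M')) < e"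
        unfolding real_norm_def by linarith
    qed
  qed
qed

text \<open>The Laplace transform at the integers \<open>m\<close> consists of the moments of
  \<open>exp (- Y n w)\<close>, a variable in the unit interval.\<close>

lemma nonneg_laplace_weak_conv:
  fixes Y :: "nat \<Rightarrow> 'a \<Rightarrow> real" and Z :: "'b \<Rightarrow> real"
  assumes M: "prob_space M" and M': "prob_space M'"
    and Y[measurable]: "\<And>n. Y n \<in> borel_measurable M" and Z[measurable]: "Z \<in> borel_measurable M'"
    and Ypos: "\<And>n. AE w in M. Y n w \<ge> 0" and Zpos: "AE w in M'. Z w \<ge> 0"
    and lim: "\<And>m::nat. m > 0 \<Longrightarrow> (\<lambda>n. \<integral>w. exp (- (real m * Y n w)) \<partial>M) \<longlonglongrightarrow> (\<integral>w. exp (- (real m * Z w)) \<partial>M')"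
  shows "weak_conv_m (\<lambda>n. distr M borel (Y n)) (distr M' borel Z)"
proof (rule integral_bdd_continuous_conv_imp_weak_conv)
  interpret M: prob_space M by fact
  interpret M': prob_space M' by fact
  show "real_distribution (distr M borel (Y n))" for n by (rule M.real_distribution_distr) simp
  show "real_distribution (distr M' borel Z)" by (rule M'.real_distribution_distr) simp
  fix f :: "real \<Rightarrow> real" assume f: "\<And>x. isCont f x" and fb: "\<And>x. \<bar>f x\<bar> \<le> 1"
  have [measurable]: "f \<in> borel_measurable borel"
    using f by (intro borel_measurable_continuous_onI) (auto simp: continuous_on_eq_continuous_at)
  have conv: "(\<lambda>n. \<integral>w. h (exp (- Y n w)) \<partial>M) \<longlonglongrightarrow> (\<integral>w. h (exp (- Z w)) \<partial>M')"
    if h: "continuous_on UNIV h" for h :: "real \<Rightarrow> real"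
  proof (rule moments_conv_continuous[OF M M' _ _ _ _ _ h])
    show "AE w in M. exp (- Y n w) \<in> {0..1}" for n using Ypos[of n] by auto
    show "AE w in M'. exp (- Z w) \<in> {0..1}" using Zpos by auto
    show "(\<lambda>n. \<integral>w. exp (- Y n w) ^ m \<partial>M) \<longlonglongrightarrow> (\<integral>w. exp (- Z w) ^ m \<partial>M')" for m
      using lim[of m] by (cases "m = 0") (simp_all add: M.prob_space M'.prob_space flip: exp_of_nat_mult)
  qed measurable
  \<comment> \<open>In the variable x = exp(-y) a bounded continuous \<open>f\<close> may oscillate
    as x tends to 0, that is, as y tends to infinity. The cutoff \<open>c\<close> damps it there so
    that \<open>F\<close> is continuous on the whole line; the error is at most
    \<open>1 - c\<close>.\<close>
  define c where "c \<delta> x = min 1 (x / \<delta>)" for \<delta> x :: real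
  define F where "F \<delta> x = (if x \<le> 0 then 0 else f (- ln x) * c \<delta> x)" for \<delta> x
  have cc: "continuous_on UNIV (c \<delta>)" if "\<delta> > 0" for \<delta>
    unfolding c_def using that by (intro continuous_intros) auto
  have Fc: "continuous_on UNIV (F \<delta>)" if d: "\<delta> > 0" for \<delta>
    unfolding continuous_on_eq_continuous_at[OF open_UNIV]
  proof
    fix x :: real
    consider "x > 0" | "x < 0" | "x = 0" by linarith
    then show "isCont (F \<delta>) x"
    proof cases
      case 1
      have "isCont (\<lambda>x. f (- ln x) * c \<delta> x) x"
        unfolding c_def using 1 d by (intro continuous_intros isCont_o2[OF _ f]) auto
      moreover have "eventually (\<lambda>y. F \<delta> y = f (- ln y) * c \<delta> y) (nhds x)"
        using eventually_nhds_in_open[of "{0<..}" x] 1 by (auto elim!: eventually_mono simp: F_def)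
      ultimately show ?thesis by (subst isCont_cong)
    next
      case 2
      have "eventually (\<lambda>y. F \<delta> y = 0) (nhds x)"
        using eventually_nhds_in_open[of "{..<0}" x] 2 by (auto elim!: eventually_mono simp: F_def)
      then show ?thesis by (subst isCont_cong) auto
    next
      case 3
      have "(F \<delta> \<longlongrightarrow> 0) (at 0)"
      proof (rule Lim_null_comparison)
        show "eventually (\<lambda>y. norm (F \<delta> y) \<le> \<bar>y\<bar> / \<delta>) (at 0)"
        proof (intro always_eventually allI)
          fix y
          have "\<bar>f (- ln y)\<bar> * \<bar>c \<delta> y\<bar> \<le> 1 * (\<bar>y\<bar> / \<delta>)" if "y > 0"
            using that d by (intro mult_mono fb) (auto simp: c_def min_def)
          then show "norm (F \<delta> y) \<le> \<bar>y\<bar> / \<delta>" using d by (auto simp: F_def abs_mult divide_nonpos_pos)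
        qed
        show "((\<lambda>y. \<bar>y\<bar> / \<delta>) \<longlongrightarrow> 0) (at 0)" using d by (auto intro!: tendsto_eq_intros)
      qed
      then show ?thesis using 3 by (simp add: isCont_def F_def)
    qed
  qed
  have c01: "0 \<le> c \<delta> (exp y)" "c \<delta> (exp y) \<le> 1" if "\<delta> > 0" for \<delta> y
    using that by (auto simp: c_def)
  have bd: "\<bar>f y - F \<delta> (exp (- y))\<bar> \<le> 1 - c \<delta> (exp (- y))" if "\<delta> > 0" for \<delta> y
  proof -
    have "\<bar>f y - F \<delta> (exp (- y))\<bar> = \<bar>f y\<bar> * (1 - c \<delta> (exp (- y)))"
    proof -
      have "f y - F \<delta> (exp (- y)) = f y * (1 - c \<delta> (exp (- y)))" by (simp add: F_def algebra_simps)
      then show ?thesis using c01[OF that, of "- y"] by (simp add: abs_mult)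
    qed
    also have "\<dots> \<le> 1 * (1 - c \<delta> (exp (- y)))"
      using c01[OF that, of "- y"] by (intro mult_right_mono fb) auto
    finally show ?thesis by simp
  qed
  have "(\<lambda>n. \<integral>w. f (Y n w) \<partial>M) \<longlonglongrightarrow> (\<integral>w. f (Z w) \<partial>M')"
  proof (rule LIMSEQ_I)
    fix e :: real assume e: "0 < e"
    \<comment> \<open>\<open>exp (- Z w)\<close> is positive, so the cutoff error of the limit
      vanishes as \<open>\<delta>\<close> shrinks. The error for \<open>Y n\<close> inherits the
      bound in the limit because \<open>1 - c \<delta>\<close> is itself an admissible test
      function, which is how escape of mass to infinity is excluded.\<close>
    have "(\<lambda>m. \<integral>w. 1 - c (1 / Suc m) (exp (- Z w)) \<partial>M') \<longlonglongrightarrow> (\<integral>w. 0 \<partial>M')"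
    proof (rule integral_dominated_convergence[where w = "\<lambda>_. 1"])
      show "AE w in M'. (\<lambda>m. 1 - c (1 / Suc m) (exp (- Z w))) \<longlonglongrightarrow> 0"
      proof (rule AE_I2)
        fix w
        have "eventually (\<lambda>m. 1 - c (1 / Suc m) (exp (- Z w)) = 0) sequentially"
        proof -
          obtain k where k: "1 / exp (- Z w) < real k" using reals_Archimedean2 by blast
          show ?thesis
            unfolding eventually_sequentially
          proof (intro exI[of _ k] allI impI)
            fix m assume "k \<le> m"
            then have "1 / exp (- Z w) < real (Suc m)" using k by linarith
            then have "1 < exp (- Z w) / (1 / real (Suc m))"
              by (simp add: divide_less_eq exp_gt_zero mult.commute)
            then show "1 - c (1 / Suc m) (exp (- Z w)) = 0" by (simp add: c_def)
          qed
        qed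
        then show "(\<lambda>m. 1 - c (1 / Suc m) (exp (- Z w))) \<longlonglongrightarrow> 0" by (rule tendsto_eventually)
      qed
      show "AE w in M'. norm (1 - c (1 / Suc m) (exp (- Z w))) \<le> 1" for m
        using c01[of "1 / Suc m"] by (intro AE_I2) (auto simp: abs_le_iff)
    qed (auto simp: c_def)
    from order_tendstoD(2)[OF this, of "e / 4"] e obtain m where
      m: "(\<integral>w. 1 - c (1 / Suc m) (exp (- Z w)) \<partial>M') < e / 4"
      by (auto simp: eventually_sequentially)
    define \<delta> where "\<delta> = 1 / real (Suc m)"
    have d: "\<delta> > 0" by (simp add: \<delta>_def)
    note m = m[folded \<delta>_def]
    have [measurable]: "F \<delta> \<in> borel_measurable borel" "c \<delta> \<in> borel_measurable borel"
      using Fc[OF d] cc[OF d] by (auto intro: borel_measurable_continuous_onI)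
    have Fb: "\<bar>F \<delta> (exp y)\<bar> \<le> 1" for y
      using mult_mono[OF fb[of "-y"] c01(2)[OF d, of y]] c01[OF d, of y] by (auto simp: F_def abs_mult)
    have iM: "integrable M (\<lambda>w. f (Y n w))" "integrable M (\<lambda>w. F \<delta> (exp (- Y n w)))"
      "integrable M (\<lambda>w. c \<delta> (exp (- Y n w)))" for n
      by (rule M.integrable_const_bound[of _ 1]; use fb Fb c01[OF d] in auto)+
    have iM': "integrable M' (\<lambda>w. f (Z w))" "integrable M' (\<lambda>w. F \<delta> (exp (- Z w)))"
      "integrable M' (\<lambda>w. c \<delta> (exp (- Z w)))"
      by (rule M'.integrable_const_bound[of _ 1]; use fb Fb c01[OF d] in auto)+
    have 1: "\<bar>(\<integral>w. f (Y n w) \<partial>M) - (\<integral>w. F \<delta> (exp (- Y n w)) \<partial>M)\<bar> \<le> (\<integral>w. 1 - c \<delta> (exp (- Y n w)) \<partial>M)" for n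
    proof -
      have "\<bar>(\<integral>w. f (Y n w) \<partial>M) - (\<integral>w. F \<delta> (exp (- Y n w)) \<partial>M)\<bar>
        = \<bar>(\<integral>w. f (Y n w) - F \<delta> (exp (- Y n w)) \<partial>M)\<bar>" using iM[of n] by simp
      also have "\<dots> \<le> (\<integral>w. \<bar>f (Y n w) - F \<delta> (exp (- Y n w))\<bar> \<partial>M)" by (rule integral_abs_bound)
      also have "\<dots> \<le> (\<integral>w. 1 - c \<delta> (exp (- Y n w)) \<partial>M)"
        using iM[of n] by (intro integral_mono bd[OF d]) auto
      finally show ?thesis .
    qed
    have 2: "\<bar>(\<integral>w. f (Z w) \<partial>M') - (\<integral>w. F \<delta> (exp (- Z w)) \<partial>M')\<bar> \<le> (\<integral>w. 1 - c \<delta> (exp (- Z w)) \<partial>M')"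
    proof -
      have "\<bar>(\<integral>w. f (Z w) \<partial>M') - (\<integral>w. F \<delta> (exp (- Z w)) \<partial>M')\<bar>
        = \<bar>(\<integral>w. f (Z w) - F \<delta> (exp (- Z w)) \<partial>M')\<bar>" using iM' by simp
      also have "\<dots> \<le> (\<integral>w. \<bar>f (Z w) - F \<delta> (exp (- Z w))\<bar> \<partial>M')" by (rule integral_abs_bound)
      also have "\<dots> \<le> (\<integral>w. 1 - c \<delta> (exp (- Z w)) \<partial>M')"
        using iM' by (intro integral_mono bd[OF d]) auto
      finally show ?thesis .
    qed
    have "eventually (\<lambda>n. (\<integral>w. 1 - c \<delta> (exp (- Y n w)) \<partial>M) < e / 4) sequentially"
      using m by (intro order_tendstoD(2)[OF conv[of "\<lambda>x. 1 - c \<delta> x"]] continuous_on_diff continuous_on_const cc[OF d])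
    moreover have "eventually (\<lambda>n. \<bar>(\<integral>w. F \<delta> (exp (- Y n w)) \<partial>M) - (\<integral>w. F \<delta> (exp (- Z w)) \<partial>M')\<bar> < e / 4) sequentially"
      using tendstoD[OF conv[OF Fc[OF d]], of "e/4"] e by (simp add: dist_real_def)
    ultimately have "eventually (\<lambda>n. norm ((\<integral>w. f (Y n w) \<partial>M) - (\<integral>w. f (Z w) \<partial>M')) < e) sequentially"
    proof eventually_elim
      case (elim n)
      with 1[of n] 2 m show ?case unfolding real_norm_def by linarith
    qed
    then show "\<exists>n0. \<forall>n\<ge>n0. norm ((\<integral>w. f (Y n w) \<partial>M) - (\<integral>w. f (Z w) \<partial>M')) < e"
      by (simp add: eventually_sequentially)
  qed
  then show "(\<lambda>n. integral\<^sup>L (distr M borel (Y n)) f) \<longlonglongrightarrow> integral\<^sup>L (distr M' borel Z) f"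
    by (simp add: integral_distr)
qed

section \<open>Squares of linear functionals as Gaussian mixtures\<close>

abbreviation std_gauss :: "'i set \<Rightarrow> ('i \<Rightarrow> real) measure" where
  "std_gauss L \<equiv> PiM L (\<lambda>_. std_normal_distribution)"

lemma prob_space_std_gauss: "prob_space (std_gauss L)"
  by (intro prob_space_PiM prob_space_normal_density) simp

lemma std_gauss_char:
  fixes x :: "'i \<Rightarrow> real"
  assumes L: "finite L"
  shows "(\<integral>g. iexp (\<Sum>l\<in>L. g l * x l) \<partial>std_gauss L) = exp (- (\<Sum>l\<in>L. (x l)\<^sup>2) / 2)"
proof -
  interpret N: prob_space std_normal_distribution by (rule prob_space_normal_density) simp
  interpret product_sigma_finite "\<lambda>_. std_normal_distribution" ..
  have "(\<integral>g. iexp (\<Sum>l\<in>L. g l * x l) \<partial>std_gauss L) = (\<integral>g. (\<Prod>l\<in>L. iexp (x l * g l)) \<partial>std_gauss L)"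
    using L by (simp add: exp_sum sum_distrib_left mult.commute)
  also have "\<dots> = (\<Prod>l\<in>L. char std_normal_distribution (x l))"
    unfolding char_def by (intro product_integral_prod L N.integrable_iexp) simp_all
  also have "\<dots> = (\<Prod>l\<in>L. complex_of_real (exp (- ((x l)\<^sup>2) / 2)))"
    by (simp add: char_std_normal_distribution)
  also have "\<dots> = complex_of_real (\<Prod>l\<in>L. exp (- ((x l)\<^sup>2) / 2))" by simp
  also have "(\<Prod>l\<in>L. exp (- ((x l)\<^sup>2) / 2)) = exp (- (\<Sum>l\<in>L. (x l)\<^sup>2) / 2)"
    using L by (simp add: sum_divide_distrib sum_negf flip: exp_sum)
  finally show ?thesis by simp
qed

text \<open>The Hubbard-Stratonovich transformation: a Gaussian in \<open>X\<close> is the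
  characteristic function of an independent standard normal vector evaluated at \<open>X\<close>,
  and Fubini's theorem exchanges the integrals.\<close>

lemma (in prob_space) gauss_mixture:
  fixes X :: "'i \<Rightarrow> 'a \<Rightarrow> real"
  assumes L: "finite L" and X[measurable]: "\<And>l. l \<in> L \<Longrightarrow> X l \<in> borel_measurable M"
  shows "complex_of_real (\<integral>w. exp (- (\<Sum>l\<in>L. (X l w)\<^sup>2) / 2) \<partial>M) =
    (\<integral>g. (\<integral>w. iexp (\<Sum>l\<in>L. g l * X l w) \<partial>M) \<partial>std_gauss L)"
proof -
  interpret G: prob_space "std_gauss L" by (rule prob_space_std_gauss)
  interpret pair_prob_space M "std_gauss L" ..
  have [measurable]: "(\<lambda>(w, g). iexp (\<Sum>l\<in>L. g l * X l w)) \<in> borel_measurable (M \<Otimes>\<^sub>M std_gauss L)"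
    by measurable
  have "complex_of_real (\<integral>w. exp (- (\<Sum>l\<in>L. (X l w)\<^sup>2) / 2) \<partial>M) =
      (\<integral>w. complex_of_real (exp (- (\<Sum>l\<in>L. (X l w)\<^sup>2) / 2)) \<partial>M)" by simp
  also have "\<dots> = (\<integral>w. (\<integral>g. iexp (\<Sum>l\<in>L. g l * X l w) \<partial>std_gauss L) \<partial>M)"
    by (simp only: std_gauss_char[OF L])
  also have "\<dots> = (\<integral>g. (\<integral>w. iexp (\<Sum>l\<in>L. g l * X l w) \<partial>M) \<partial>std_gauss L)"
    by (intro Fubini_integral[symmetric] P.integrable_const_bound[of _ 1]) auto
  finally show ?thesis .
qed

text \<open>Characteristic functions are bounded by 1, so pointwise convergence passes through the
  Gaussian integral by dominated convergence.\<close>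

lemma gauss_mixture_conv:
  fixes X :: "nat \<Rightarrow> 'i \<Rightarrow> 'a \<Rightarrow> real" and Z :: "'i \<Rightarrow> 'b \<Rightarrow> real"
  assumes M: "prob_space M" and M': "prob_space M'" and L: "finite L"
    and X[measurable]: "\<And>n l. l \<in> L \<Longrightarrow> X n l \<in> borel_measurable M"
    and Z[measurable]: "\<And>l. l \<in> L \<Longrightarrow> Z l \<in> borel_measurable M'"
    and lim: "\<And>g. (\<lambda>n. \<integral>w. iexp (\<Sum>l\<in>L. g l * X n l w) \<partial>M) \<longlonglongrightarrow> (\<integral>w. iexp (\<Sum>l\<in>L. g l * Z l w) \<partial>M')"
  shows "(\<lambda>n. \<integral>w. exp (- (\<Sum>l\<in>L. (X n l w)\<^sup>2) / 2) \<partial>M) \<longlonglongrightarrow> (\<integral>w. exp (- (\<Sum>l\<in>L. (Z l w)\<^sup>2) / 2) \<partial>M')"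
proof -
  interpret M: prob_space M by fact
  interpret M': prob_space M' by fact
  interpret G: prob_space "std_gauss L" by (rule prob_space_std_gauss)
  have "(\<lambda>n. \<integral>g. (\<integral>w. iexp (\<Sum>l\<in>L. g l * X n l w) \<partial>M) \<partial>std_gauss L)
     \<longlonglongrightarrow> (\<integral>g. (\<integral>w. iexp (\<Sum>l\<in>L. g l * Z l w) \<partial>M') \<partial>std_gauss L)"
  proof (rule integral_dominated_convergence[where w = "\<lambda>_. 1"])
    show "(\<lambda>g. \<integral>w. iexp (\<Sum>l\<in>L. g l * Z l w) \<partial>M') \<in> borel_measurable (std_gauss L)"
      by (rule M'.borel_measurable_lebesgue_integral) measurable
    show "(\<lambda>g. \<integral>w. iexp (\<Sum>l\<in>L. g l * X n l w) \<partial>M) \<in> borel_measurable (std_gauss L)" for n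
      by (rule M.borel_measurable_lebesgue_integral) measurable
    have "norm (\<integral>w. iexp (\<Sum>l\<in>L. g l * X n l w) \<partial>M) \<le> (\<integral>w. norm (iexp (\<Sum>l\<in>L. g l * X n l w)) \<partial>M)" for n g
      by (rule integral_norm_bound)
    then show "AE g in std_gauss L. norm (\<integral>w. iexp (\<Sum>l\<in>L. g l * X n l w) \<partial>M) \<le> 1" for n
      by (simp add: M.prob_space)
    show "AE g in std_gauss L. (\<lambda>n. \<integral>w. iexp (\<Sum>l\<in>L. g l * X n l w) \<partial>M)
        \<longlonglongrightarrow> (\<integral>w. iexp (\<Sum>l\<in>L. g l * Z l w) \<partial>M')"
      by (intro AE_I2 lim)
  qed auto
  then have "(\<lambda>n. complex_of_real (\<integral>w. exp (- (\<Sum>l\<in>L. (X n l w)\<^sup>2) / 2) \<partial>M))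
      \<longlonglongrightarrow> complex_of_real (\<integral>w. exp (- (\<Sum>l\<in>L. (Z l w)\<^sup>2) / 2) \<partial>M')"
    by (subst (1 2) prob_space.gauss_mixture) (use M M' L X Z in auto)
  then show ?thesis by (simp only: tendsto_of_real_iff)
qed

section \<open>Exceedances of an order statistic\<close>

definition exceed :: "nat \<Rightarrow> nat \<Rightarrow> (nat \<Rightarrow> 'b::real_normed_vector) \<Rightarrow> nat set" where
  "exceed n k x = {i\<in>{..<n}. norm_order_stat n k x < norm (x i)}"

lemma finite_exceed [simp]: "finite (exceed n k x)"
  by (simp add: exceed_def)

text \<open>Trades the order statistic for a count at a fixed level; measurability, the description
  of exceedance sets and the bounds on \<open>T\<close> rest on it. With the zero-based index,
  exactly \<open>k\<close> exceedances are still admissible.\<close>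

lemma norm_order_stat_le_iff:
  assumes k: "k < n"
  shows "norm_order_stat n k x \<le> y \<longleftrightarrow> card {i\<in>{..<n}. y < norm (x i)} \<le> k"
proof -
  let ?xs = "map (\<lambda>i. norm (x i)) [0..<n]"
  let ?ys = "rev (sort ?xs)"
  let ?A = "{j. j < n \<and> y < ?ys ! j}"
  have desc: "?ys ! j \<le> ?ys ! i" if "i \<le> j" "j < n" for i j
    using that sorted_nth_mono[of "sort ?xs" "n - Suc j" "n - Suc i"] by (simp add: rev_nth)
  have "{i\<in>{..<n}. y < norm (x i)} = {i. i < length ?xs \<and> y < ?xs ! i}" by auto
  then have "card {i\<in>{..<n}. y < norm (x i)} = length (filter (\<lambda>z. y < z) ?xs)"
    by (simp add: length_filter_conv_card del: length_map)
  also have "\<dots> = length (filter (\<lambda>z. y < z) ?ys)"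
    by (simp flip: size_mset add: mset_filter del: mset_map)
  also have "\<dots> = card ?A" by (simp add: length_filter_conv_card)
  finally have eq: "card {i\<in>{..<n}. y < norm (x i)} = card ?A" .
  show ?thesis
  proof
    assume "norm_order_stat n k x \<le> y"
    then have "?ys ! k \<le> y" by (simp add: norm_order_stat_def)
    have "?A \<subseteq> {..<k}"
    proof
      fix j assume j: "j \<in> ?A"
      show "j \<in> {..<k}"
      proof (rule ccontr)
        assume "j \<notin> {..<k}"
        then have "?ys ! j \<le> ?ys ! k" using desc[of k j] j by simp
        then show False using j \<open>?ys ! k \<le> y\<close> by simp
      qed
    qed
    then show "card {i\<in>{..<n}. y < norm (x i)} \<le> k"
      unfolding eq using card_mono[of "{..<k}" ?A] by simp
  next
    assume c: "card {i\<in>{..<n}. y < norm (x i)} \<le> k"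
    show "norm_order_stat n k x \<le> y"
    proof (rule ccontr)
      assume "\<not> ?thesis"
      then have "y < ?ys ! k" by (simp add: norm_order_stat_def)
      have "{..k} \<subseteq> ?A"
      proof
        fix j assume "j \<in> {..k}"
        then show "j \<in> ?A" using desc[of j k] k \<open>y < ?ys ! k\<close> by simp
      qed
      then have "card {..k} \<le> card ?A" by (intro card_mono) auto
      then show False using c eq by simp
    qed
  qed
qed

lemma norm_order_stat_cong:
  assumes "\<And>i. i < n \<Longrightarrow> x i = y i"
  shows "norm_order_stat n k x = norm_order_stat n k y"
proof -
  have "map (\<lambda>i. norm (x i)) [0..<n] = map (\<lambda>i. norm (y i)) [0..<n]" using assms by simp
  then show ?thesis by (simp only: norm_order_stat_def)
qed

lemma norm_order_stat_attained:
  assumes "k < n"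
  shows "\<exists>i<n. norm_order_stat n k x = norm (x i)"
proof -
  let ?xs = "map (\<lambda>i. norm (x i)) [0..<n]"
  have "rev (sort ?xs) ! k \<in> set (rev (sort ?xs))" using assms by (intro nth_mem) simp
  then show ?thesis by (auto simp: norm_order_stat_def)
qed

lemma card_exceed_le: "k < n \<Longrightarrow> card (exceed n k x) \<le> k"
  unfolding exceed_def using norm_order_stat_le_iff[of k n x "norm_order_stat n k x"] by simp

text \<open>Given the exceedance set \<open>I\<close>, the order statistic is a function of the remaining coordinates
  \<open>J\<close> alone, and the event itself splits into a condition on \<open>J\<close> and independent conditions on \<open>I\<close>.\<close>

lemma exceed_eq_iff:
  fixes x :: "nat \<Rightarrow> 'b::real_normed_vector"
  assumes k: "k < n" and I: "I \<subseteq> {..<n}" "card I \<le> k" and J: "J = {..<n} - I"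
  defines "\<tau> \<equiv> Max ((\<lambda>i. norm (x i)) ` J)"
  shows "exceed n k x = I \<longleftrightarrow> (\<forall>i\<in>I. \<tau> < norm (x i)) \<and> (\<forall>y<\<tau>. k < card I + card {i\<in>J. y < norm (x i)})"
    and "exceed n k x = I \<Longrightarrow> norm_order_stat n k x = \<tau>"
proof -
  let ?T = "norm_order_stat n k x"
  have fin: "finite I" "finite J" using I J finite_subset by auto
  have Jne: "J \<noteq> {}"
  proof
    assume "J = {}"
    then have "I = {..<n}" using I J by auto
    then show False using I k by simp
  qed
  have le: "norm (x i) \<le> \<tau>" if "i \<in> J" for i using that fin by (auto simp: \<tau>_def)
  show T: "?T = \<tau>" if "exceed n k x = I"
  proof (rule antisym)
    obtain i where i: "i < n" "?T = norm (x i)" using norm_order_stat_attained[OF k] by blast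
    then have "i \<in> J" using that J by (auto simp: exceed_def)
    then show "?T \<le> \<tau>" using le i by simp
    have "norm (x i) \<le> ?T" if "i \<in> J" for i using that J \<open>exceed n k x = I\<close> by (force simp: exceed_def)
    then show "\<tau> \<le> ?T" unfolding \<tau>_def using fin Jne by simp
  qed
  have above: "{i\<in>{..<n}. \<tau> < norm (x i)} = I" if "\<forall>i\<in>I. \<tau> < norm (x i)"
    using that le J I by force
  have split: "card {i\<in>{..<n}. y < norm (x i)} = card I + card {i\<in>J. y < norm (x i)}"
    if "\<forall>i\<in>I. y < norm (x i)" for y
  proof -
    have "{i\<in>{..<n}. y < norm (x i)} = I \<union> {i\<in>J. y < norm (x i)}" using that J I by auto
    then show ?thesis using fin J by (simp add: card_Un_disjoint disjoint_iff)
  qed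
  show "exceed n k x = I \<longleftrightarrow> (\<forall>i\<in>I. \<tau> < norm (x i)) \<and> (\<forall>y<\<tau>. k < card I + card {i\<in>J. y < norm (x i)})"
  proof
    assume e: "exceed n k x = I"
    then have a: "\<forall>i\<in>I. \<tau> < norm (x i)" using T by (auto simp: exceed_def)
    moreover have "k < card I + card {i\<in>J. y < norm (x i)}" if "y < \<tau>" for y
      using norm_order_stat_le_iff[OF k, of x y] that T[OF e] split[of y] a by force
    ultimately show "(\<forall>i\<in>I. \<tau> < norm (x i)) \<and> (\<forall>y<\<tau>. k < card I + card {i\<in>J. y < norm (x i)})" by blast
  next
    assume a: "(\<forall>i\<in>I. \<tau> < norm (x i)) \<and> (\<forall>y<\<tau>. k < card I + card {i\<in>J. y < norm (x i)})"
    have "?T \<le> \<tau>" unfolding norm_order_stat_le_iff[OF k] using above a I by simp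
    moreover have "\<not> ?T \<le> y" if "y < \<tau>" for y
    proof -
      have "\<forall>i\<in>I. y < norm (x i)" using a that by force
      then show ?thesis unfolding norm_order_stat_le_iff[OF k] using a that split[of y] by force
    qed
    \<comment> \<open>Take \<open>y\<close> to be \<open>?T\<close> itself.\<close>
    then have "\<not> ?T < \<tau>" by blast
    ultimately have "?T = \<tau>" by simp
    then show "exceed n k x = I" using above a by (simp add: exceed_def)
  qed
qed

lemma measurable_norm_order_stat:
  fixes X :: "nat \<Rightarrow> 'a \<Rightarrow> 'b::euclidean_space"
  assumes k: "k < n" and X: "\<And>i. i < n \<Longrightarrow> X i \<in> borel_measurable M"
  shows "(\<lambda>w. norm_order_stat n k (\<lambda>i. X i w)) \<in> borel_measurable M"
proof (rule borel_measurableI_le)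
  fix y :: real
  have eq: "real (card {i\<in>{..<n}. y < norm (X i w)}) = (\<Sum>i<n. if y < norm (X i w) then 1 else 0)" for w
    by (simp add: sum.If_cases Int_def)
  have "(\<lambda>w. if y < norm (X i w) then 1 else 0 :: real) \<in> borel_measurable M" if "i < n" for i
  proof -
    note [measurable] = X[OF that]
    show ?thesis by measurable
  qed
  then have [measurable]: "(\<lambda>w. \<Sum>i<n. if y < norm (X i w) then 1 else 0 :: real) \<in> borel_measurable M"
    by (intro borel_measurable_sum) simp
  have "{w\<in>space M. norm_order_stat n k (\<lambda>i. X i w) \<le> y} =
      {w\<in>space M. (\<Sum>i<n. if y < norm (X i w) then 1 else 0 :: real) \<le> real k}"
    unfolding norm_order_stat_le_iff[OF k] eq[symmetric] by simp
  also have "\<dots> \<in> sets M" by measurable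
  finally show "{w\<in>space M. norm_order_stat n k (\<lambda>i. X i w) \<le> y} \<in> sets M" .
qed

text \<open>Partitions the sample space by the exceedance set; in each summand the index set of the
  product is no longer random.\<close>

lemma prod_exceed_split:
  "(\<Prod>i\<in>exceed n k x. h i) = (\<Sum>I\<in>Pow {..<n}. if exceed n k x = I then (\<Prod>i\<in>I. h i) else (0::complex))"
proof -
  have "exceed n k x \<in> Pow {..<n}" by (auto simp: exceed_def)
  then show ?thesis by simp
qed

lemma measurable_exceed_event:
  fixes X :: "nat \<Rightarrow> 'a \<Rightarrow> 'b::euclidean_space"
  assumes k: "k < n" and X: "\<And>i. i < n \<Longrightarrow> X i \<in> borel_measurable M"
  shows "Measurable.pred M (\<lambda>w. exceed n k (\<lambda>i. X i w) = I)"
proof -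
  note [measurable] = measurable_norm_order_stat[of k n X M, OF k X]
  let ?T = "\<lambda>w. norm_order_stat n k (\<lambda>i. X i w)"
  have "(exceed n k (\<lambda>i. X i w) = I) = ((\<forall>i\<in>{..<n}. (i \<in> I) = (?T w < norm (X i w))) \<and> I \<subseteq> {..<n})" for w
    by (auto simp: exceed_def)
  moreover have *: "Measurable.pred M (\<lambda>w. (i \<in> I) = (?T w < norm (X i w)))" if "i \<in> {..<n}" for i
  proof -
    have [measurable]: "X i \<in> borel_measurable M" using X that by simp
    show ?thesis by measurable
  qed
  have "Measurable.pred M (\<lambda>w. \<forall>i\<in>{..<n}. (i \<in> I) = (?T w < norm (X i w)))"
    by (intro pred_intros_finite finite_lessThan *)
  then have "Measurable.pred M (\<lambda>w. (\<forall>i\<in>{..<n}. (i \<in> I) = (?T w < norm (X i w))) \<and> I \<subseteq> {..<n})"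
    by (cases "I \<subseteq> {..<n}") simp_all
  ultimately show ?thesis by simp
qed

lemma measurable_exceed_prod:
  fixes X :: "nat \<Rightarrow> 'a \<Rightarrow> 'b::euclidean_space" and \<phi> :: "'b \<Rightarrow> real \<Rightarrow> complex"
  assumes k: "k < n" and X: "\<And>i. i < n \<Longrightarrow> X i \<in> borel_measurable M"
    and \<phi>: "(\<lambda>(x, s). \<phi> x s) \<in> borel_measurable (borel \<Otimes>\<^sub>M borel)"
  shows "(\<lambda>w. \<Prod>i\<in>exceed n k (\<lambda>i. X i w). \<phi> (X i w) (norm_order_stat n k (\<lambda>i. X i w))) \<in> borel_measurable M"
proof -
  let ?T = "\<lambda>w. norm_order_stat n k (\<lambda>i. X i w)"
  have "(\<lambda>w. \<phi> (X i w) (?T w)) \<in> borel_measurable M" if "i < n" for i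
  proof -
    have "(\<lambda>w. (X i w, ?T w)) \<in> M \<rightarrow>\<^sub>M borel \<Otimes>\<^sub>M borel"
      using X[OF that] measurable_norm_order_stat[of k n X M, OF k X] by (rule measurable_Pair)
    from measurable_compose[OF this \<phi>] show ?thesis by simp
  qed
  then have "(\<lambda>w. \<Prod>i\<in>I. \<phi> (X i w) (?T w)) \<in> borel_measurable M" if "I \<subseteq> {..<n}" for I
    using that by (intro borel_measurable_prod) auto
  then show ?thesis unfolding prod_exceed_split
    by (intro borel_measurable_sum measurable_If) (auto intro: measurable_exceed_event[OF k X] simp flip: pred_def)
qed

text \<open>The general codomain serves conditional means and variances as well as complex
  characteristic functions.\<close>

lemma measurable_cond_expectation:
  fixes P :: "'b::euclidean_space measure" and \<phi> :: "'b \<Rightarrow> real \<Rightarrow> 'c::{banach, real_normed_field, second_countable_topology}"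
  assumes P: "prob_space P" and sets: "sets P = sets borel"
    and \<phi>: "(\<lambda>(x, s). \<phi> x s) \<in> borel_measurable (borel \<Otimes>\<^sub>M borel)"
  shows "(\<lambda>s. (\<integral>x. \<phi> x s * indicator {x. s < norm x} x \<partial>P) / of_real (measure P {x\<in>space P. s < norm x})) \<in> borel_measurable borel"
proof -
  interpret P: prob_space P by fact
  note [measurable_cong] = sets
  have sp: "space P = UNIV" using sets_eq_imp_space_eq[OF sets] by simp
  have \<phi>'[measurable]: "(\<lambda>(s, x). \<phi> x s) \<in> borel_measurable (borel \<Otimes>\<^sub>M P)"
    using measurable_compose[OF _ \<phi>, of "\<lambda>(s, x). (x, s)" "borel \<Otimes>\<^sub>M P"] by (simp add: split_beta')
  have "(\<lambda>s. \<integral>x. \<phi> x s * (if s < norm x then 1 else 0) \<partial>P) \<in> borel_measurable borel"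
    by (rule P.borel_measurable_lebesgue_integral) measurable
  moreover have "(\<lambda>s. \<integral>x. (if s < norm x then 1 else 0 :: real) \<partial>P) \<in> borel_measurable borel"
    by (rule P.borel_measurable_lebesgue_integral) measurable
  moreover have "(\<integral>x. (if s < norm x then 1 else 0 :: real) \<partial>P) = measure P {x\<in>space P. s < norm x}" for s
  proof -
    have [measurable]: "{x. s < norm x} \<in> P.events" by measurable
    have "(\<integral>x. (if s < norm x then 1 else 0 :: real) \<partial>P) = (\<integral>x. indicator {x. s < norm x} x \<partial>P)"
      by (intro Bochner_Integration.integral_cong) auto
    also have "\<dots> = measure P {x\<in>space P. s < norm x}" by (simp add: sp)
    finally show ?thesis .
  qed
  moreover have "(\<lambda>x. \<phi> x s * indicator {x. s < norm x} x) = (\<lambda>x. \<phi> x s * (if s < norm x then 1 else 0))" for s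
    by (auto simp: indicator_def)
  ultimately show ?thesis by simp
qed

text \<open>Conditionally on the order statistic, the exceedances are independent draws from the
  distribution above it.\<close>

lemma exceed_product_identity_PiM:
  fixes P :: "'b::euclidean_space measure" and \<phi> :: "'b \<Rightarrow> real \<Rightarrow> complex"
  assumes P: "prob_space P" and sets: "sets P = sets borel" and k: "k < n"
    and \<phi>: "(\<lambda>(x, s). \<phi> x s) \<in> borel_measurable (borel \<Otimes>\<^sub>M borel)" "\<And>x s. norm (\<phi> x s) \<le> 1"
    and pos: "\<And>s. 0 < measure P {x\<in>space P. s < norm x}"
  defines "\<Psi> \<equiv> \<lambda>s. (\<integral>x. \<phi> x s * indicator {x. s < norm x} x \<partial>P) / measure P {x\<in>space P. s < norm x}"
  shows "(\<integral>x. (\<Prod>i\<in>exceed n k x. \<phi> (x i) (norm_order_stat n k x)) \<partial>PiM {..<n} (\<lambda>_. P)) =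
    (\<integral>x. \<Psi> (norm_order_stat n k x) ^ card (exceed n k x) \<partial>PiM {..<n} (\<lambda>_. P))"
proof -
  interpret P: prob_space P by fact
  interpret product_sigma_finite "\<lambda>_::nat. P" ..
  interpret Pi: prob_space "PiM I (\<lambda>_. P)" for I :: "nat set" by (intro prob_space_PiM P)
  note [measurable_cong] = sets
  have sp: "space P = UNIV" using sets_eq_imp_space_eq[OF sets] by simp
  note \<phi>(1)[measurable]
  let ?PI = "\<lambda>I. PiM I (\<lambda>_::nat. P)"
  let ?T = "norm_order_stat n k"
  define Fb where "Fb s = measure P {x. s < norm x}" for s :: real
  have Fb: "Fb s > 0" for s using pos[of s] by (simp add: Fb_def sp)
  have Fb_int: "(\<integral>x. indicator {x. s < norm x} x \<partial>P) = complex_of_real (Fb s)" for s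
  proof -
    have "{x. s < norm x} \<in> P.events" by measurable
    then have "(\<integral>x. indicator {x. s < norm x} x \<partial>P) = (Fb s :: real)" by (simp add: Fb_def)
    then have "complex_of_real (\<integral>x. indicator {x. s < norm x} x \<partial>P) = Fb s" by simp
    moreover have "complex_of_real (\<integral>x. indicator {x. s < norm x} x \<partial>P) = (\<integral>x. complex_of_real (indicator {x. s < norm x} x) \<partial>P)"
      by simp
    ultimately show ?thesis by (simp only: of_real_indicator)
  qed
  have \<phi>_int: "integrable P (\<lambda>x. \<phi> x s * indicator {x. s < norm x} x)" for s
    by (rule P.integrable_const_bound[of _ 1]) (use \<phi>(2) in \<open>auto simp: norm_mult indicator_def\<close>)
  have \<Psi>: "(\<integral>x. \<phi> x s * indicator {x. s < norm x} x \<partial>P) = \<Psi> s * Fb s" for s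
    using Fb[of s] by (simp add: \<Psi>_def Fb_def sp)
  have \<Psi>1: "norm (\<Psi> s) \<le> 1" for s
  proof -
    have "norm (\<integral>x. \<phi> x s * indicator {x. s < norm x} x \<partial>P) \<le> (\<integral>x. norm (\<phi> x s * indicator {x. s < norm x} x) \<partial>P)"
      by (rule integral_norm_bound)
    also have "\<dots> \<le> (\<integral>x. indicator {x. s < norm x} x \<partial>P)"
    proof (rule integral_mono)
      show "integrable P (indicat_real {x. s < norm x})"
        by (rule P.integrable_const_bound[of _ 1]) auto
      show "integrable P (\<lambda>x. norm (\<phi> x s * indicator {x. s < norm x} x))"
        by (intro integrable_norm \<phi>_int)
    qed (use \<phi>(2) in \<open>auto simp: norm_mult indicator_def\<close>)
    also have "\<dots> = Fb s" by (simp add: Fb_def sp)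
    finally show ?thesis using Fb[of s] by (simp add: \<Psi>_def Fb_def[symmetric] sp norm_divide)
  qed
  have [measurable]: "\<Psi> \<in> borel_measurable borel"
    unfolding \<Psi>_def by (rule measurable_cond_expectation[OF P sets \<phi>(1)])
  have xm: "(\<lambda>x. x i) \<in> borel_measurable (?PI {..<n})" if "i < n" for i
  proof -
    have "(\<lambda>x. x i) \<in> ?PI {..<n} \<rightarrow>\<^sub>M P"
      using that by (intro measurable_component_singleton) simp
    then show ?thesis by (simp add: measurable_cong_sets[OF refl sets])
  qed
  have Tm[measurable]: "?T \<in> borel_measurable (?PI {..<n})"
    using measurable_norm_order_stat[of k n "\<lambda>i x. x i", OF k xm] .
  have ind[measurable]: "Measurable.pred (?PI {..<n}) (\<lambda>x. exceed n k x = I)" for I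
    using measurable_exceed_event[of k n "\<lambda>i x. x i", OF k xm] .
  define f1 where "f1 I x = (if exceed n k x = I then (\<Prod>i\<in>I. \<phi> (x i) (?T x)) else 0)" for I and x :: "nat \<Rightarrow> 'b"
  define f2 where "f2 I x = (if exceed n k x = I then (\<Prod>i\<in>I. \<Psi> (?T x)) else 0)" for I and x :: "nat \<Rightarrow> 'b"
  have \<phi>m: "(\<lambda>x. \<phi> (x i) (?T x)) \<in> borel_measurable (?PI {..<n})" if "i < n" for i
  proof -
    have "(\<lambda>x. (x i, ?T x)) \<in> ?PI {..<n} \<rightarrow>\<^sub>M borel \<Otimes>\<^sub>M borel"
      using xm[OF that] Tm by (rule measurable_Pair)
    from measurable_compose[OF this \<phi>(1)] show ?thesis by simp
  qed
  have f1i: "integrable (?PI {..<n}) (f1 I)" and f2i: "integrable (?PI {..<n}) (f2 I)" if I: "I \<subseteq> {..<n}" for I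
  proof -
    have [measurable]: "(\<lambda>x. \<Prod>i\<in>I. \<phi> (x i) (?T x)) \<in> borel_measurable (?PI {..<n})"
      using \<phi>m I by (intro borel_measurable_prod) auto
    have "norm (\<Prod>i\<in>I. \<phi> (x i) (?T x)) \<le> 1" "norm (\<Prod>i\<in>I. \<Psi> (?T x)) \<le> 1" for x
      unfolding prod_norm[symmetric] using \<phi>(2) \<Psi>1 by (auto intro!: prod_le_1 power_le_one)
    then have "norm (f1 I x) \<le> 1" "norm (f2 I x) \<le> 1" for x
      by (simp_all add: f1_def f2_def)
    moreover have "f1 I \<in> borel_measurable (?PI {..<n})" unfolding f1_def[abs_def] by measurable
    moreover have "f2 I \<in> borel_measurable (?PI {..<n})" unfolding f2_def[abs_def] by measurable
    ultimately show "integrable (?PI {..<n}) (f1 I)" "integrable (?PI {..<n}) (f2 I)"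
      by (auto intro!: Pi.integrable_const_bound[of _ 1])
  qed
  have main: "integral\<^sup>L (?PI {..<n}) (f1 I) = integral\<^sup>L (?PI {..<n}) (f2 I)" if I: "I \<subseteq> {..<n}" for I
  proof (cases "card I \<le> k")
    case False
    then have "exceed n k x \<noteq> I" for x :: "nat \<Rightarrow> 'b" using card_exceed_le[OF k, of x] by auto
    then show ?thesis by (simp add: f1_def[abs_def] f2_def[abs_def])
  next
    case True
    define J where "J = {..<n} - I"
    have IJ: "J \<inter> I = {}" "finite J" "finite I" "J \<union> I = {..<n}"
      using I by (auto simp: J_def intro: finite_subset)
    define \<tau> where "\<tau> y = Max ((\<lambda>i. norm (y i)) ` J)" for y :: "nat \<Rightarrow> 'b"
    define C where "C y \<longleftrightarrow> (\<forall>u<\<tau> y. k < card I + card {i\<in>J. u < norm (y i)})" for y :: "nat \<Rightarrow> 'b"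
    have mJ: "merge J I (y, z) i = y i" if "i \<in> J" for y z :: "nat \<Rightarrow> 'b" and i
      using that by (simp add: merge_def)
    have mI: "merge J I (y, z) i = z i" if "i \<in> I" for y z :: "nat \<Rightarrow> 'b" and i
      using that IJ by (auto simp: merge_def)
    have \<tau>m: "\<tau> (merge J I (y, z)) = \<tau> y" for y z
      unfolding \<tau>_def by (intro arg_cong[where f = Max] image_cong refl) (simp add: mJ)
    have Cm: "C (merge J I (y, z)) = C y" for y z
      unfolding C_def \<tau>m by (simp add: mJ cong: conj_cong)
    have eqv: "exceed n k x = I \<longleftrightarrow> (\<forall>i\<in>I. \<tau> x < norm (x i)) \<and> C x"
      "exceed n k x = I \<Longrightarrow> ?T x = \<tau> x" for x
      using exceed_eq_iff[OF k I True J_def, of x] by (auto simp: \<tau>_def C_def)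
    have g1: "f1 I (merge J I (y, z)) = (if C y then 1 else 0) * (\<Prod>i\<in>I. \<phi> (z i) (\<tau> y) * indicator {x. \<tau> y < norm x} (z i))"
      and g2: "f2 I (merge J I (y, z)) = (if C y then 1 else 0) * (\<Prod>i\<in>I. \<Psi> (\<tau> y) * indicator {x. \<tau> y < norm x} (z i))" for y z
    proof -
      let ?x = "merge J I (y, z)"
      have ex: "exceed n k ?x = I \<longleftrightarrow> (\<forall>i\<in>I. \<tau> y < norm (z i)) \<and> C y"
        unfolding eqv(1) \<tau>m Cm by (simp add: mI)
      have "(\<Prod>i\<in>I. h i * indicator {x. \<tau> y < norm x} (z i)) = (if \<forall>i\<in>I. \<tau> y < norm (z i) then \<Prod>i\<in>I. h i else 0)"
        for h :: "nat \<Rightarrow> complex"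
        using IJ(3) by (auto intro!: prod.cong prod_zero simp: indicator_def)
      then show "f1 I ?x = (if C y then 1 else 0) * (\<Prod>i\<in>I. \<phi> (z i) (\<tau> y) * indicator {x. \<tau> y < norm x} (z i))"
        "f2 I ?x = (if C y then 1 else 0) * (\<Prod>i\<in>I. \<Psi> (\<tau> y) * indicator {x. \<tau> y < norm x} (z i))"
        using ex eqv(2)[of ?x] by (auto simp: f1_def f2_def \<tau>m mI intro!: prod.cong)
    qed
    have "integral\<^sup>L (?PI {..<n}) (f1 I) = (\<integral>y. (\<integral>z. f1 I (merge J I (y, z)) \<partial>?PI I) \<partial>?PI J)"
      using product_integral_fold[of J I "f1 I"] IJ f1i[OF I] by simp
    also have "\<dots> = (\<integral>y. (\<integral>z. f2 I (merge J I (y, z)) \<partial>?PI I) \<partial>?PI J)"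
    proof (rule Bochner_Integration.integral_cong[OF refl])
      fix y
      have i2: "integrable P (\<lambda>x. \<Psi> (\<tau> y) * indicator {x. \<tau> y < norm x} x)"
      proof (rule P.integrable_const_bound)
        show "AE x in P. norm (\<Psi> (\<tau> y) * indicator {x. \<tau> y < norm x} x) \<le> 1"
          using \<Psi>1 by (auto simp: norm_mult indicator_def)
      qed measurable
      \<comment> \<open>With the coordinates in \<open>J\<close> fixed, the threshold
        \<open>\<tau> y\<close> is a constant. Both inner integrals factor over \<open>I\<close>,
        and the factors agree because \<open>\<Psi>\<close> is the conditional mean of
        \<open>\<phi>\<close> above the threshold.\<close>
      have "(\<integral>z. (\<Prod>i\<in>I. \<phi> (z i) (\<tau> y) * indicator {x. \<tau> y < norm x} (z i)) \<partial>?PI I)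
          = (\<Prod>i\<in>I. \<integral>x. \<phi> x (\<tau> y) * indicator {x. \<tau> y < norm x} x \<partial>P)"
        by (rule product_integral_prod[OF IJ(3) \<phi>_int])
      also have "\<dots> = (\<Prod>i\<in>I. \<integral>x. \<Psi> (\<tau> y) * indicator {x. \<tau> y < norm x} x \<partial>P)"
        by (simp add: \<Psi> Fb_int)
      also have "\<dots> = (\<integral>z. (\<Prod>i\<in>I. \<Psi> (\<tau> y) * indicator {x. \<tau> y < norm x} (z i)) \<partial>?PI I)"
        by (rule product_integral_prod[OF IJ(3) i2, symmetric])
      finally show "(\<integral>z. f1 I (merge J I (y, z)) \<partial>?PI I) = (\<integral>z. f2 I (merge J I (y, z)) \<partial>?PI I)"
        unfolding g1 g2 by simp
    qed
    also have "\<dots> = integral\<^sup>L (?PI {..<n}) (f2 I)"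
      using product_integral_fold[of J I "f2 I"] IJ f2i[OF I] by simp
    finally show ?thesis .
  qed
  have "(\<integral>x. (\<Prod>i\<in>exceed n k x. \<phi> (x i) (?T x)) \<partial>?PI {..<n}) = (\<integral>x. (\<Sum>I\<in>Pow {..<n}. f1 I x) \<partial>?PI {..<n})"
    unfolding prod_exceed_split f1_def ..
  also have "\<dots> = (\<Sum>I\<in>Pow {..<n}. integral\<^sup>L (?PI {..<n}) (f1 I))"
    using f1i by (intro Bochner_Integration.integral_sum) auto
  also have "\<dots> = (\<Sum>I\<in>Pow {..<n}. integral\<^sup>L (?PI {..<n}) (f2 I))"
    using main by (intro sum.cong) auto
  also have "\<dots> = (\<integral>x. (\<Sum>I\<in>Pow {..<n}. f2 I x) \<partial>?PI {..<n})"
    using f2i by (intro Bochner_Integration.integral_sum[symmetric]) auto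
  also have "\<dots> = (\<integral>x. (\<Prod>i\<in>exceed n k x. \<Psi> (?T x)) \<partial>?PI {..<n})"
    unfolding prod_exceed_split f2_def ..
  finally show ?thesis by simp
qed

lemma exceed_cong:
  assumes "\<And>i. i < n \<Longrightarrow> x i = y i"
  shows "exceed n k x = exceed n k y"
  unfolding exceed_def using assms norm_order_stat_cong[of n x y k] by auto

text \<open>Both sides depend only on the first \<open>n\<close> observations, whose joint law is
  the product measure of \<open>exceed_product_identity_PiM\<close>.\<close>

lemma (in prob_space) exceed_product_identity:
  fixes Xs :: "nat \<Rightarrow> 'a \<Rightarrow> 'b::euclidean_space" and \<phi> :: "'b \<Rightarrow> real \<Rightarrow> complex"
  assumes indep: "indep_vars (\<lambda>_. borel) Xs UNIV" and P: "\<And>i. distr M borel (Xs i) = P" and k: "k < n"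
    and \<phi>: "(\<lambda>(x, s). \<phi> x s) \<in> borel_measurable (borel \<Otimes>\<^sub>M borel)" "\<And>x s. norm (\<phi> x s) \<le> 1"
    and pos: "\<And>s. 0 < measure P {x\<in>space P. s < norm x}"
  defines "\<Psi> \<equiv> \<lambda>s. (\<integral>x. \<phi> x s * indicator {x. s < norm x} x \<partial>P) / measure P {x\<in>space P. s < norm x}"
  shows "(\<integral>w. (\<Prod>i\<in>exceed n k (\<lambda>i. Xs i w). \<phi> (Xs i w) (norm_order_stat n k (\<lambda>i. Xs i w))) \<partial>M) =
    (\<integral>w. \<Psi> (norm_order_stat n k (\<lambda>i. Xs i w)) ^ card (exceed n k (\<lambda>i. Xs i w)) \<partial>M)"
proof -
  have Xm[measurable]: "Xs i \<in> borel_measurable M" for i using indep by (auto simp: indep_vars_def)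
  have sets: "sets P = sets borel" using P[of 0] by (metis sets_distr)
  have PP: "prob_space P" using prob_space_distr[OF Xm[of 0]] P by simp
  let ?X = "\<lambda>w. \<lambda>i\<in>{..<n}. Xs i w"
  have "indep_vars (\<lambda>_. borel) Xs {..<n}" using indep by (rule indep_vars_subset) simp
  then have law: "distr M (PiM {..<n} (\<lambda>_. borel)) ?X = PiM {..<n} (\<lambda>_. P)"
    using k by (subst (asm) indep_vars_iff_distr_eq_PiM) (auto simp: P)
  have setsPi: "sets (PiM {..<n} (\<lambda>_. P)) = sets (PiM {..<n} (\<lambda>_. borel))"
    by (intro sets_PiM_cong) (simp_all add: sets)
  have T: "norm_order_stat n k (?X w) = norm_order_stat n k (\<lambda>i. Xs i w)"
    and E: "exceed n k (?X w) = exceed n k (\<lambda>i. Xs i w)" for w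
    by (rule norm_order_stat_cong, simp) (rule exceed_cong, simp)
  have Xpi: "?X \<in> measurable M (PiM {..<n} (\<lambda>_. borel))" by (intro measurable_restrict) simp
  have transfer: "(\<integral>x. h x \<partial>PiM {..<n} (\<lambda>_. P)) = (\<integral>w. h (?X w) \<partial>M)"
    if "h \<in> borel_measurable (PiM {..<n} (\<lambda>_. borel))" for h :: "(nat \<Rightarrow> 'b) \<Rightarrow> complex"
    unfolding law[symmetric] by (rule integral_distr[OF Xpi that])
  have \<Psi>m: "(\<lambda>(x::'b, s). \<Psi> s) \<in> borel_measurable (borel \<Otimes>\<^sub>M borel)"
    using measurable_compose[OF measurable_snd measurable_cond_expectation[OF PP sets \<phi>(1)]]
    by (simp add: \<Psi>_def split_beta')
  have x: "(\<lambda>x. x i) \<in> borel_measurable (PiM {..<n} (\<lambda>_. borel))" if "i < n" for i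
    using that by (intro measurable_component_singleton) simp
  have X: "(\<Prod>i\<in>exceed n k (\<lambda>i. Xs i w). \<phi> (?X w i) (norm_order_stat n k (\<lambda>i. Xs i w))) =
      (\<Prod>i\<in>exceed n k (\<lambda>i. Xs i w). \<phi> (Xs i w) (norm_order_stat n k (\<lambda>i. Xs i w)))" for w
    by (intro prod.cong) (auto simp: exceed_def)
  show ?thesis
    using exceed_product_identity_PiM[OF PP sets k \<phi> pos]
      transfer[OF measurable_exceed_prod[of k n "\<lambda>i x. x i", OF k x \<phi>(1)]]
      transfer[OF measurable_exceed_prod[of k n "\<lambda>i x. x i", OF k x \<Psi>m]]
    unfolding T E X prod_constant by (simp add: \<Psi>_def)
qed

section \<open>Regularly varying tails\<close>

text \<open>The scales \<open>s\<close> along which \<open>H (s * t) / H t\<close> has a positive limit form a multiplicative group,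
  on which the limit is a monotone homomorphism.\<close>

definition ratio_lim :: "(real \<Rightarrow> real) \<Rightarrow> real \<Rightarrow> real \<Rightarrow> bool" where
  "ratio_lim H s c \<longleftrightarrow> 0 < s \<and> 0 < c \<and> ((\<lambda>t. H (s * t) / H t) \<longlongrightarrow> c) at_top"

locale tail_ratio =
  fixes H :: "real \<Rightarrow> real"
  assumes pos: "\<And>t. 0 < H t" and anti: "\<And>s t. s \<le> t \<Longrightarrow> H t \<le> H s"
begin

lemma H_nonzero [simp]: "H t \<noteq> 0"
  using pos[of t] by simp

lemma ratio_lim_mult:
  assumes "ratio_lim H s a" "ratio_lim H r b"
  shows "ratio_lim H (s * r) (a * b)"
proof -
  have r: "r > 0" using assms by (simp add: ratio_lim_def)
  have "((\<lambda>t. H (s * (r * t)) / H (r * t)) \<longlongrightarrow> a) at_top"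
    using assms(1) filterlim_compose[of "\<lambda>t. H (s * t) / H t" "nhds a" at_top "\<lambda>t. r * t" at_top]
      filterlim_tendsto_pos_mult_at_top[OF tendsto_const r filterlim_ident]
    by (simp add: ratio_lim_def)
  then have "((\<lambda>t. H (s * (r * t)) / H (r * t) * (H (r * t) / H t)) \<longlongrightarrow> a * b) at_top"
    using assms(2) unfolding ratio_lim_def by (intro tendsto_mult) auto
  then show ?thesis using assms by (simp add: ratio_lim_def mult.assoc)
qed

lemma ratio_lim_inverse:
  assumes "ratio_lim H s a"
  shows "ratio_lim H (1 / s) (1 / a)"
proof -
  have s: "s > 0" "1 / s > 0" using assms by (auto simp: ratio_lim_def)
  have "((\<lambda>t. H (s * (1 / s * t)) / H (1 / s * t)) \<longlongrightarrow> a) at_top"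
    using assms filterlim_compose[of "\<lambda>t. H (s * t) / H t" "nhds a" at_top "\<lambda>t. 1 / s * t" at_top]
      filterlim_tendsto_pos_mult_at_top[OF tendsto_const s(2) filterlim_ident]
    by (simp add: ratio_lim_def)
  then have "((\<lambda>t. 1 / (H (s * (1 / s * t)) / H (1 / s * t))) \<longlongrightarrow> 1 / a) at_top"
    using assms by (intro tendsto_divide tendsto_const) (auto simp: ratio_lim_def)
  then show ?thesis using s assms by (simp add: ratio_lim_def)
qed

lemma ratio_lim_1: "ratio_lim H 1 1"
  by (simp add: ratio_lim_def)

lemma ratio_lim_power: "ratio_lim H s a \<Longrightarrow> ratio_lim H (s ^ n) (a ^ n)"
  by (induction n) (auto intro: ratio_lim_1 ratio_lim_mult)

lemma ratio_lim_mono: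
  assumes "ratio_lim H s a" "ratio_lim H r b" "s \<le> r"
  shows "b \<le> a"
proof (rule tendsto_le[of at_top])
  show "((\<lambda>t. H (s * t) / H t) \<longlongrightarrow> a) at_top" "((\<lambda>t. H (r * t) / H t) \<longlongrightarrow> b) at_top"
    using assms by (auto simp: ratio_lim_def)
  show "eventually (\<lambda>t. H (r * t) / H t \<le> H (s * t) / H t) at_top"
    using eventually_ge_at_top[of 0]
  proof eventually_elim
    case (elim t)
    then show ?case using assms(3) pos[of t]
      by (intro divide_right_mono anti mult_right_mono) auto
  qed
qed simp

end

text \<open>In the application \<open>C\<close> holds the radii of spheres not charged by the limit
  measure and \<open>G\<close> is its mass outside a ball. Density of \<open>C\<close> and decay of
  \<open>G\<close> are kept in place of the explicit power law.\<close>

locale regular_tail = tail_ratio +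
  fixes G :: "real \<Rightarrow> real" and C :: "real set"
  assumes C_pos: "C \<subseteq> {0<..}"
    and C_dense: "\<And>a b. 0 < a \<Longrightarrow> a < b \<Longrightarrow> \<exists>s\<in>C. a < s \<and> s < b"
    and C_lim: "\<And>s. s \<in> C \<Longrightarrow> ((\<lambda>t. H (s * t) / H t) \<longlongrightarrow> G s) at_top"
    and G_small: "\<And>e. e > 0 \<Longrightarrow> \<exists>s\<in>C. G s < e"
begin

lemma C_below: "0 < b \<Longrightarrow> \<exists>s\<in>C. 0 < s \<and> s < b"
  using C_dense[of "b / 2" b] C_pos by auto

text \<open>What has to be shown is \<open>G s > 0\<close>. A zero limit at one scale can be carried
  by composition to a scale below 1, where monotonicity keeps the ratio at least 1.\<close>

lemma ratio_lim_C:
  assumes s: "s \<in> C"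
  shows "ratio_lim H s (G s)"
proof -
  have s0: "s > 0" using s C_pos by auto
  have "G s \<ge> 0"
    using pos by (intro tendsto_lowerbound[OF C_lim[OF s]]) (auto intro!: always_eventually simp: less_imp_le)
  moreover have "G s \<noteq> 0"
  proof
    assume z: "G s = 0"
    obtain r where r: "r \<in> C" "0 < r" "r < min 1 s" using C_below[of "min 1 s"] s0 by auto
    have r1: "1 \<le> G r"
    proof (rule tendsto_lowerbound[OF C_lim[OF r(1)]])
      show "eventually (\<lambda>t. 1 \<le> H (r * t) / H t) at_top"
        using eventually_ge_at_top[of 0]
      proof eventually_elim
        case (elim t)
        then have "r * t \<le> t" using r by (simp add: mult_le_cancel_right2)
        then show ?case using anti[of "r * t" t] pos[of t] by simp
      qed
    qed simp
    have rl: "ratio_lim H r (G r)" using r r1 C_lim by (simp add: ratio_lim_def)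
    have inv: "((\<lambda>t. H (1 / r * t) / H t) \<longlongrightarrow> 1 / G r) at_top"
      using ratio_lim_inverse[OF rl] by (simp add: ratio_lim_def)
    have "filterlim (\<lambda>t. 1 / r * t) at_top at_top"
      using filterlim_tendsto_pos_mult_at_top[OF tendsto_const _ filterlim_ident, of "1 / r"] r by simp
    from filterlim_compose[OF C_lim[OF s] this]
    have "((\<lambda>t. H (s * (1 / r * t)) / H (1 / r * t) * (H (1 / r * t) / H t)) \<longlongrightarrow> 0 * (1 / G r)) at_top"
      using z by (intro tendsto_mult inv) simp
    then have q: "((\<lambda>t. H (s / r * t) / H t) \<longlongrightarrow> 0) at_top"
      by (simp add: mult.assoc)
    define q where "q = s / r"
    have q0: "q > 0" using s0 r by (simp add: q_def)
    \<comment> \<open>The scale \<open>q * u\<close> is below 1 and still has limit 0.\<close>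
    obtain u where u: "u \<in> C" "0 < u" "u < 1 / q" using C_below[of "1 / q"] q0 by auto
    have "((\<lambda>t. H (q * (u * t)) / H (u * t)) \<longlongrightarrow> 0) at_top"
      using filterlim_compose[OF q[folded q_def] filterlim_tendsto_pos_mult_at_top[OF tendsto_const u(2) filterlim_ident]] by simp
    from tendsto_mult[OF this C_lim[OF u(1)]]
    have "((\<lambda>t. H (q * (u * t)) / H t) \<longlongrightarrow> 0) at_top"
      by simp
    from order_tendstoD(2)[OF this, of 1]
    have "eventually (\<lambda>t. H (q * (u * t)) / H t < 1) at_top" by simp
    moreover have "eventually (\<lambda>t. H (q * (u * t)) / H t \<ge> 1) at_top"
      using eventually_ge_at_top[of 0]
    proof eventually_elim
      case (elim t)
      have "q * u < 1" using u q0 by (simp add: field_simps)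
      then have "q * (u * t) \<le> t" using elim by (simp add: mult_le_cancel_right2 flip: mult.assoc)
      then show ?case using anti[of "q * (u * t)" t] pos[of t] by simp
    qed
    ultimately have "eventually (\<lambda>t::real. False) at_top" by eventually_elim simp
    then show False by simp
  qed
  ultimately show ?thesis using s0 C_lim[OF s] by (simp add: ratio_lim_def)
qed

text \<open>Powers of \<open>s\<close> pass beyond a radius where \<open>G\<close> is below 1,
  whereas powers of a limit \<open>c \<ge> 1\<close> would stay at least 1.\<close>

lemma ratio_lim_less_1:
  assumes s: "ratio_lim H s c" "s > 1"
  shows "c < 1"
proof (rule ccontr)
  assume "\<not> c < 1"
  obtain r where r: "r \<in> C" "G r < 1" using G_small[of 1] by auto
  obtain n where n: "r < s ^ n" using real_arch_pow[OF s(2)] by blast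
  have "c ^ n \<le> G r"
    using ratio_lim_mono[OF ratio_lim_C[OF r(1)] ratio_lim_power[OF s(1)], of n] n by simp
  moreover have "1 \<le> c ^ n" using \<open>\<not> c < 1\<close> by (simp add: one_le_power)
  ultimately show False using r by simp
qed

lemma ratio_lim_greater_1:
  assumes s: "ratio_lim H s c" "s < 1"
  shows "c > 1"
proof -
  have "0 < s" "0 < c" using s by (auto simp: ratio_lim_def)
  then show ?thesis using ratio_lim_less_1[OF ratio_lim_inverse[OF s(1)]] s(2) by simp
qed

text \<open>Continuity at scale 1. If all limits above 1 stayed below some \<open>b < 1\<close>,
  splitting a fixed \<open>s1\<close> into \<open>n\<close> nearly equal factors would give
  \<open>G s1 \<le> b ^ n\<close> for every positive \<open>n\<close>.\<close>

lemma ratio_lim_near_1: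
  assumes e: "e > 0"
  shows "\<exists>s>1. \<exists>c. ratio_lim H s c \<and> 1 - e < c"
proof (rule ccontr)
  assume neg: "\<not> ?thesis"
  define b where "b = max (1 - e) (1 / 2)"
  have b: "0 < b" "b < 1" using e by (auto simp: b_def)
  obtain s1 where s1: "s1 \<in> C" "1 < s1" using C_dense[of 1 2] by auto
  have "G s1 \<le> b ^ n" if n: "n > 0" for n
  proof -
    have "1 < root n s1" using s1 n by simp
    then obtain s where s: "s \<in> C" "1 < s" "s < root n s1" using C_dense[of 1 "root n s1"] by auto
    have "s ^ n \<le> root n s1 ^ n" using s by (intro power_mono) auto
    then have sn: "s ^ n \<le> s1" using s1 n by simp
    have "G s \<le> b" using neg ratio_lim_C[OF s(1)] s(2) by (force simp: b_def)
    moreover have "0 < G s" using ratio_lim_C[OF s(1)] by (simp add: ratio_lim_def)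
    ultimately have "G s ^ n \<le> b ^ n" by (intro power_mono) auto
    then show ?thesis
      using ratio_lim_mono[OF ratio_lim_power[OF ratio_lim_C[OF s(1)]] ratio_lim_C[OF s1(1)] sn] by simp
  qed
  then have "eventually (\<lambda>n. G s1 \<le> b ^ n) sequentially"
    by (auto simp: eventually_sequentially intro!: exI[of _ 1])
  from tendsto_lowerbound[OF LIMSEQ_realpow_zero this] b have "G s1 \<le> 0" by simp
  then show False using ratio_lim_C[OF s1(1)] by (simp add: ratio_lim_def)
qed

end

lemma (in prob_space) regularly_varying_tail:
  fixes X :: "'a \<Rightarrow> 'b::euclidean_space"
  assumes rv: "regularly_varying M X \<nu>"
  shows "\<exists>G C. regular_tail (\<lambda>t. prob {w\<in>space M. t < norm (X w)}) G C"
proof -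
  let ?H = "\<lambda>t. prob {w\<in>space M. t < norm (X w)}"
  let ?G = "\<lambda>s. measure \<nu> {x. s < norm x}"
  let ?C = "{s. 0 < s \<and> emeasure \<nu> {x. norm x = s} = 0}"
  have X[measurable]: "X \<in> borel_measurable M" and sets: "sets \<nu> = sets (restrict_space borel (- {0}))"
    and nz: "emeasure \<nu> (space \<nu>) \<noteq> 0" and fin: "\<And>e. e > 0 \<Longrightarrow> emeasure \<nu> {x. e \<le> norm x} < \<infinity>"
    and lim: "\<And>B. B \<in> sets \<nu> \<Longrightarrow> 0 \<notin> closure B \<Longrightarrow> emeasure \<nu> (frontier B) = 0 \<Longrightarrow>
       ((\<lambda>t. measure M {w\<in>space M. (1 / t) *\<^sub>R X w \<in> B} / ?H t) \<longlongrightarrow> measure \<nu> B) at_top"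
    using rv by (auto simp: regularly_varying_def)
  have space: "space \<nu> = - {0}" using sets_eq_imp_space_eq[OF sets] by (simp add: space_restrict_space)
  have setsI: "B \<in> sets \<nu>" if "B \<in> sets borel" "0 \<notin> B" for B
    unfolding sets using that by (subst sets_restrict_space_iff) auto
  have m1: "{x. s < norm x} \<in> sets \<nu>" "{x. s \<le> norm x} \<in> sets \<nu>" "{x. norm x = s} \<in> sets \<nu>" if "s > 0" for s
    using that by (auto intro!: setsI)
  have fin': "emeasure \<nu> {x. s < norm x} < \<infinity>" if "s > 0" for s
    by (rule le_less_trans[OF emeasure_mono fin[OF that]]) (use m1 that in auto)
  have anti: "?H t \<le> ?H s" if "s \<le> t" for s t
    using that by (intro finite_measure_mono) auto
  have Ganti: "?G t \<le> ?G s" if "s \<le> t" "0 < s" for s t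
    using that m1 fin'[of s] by (intro measure_mono_fmeasurable fmeasurableI) auto
  have C_lim: "((\<lambda>t. ?H (s * t) / ?H t) \<longlongrightarrow> ?G s) at_top" if s: "s \<in> ?C" for s
  proof -
    have s0: "s > 0" using s by simp
    have cl: "closure {x::'b. s < norm x} \<subseteq> {x. s \<le> norm x}"
      by (intro closure_minimal) (auto intro!: closed_Collect_le continuous_intros)
    have op: "open {x::'b. s < norm x}" by (intro open_Collect_less continuous_intros)
    have fr: "frontier {x::'b. s < norm x} \<subseteq> {x. norm x = s}"
      using cl op by (auto simp: frontier_def interior_open)
    have "emeasure \<nu> (frontier {x. s < norm x}) \<le> emeasure \<nu> {x. norm x = s}"
      using fr m1 s0 by (intro emeasure_mono) auto
    then have "emeasure \<nu> (frontier {x. s < norm x}) = 0" using s by simp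
    moreover have "0 \<notin> closure {x::'b. s < norm x}" using cl s0 by auto
    ultimately have L: "((\<lambda>t. measure M {w\<in>space M. (1 / t) *\<^sub>R X w \<in> {x. s < norm x}} / ?H t) \<longlongrightarrow> ?G s) at_top"
      using m1 s0 by (intro lim) auto
    have "eventually (\<lambda>t. measure M {w\<in>space M. (1 / t) *\<^sub>R X w \<in> {x. s < norm x}} / ?H t = ?H (s * t) / ?H t) at_top"
      using eventually_gt_at_top[of 0]
    proof eventually_elim
      case (elim t)
      then have "{w\<in>space M. (1 / t) *\<^sub>R X w \<in> {x. s < norm x}} = {w\<in>space M. s * t < norm (X w)}"
        by (auto simp: field_simps)
      then show ?case by simp
    qed
    from tendsto_cong[THEN iffD1, OF this L] show ?thesis .
  qed
  \<comment> \<open>Away from the origin the image of \<open>\<nu>\<close> under the norm is a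
    finite measure, so it has at most countably many atoms and every interval contains an uncharged
    radius.\<close>
  have dense: "\<exists>s\<in>?C. a < s \<and> s < b" if ab: "0 < a" "a < b" for a b
  proof -
    let ?\<nu>' = "distr (restrict_space \<nu> {x. a \<le> norm x}) borel norm"
    have nm: "norm \<in> borel_measurable (restrict_space \<nu> {x. a \<le> norm x})"
    proof (rule measurable_restrict_space1)
      have "norm \<in> borel_measurable (restrict_space borel (- {0::'b}))"
        by (rule measurable_restrict_space1) simp
      then show "norm \<in> borel_measurable \<nu>" using measurable_cong_sets[OF sets refl] by blast
    qed
    have sp: "space (restrict_space \<nu> {x. a \<le> norm x}) = {x. a \<le> norm x}"
      using ab by (auto simp: space_restrict_space space)
    have int: "{x::'b. a \<le> norm x} \<inter> - {0} = {x. a \<le> norm x}" using ab by auto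
    have "finite_measure (restrict_space \<nu> {x. a \<le> norm x})"
      using fin[OF ab(1)] m1[OF ab(1)]
      by (intro finite_measureI) (auto simp: sp int emeasure_restrict_space space space_restrict_space less_top)
    then interpret \<nu>': finite_measure ?\<nu>' by (rule finite_measure.finite_measure_distr[OF _ nm])
    have "countable {s. measure ?\<nu>' {s} \<noteq> 0}" by (rule \<nu>'.countable_support)
    moreover have "uncountable {a<..<b}" using ab by (simp add: uncountable_open_interval)
    ultimately have "\<not> {a<..<b} \<subseteq> {s. measure ?\<nu>' {s} \<noteq> 0}" using countable_subset by blast
    then obtain s where s: "a < s" "s < b" "measure ?\<nu>' {s} = 0" by auto
    have "emeasure ?\<nu>' {s} = emeasure \<nu> {x. norm x = s}"
    proof -
      have "norm -` {s} \<inter> {x::'b. a \<le> norm x} = {x. norm x = s}" using s by auto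
      then have "emeasure ?\<nu>' {s} = emeasure (restrict_space \<nu> {x. a \<le> norm x}) {x. norm x = s}"
        using nm by (simp add: emeasure_distr sp)
      also have "\<dots> = emeasure \<nu> {x. norm x = s}"
        using m1[of a] ab s by (intro emeasure_restrict_space) (auto simp: int space)
      finally show ?thesis .
    qed
    moreover have "emeasure ?\<nu>' {s} = 0" using s(3) by (simp add: \<nu>'.emeasure_eq_measure)
    ultimately show ?thesis using s ab by (intro bexI[of _ s]) auto
  qed
  have small: "\<exists>s\<in>?C. ?G s < e" if e: "e > 0" for e
  proof -
    have "(\<lambda>i. measure \<nu> {x. real (Suc i) < norm x}) \<longlonglongrightarrow> measure \<nu> (\<Inter>i. {x::'b. real (Suc i) < norm x})"
    proof (rule Lim_measure_decseq)
      show "range (\<lambda>i. {x::'b. real (Suc i) < norm x}) \<subseteq> sets \<nu>" using m1 by auto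
      show "decseq (\<lambda>i. {x::'b. real (Suc i) < norm x})" by (auto simp: decseq_def)
      show "emeasure \<nu> {x. real (Suc i) < norm x} \<noteq> \<infinity>" for i using fin'[of "Suc i"] by auto
    qed
    moreover have "(\<Inter>i. {x::'b. real (Suc i) < norm x}) = {}"
    proof -
      have "\<exists>i. \<not> real (Suc i) < norm x" for x :: 'b
        using reals_Archimedean2[of "norm x"] by (metis not_less_iff_gr_or_eq less_Suc_eq of_nat_less_iff less_trans)
      then show ?thesis by blast
    qed
    ultimately have "(\<lambda>i. measure \<nu> {x. real (Suc i) < norm x}) \<longlonglongrightarrow> 0" by simp
    from order_tendstoD(2)[OF this e] obtain i where i: "?G (real (Suc i)) < e"
      by (auto simp: eventually_sequentially)
    obtain s where "s \<in> ?C" "real (Suc i) < s" using dense[of "real (Suc i)" "real (Suc i) + 1"] by auto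
    then show ?thesis using Ganti[of "real (Suc i)" s] i by (intro bexI[of _ s]) auto
  qed
  \<comment> \<open>Non-degeneracy: the punctured space is a countable union of complements of
    balls, so one of them is not a null set.\<close>
  have "\<exists>s\<in>?C. 0 < ?G s"
  proof -
    have "(\<Union>i. {x::'b. 1 / real (Suc i) < norm x}) = - {0}"
    proof -
      have "\<exists>i. 1 / real (Suc i) < norm x" if "x \<noteq> 0" for x :: 'b
        using reals_Archimedean[of "norm x"] that by (auto simp: inverse_eq_divide)
      then show ?thesis by auto
    qed
    moreover have "(\<Union>i. {x::'b. 1 / real (Suc i) < norm x}) \<notin> null_sets \<nu>"
      using nz unfolding calculation space[symmetric] by auto
    ultimately obtain i where "{x. 1 / real (Suc i) < norm x} \<notin> null_sets \<nu>"
      using null_sets_UN[of "\<lambda>i. {x::'b. 1 / real (Suc i) < norm x}" \<nu>] by blast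
    then have "emeasure \<nu> {x. 1 / real (Suc i) < norm x} \<noteq> 0" using m1[of "1 / real (Suc i)"] by (simp add: null_sets_def)
    then have p: "?G (1 / real (Suc i)) > 0"
      using fin'[of "1 / real (Suc i)"] by (simp add: measure_def enn2real_positive_iff zero_less_iff_neq_zero less_top)
    obtain s where s: "s \<in> ?C" "s < 1 / real (Suc i)"
    proof -
      have "0 < 1 / real (Suc i) / 2" "1 / real (Suc i) / 2 < 1 / real (Suc i)" by (simp_all add: field_simps)
      from dense[OF this] that show thesis by blast
    qed
    then show ?thesis using Ganti[of s "1 / real (Suc i)"] p by (intro bexI[of _ s]) auto
  qed
  then obtain s where s: "s \<in> ?C" "0 < ?G s" by blast
  \<comment> \<open>If the tail vanished from some point on, all later ratios would be 0 / 0 = 0,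
    against the positive limit at \<open>s\<close>.\<close>
  have pos: "0 < ?H t" for t
  proof (rule ccontr)
    assume "\<not> 0 < ?H t"
    then have z: "?H u = 0" if "u \<ge> t" for u using anti[OF that] by (simp add: not_less measure_le_0_iff)
    have "eventually (\<lambda>u. ?H (s * u) / ?H u = 0) at_top"
      using eventually_ge_at_top[of t] by eventually_elim (simp add: z)
    then have "((\<lambda>u. ?H (s * u) / ?H u) \<longlongrightarrow> 0) at_top" by (rule tendsto_eventually)
    with C_lim[OF s(1)] have "?G s = 0" by (intro tendsto_unique) auto
    then show False using s by simp
  qed
  have "regular_tail ?H ?G ?C"
    by unfold_locales (use pos anti C_lim small dense in \<open>auto simp: Bex_def\<close>)
  then show ?thesis by blast
qed

section \<open>Top order statistics of a regularly varying sample\<close>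

context prob_space
begin

text \<open>An exceptional event instead of the probability of the complement leaves
  \<open>P\<close> arbitrary, measurable or not. The level is a separate parameter because tightness
  gives a bound that depends on it.\<close>

definition holds_up_to :: "real \<Rightarrow> (nat \<Rightarrow> 'a \<Rightarrow> bool) \<Rightarrow> bool" where
  "holds_up_to \<eta> P \<longleftrightarrow> (\<forall>\<^sub>F n in sequentially. \<exists>A\<in>events. prob A \<le> \<eta> \<and> (\<forall>w\<in>space M - A. P n w))"

definition whp :: "(nat \<Rightarrow> 'a \<Rightarrow> bool) \<Rightarrow> bool" where
  "whp P \<longleftrightarrow> (\<forall>\<eta>>0. holds_up_to \<eta> P)"

lemma holds_up_to_mono:
  assumes "holds_up_to \<eta> P" "\<forall>\<^sub>F n in sequentially. \<forall>w\<in>space M. P n w \<longrightarrow> Q n w"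
  shows "holds_up_to \<eta> Q"
  using assms unfolding holds_up_to_def by eventually_elim blast

lemma holds_up_to_conj:
  assumes "holds_up_to a P" "holds_up_to b Q"
  shows "holds_up_to (a + b) (\<lambda>n w. P n w \<and> Q n w)"
  using assms unfolding holds_up_to_def
proof eventually_elim
  case (elim n)
  then obtain A B where *: "A \<in> events" "prob A \<le> a" "\<forall>w\<in>space M - A. P n w"
    "B \<in> events" "prob B \<le> b" "\<forall>w\<in>space M - B. Q n w" by blast
  then have "prob (A \<union> B) \<le> a + b" using measure_Un_le[of A M B] by simp
  then show ?case using * by (intro bexI[of _ "A \<union> B"]) auto
qed

lemma whp_mono:
  "whp P \<Longrightarrow> \<forall>\<^sub>F n in sequentially. \<forall>w\<in>space M. P n w \<longrightarrow> Q n w \<Longrightarrow> whp Q"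
  unfolding whp_def using holds_up_to_mono by blast

lemma holds_up_to_whp:
  assumes P: "holds_up_to \<eta> P" and Q: "whp Q" and \<eta>: "\<eta> < \<eta>'"
  shows "holds_up_to \<eta>' (\<lambda>n w. P n w \<and> Q n w)"
  using holds_up_to_conj[OF P, of "\<eta>' - \<eta>" Q] Q \<eta> by (simp add: whp_def)

lemma whp_conj:
  assumes "whp P" "whp Q"
  shows "whp (\<lambda>n w. P n w \<and> Q n w)"
  unfolding whp_def
proof (intro allI impI)
  fix \<eta> :: real assume "\<eta> > 0"
  then show "holds_up_to \<eta> (\<lambda>n w. P n w \<and> Q n w)"
    using holds_up_to_whp[of "\<eta> / 2" P Q \<eta>] assms by (simp add: whp_def)
qed

text \<open>Bounded convergence in probability; one \<open>e\<close> bounds both the error and the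
  probability of the exceptional event.\<close>

lemma expectation_tendsto_0:
  fixes Y :: "nat \<Rightarrow> 'a \<Rightarrow> real"
  assumes Y: "\<forall>\<^sub>F n in sequentially. Y n \<in> borel_measurable M" and B: "\<And>n w. w \<in> space M \<Longrightarrow> \<bar>Y n w\<bar> \<le> B"
    and small: "\<And>e. e > 0 \<Longrightarrow> holds_up_to e (\<lambda>n w. \<bar>Y n w\<bar> \<le> e)"
  shows "(\<lambda>n. expectation (Y n)) \<longlonglongrightarrow> 0"
proof (rule tendstoI)
  fix e :: real assume e: "e > 0"
  have B0: "B \<ge> 0" using B not_empty by (metis abs_ge_zero ex_in_conv order_trans)
  \<comment> \<open>The two contributions \<open>d\<close> and \<open>B * d\<close> then add up to
    \<open>e / 2\<close>.\<close>
  define d where "d = e / (2 * (B + 1))"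
  have d: "d > 0" "d * (B + 1) < e"
  proof -
    have "d * (B + 1) = e / 2" using B0 by (simp add: d_def nonzero_divide_eq_eq)
    then show "d * (B + 1) < e" using e by simp
    show "d > 0" using e B0 by (simp add: d_def)
  qed
  show "\<forall>\<^sub>F n in sequentially. dist (expectation (Y n)) 0 < e"
    using small[OF d(1), unfolded holds_up_to_def] Y
  proof eventually_elim
    case (elim n)
    note [measurable] = elim(2)
    from elim obtain A where [measurable]: "A \<in> events" and A: "prob A \<le> d" "\<forall>w\<in>space M - A. \<bar>Y n w\<bar> \<le> d" by blast
    have "\<bar>expectation (Y n)\<bar> \<le> expectation (\<lambda>w. \<bar>Y n w\<bar>)" by (rule integral_abs_bound)
    also have "\<dots> \<le> expectation (\<lambda>w. d + B * indicator A w)"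
    proof (rule integral_mono)
      show "integrable M (\<lambda>w. \<bar>Y n w\<bar>)" using B by (intro integrable_const_bound[of _ B]) auto
      show "\<bar>Y n w\<bar> \<le> d + B * indicator A w" if "w \<in> space M" for w
        using A(2) B[OF that, of n] that d by (cases "w \<in> A") auto
    qed (simp add: less_top[symmetric])
    also have "\<dots> = d + B * prob A" by (simp add: prob_space less_top[symmetric])
    also have "\<dots> \<le> d + B * d" using A B0 by (simp add: mult_left_mono)
    also have "\<dots> < e" using d by (simp add: algebra_simps)
    finally show ?case by simp
  qed
qed

text \<open>The count is binomial, with variance n q (1 - q) at most its mean n q.\<close>

lemma count_second_moment:
  fixes Xs :: "nat \<Rightarrow> 'a \<Rightarrow> 'b::euclidean_space" and B :: "'b set"
  assumes indep: "indep_vars (\<lambda>_. borel) Xs UNIV" and law: "\<And>i. distr M borel (Xs i) = distr M borel X"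
    and X[measurable]: "X \<in> borel_measurable M" and B[measurable]: "B \<in> sets borel"
  defines "q \<equiv> prob {w\<in>space M. X w \<in> B}"
  shows "expectation (\<lambda>w. (real (card {i\<in>{..<n}. Xs i w \<in> B}) - real n * q)\<^sup>2) \<le> real n * q"
    and "integrable M (\<lambda>w. (real (card {i\<in>{..<n}. Xs i w \<in> B}) - real n * q)\<^sup>2)"
proof -
  have [measurable]: "Xs i \<in> borel_measurable M" for i using indep by (auto simp: indep_vars_def)
  define D where "D i w = indicator B (Xs i w) - q" for i w
  have q: "0 \<le> q" "q \<le> 1" by (auto simp: q_def)
  have Dm[measurable]: "D i \<in> borel_measurable M" for i unfolding D_def by measurable
  have D1: "\<bar>D i w\<bar> \<le> 1" for i w using q by (auto simp: D_def indicator_def)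
  have intD: "integrable M (D i)" "integrable M (\<lambda>w. D i w * D j w)" for i j
    using D1 by (auto intro!: integrable_const_bound[of _ 1] simp: abs_mult mult_le_one)
  have ind: "expectation (\<lambda>w. indicator B (Xs i w)) = q" for i
  proof -
    have "expectation (\<lambda>w. indicator B (Xs i w)) = (\<integral>x. indicat_real B x \<partial>distr M borel (Xs i))"
      by (rule integral_distr[symmetric]) simp_all
    also have "\<dots> = (\<integral>x. indicat_real B x \<partial>distr M borel X)" by (simp add: law)
    also have "\<dots> = q" by (simp add: measure_distr q_def vimage_def Int_def conj_commute)
    finally show ?thesis .
  qed
  have indi: "integrable M (\<lambda>w. indicat_real B (Xs i w))" for i
    by (intro integrable_const_bound[of _ 1]) auto
  have D0: "expectation (D i) = 0" for i
    unfolding D_def using indi ind[of i] by (simp add: prob_space)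
  have cross: "expectation (\<lambda>w. D i w * D j w) = 0" if "i \<noteq> j" for i j
  proof -
    have "indep_vars (\<lambda>_. borel) (\<lambda>i w. (\<lambda>x. indicator B x - q) (Xs i w)) {i, j}"
      by (rule indep_vars_compose2[where X = Xs]) (auto intro: indep_vars_subset[OF indep])
    then have iv: "indep_vars (\<lambda>_. borel) D {i, j}" by (simp add: D_def[abs_def])
    have "expectation (\<lambda>w. \<Prod>l\<in>{i, j}. D l w) = (\<Prod>l\<in>{i, j}. expectation (D l))"
      by (rule indep_vars_lebesgue_integral[OF _ iv]) (auto intro: intD)
    then show ?thesis using that by (simp add: D0)
  qed
  have diag: "expectation (\<lambda>w. D i w * D i w) \<le> q" for i
  proof -
    have "D i w * D i w = (1 - 2 * q) * indicator B (Xs i w) + q * q" for w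
      by (auto simp: D_def indicator_def algebra_simps)
    then have "expectation (\<lambda>w. D i w * D i w) = (1 - 2 * q) * q + q * q"
      using indi ind[of i] by (simp add: prob_space)
    also have "\<dots> \<le> q" using q by (simp add: algebra_simps)
    finally show ?thesis .
  qed
  have eq: "real (card {i\<in>{..<n}. Xs i w \<in> B}) - real n * q = (\<Sum>i<n. D i w)" for w
  proof -
    have "(\<Sum>i<n. indicat_real B (Xs i w)) = real (card {i\<in>{..<n}. Xs i w \<in> B})"
      by (simp add: indicator_def sum.If_cases Int_def)
    then show ?thesis by (simp add: D_def sum_subtractf)
  qed
  have sq: "(\<Sum>i<n. D i w)\<^sup>2 = (\<Sum>i<n. \<Sum>j<n. D i w * D j w)" for w
    by (simp add: power2_eq_square sum_product)
  show "integrable M (\<lambda>w. (real (card {i\<in>{..<n}. Xs i w \<in> B}) - real n * q)\<^sup>2)"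
    unfolding eq sq using intD by (intro Bochner_Integration.integrable_sum)
  have "expectation (\<lambda>w. (\<Sum>i<n. D i w)\<^sup>2) = (\<Sum>i<n. \<Sum>j<n. expectation (\<lambda>w. D i w * D j w))"
    unfolding sq using intD by (simp add: Bochner_Integration.integral_sum)
  also have "\<dots> = (\<Sum>i<n. \<Sum>j<n. if i = j then expectation (\<lambda>w. D i w * D i w) else 0)"
    using cross by (intro sum.cong) auto
  also have "\<dots> = (\<Sum>i<n. expectation (\<lambda>w. D i w * D i w))" by simp
  also have "\<dots> \<le> (\<Sum>i<n. q)" by (intro sum_mono diag)
  finally show "expectation (\<lambda>w. (real (card {i\<in>{..<n}. Xs i w \<in> B}) - real n * q)\<^sup>2) \<le> real n * q"
    unfolding eq by simp
qed

text \<open>Chebyshev's inequality at deviation \<open>e / 2 * k n\<close>: the variance is at most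
  of order \<open>k n\<close>, so the bound is of order \<open>1 / k n\<close>. The other half of
  \<open>e\<close> pays for the convergence of the mean.\<close>

lemma whp_count:
  fixes Xs :: "nat \<Rightarrow> 'a \<Rightarrow> 'b::euclidean_space" and B :: "nat \<Rightarrow> 'b set"
  assumes indep: "indep_vars (\<lambda>_. borel) Xs UNIV" and law: "\<And>i. distr M borel (Xs i) = distr M borel X"
    and X[measurable]: "X \<in> borel_measurable M" and B: "\<And>n. B n \<in> sets borel"
    and k: "filterlim k at_top sequentially"
    and lim: "(\<lambda>n. real n * prob {w\<in>space M. X w \<in> B n} / real (k n)) \<longlonglongrightarrow> c" and e: "e > 0"
  shows "whp (\<lambda>n w. \<bar>real (card {i\<in>{..<n}. Xs i w \<in> B n}) / real (k n) - c\<bar> \<le> e)"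
  unfolding whp_def
proof (intro allI impI)
  fix \<eta> :: real assume \<eta>: "\<eta> > 0"
  let ?q = "\<lambda>n. prob {w\<in>space M. X w \<in> B n}"
  let ?N = "\<lambda>n w. real (card {i\<in>{..<n}. Xs i w \<in> B n})"
  have kr: "filterlim (\<lambda>n. real (k n)) at_top sequentially"
    by (rule filterlim_compose[OF filterlim_real_sequentially k])
  have "(\<lambda>n. 4 / e\<^sup>2 * (real n * ?q n / real (k n)) * inverse (real (k n))) \<longlonglongrightarrow> 4 / e\<^sup>2 * c * 0"
    by (intro tendsto_intros lim tendsto_inverse_0_at_top kr)
  then have "\<forall>\<^sub>F n in sequentially. 4 / e\<^sup>2 * (real n * ?q n / real (k n)) * inverse (real (k n)) < \<eta>"
    using \<eta> by (intro order_tendstoD) auto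
  moreover have "\<forall>\<^sub>F n in sequentially. \<bar>real n * ?q n / real (k n) - c\<bar> < e / 2"
    using tendstoD[OF lim, of "e / 2"] e by (simp add: dist_real_def)
  moreover have "\<forall>\<^sub>F n in sequentially. 0 < real (k n)"
    using kr[unfolded filterlim_at_top_dense] by (rule spec)
  ultimately show "holds_up_to \<eta> (\<lambda>n w. \<bar>?N n w / real (k n) - c\<bar> \<le> e)"
    unfolding holds_up_to_def
  proof eventually_elim
    case (elim n)
    note m = count_second_moment[OF indep law X B, of n n]
    let ?A = "{w\<in>space M. (?N n w - real n * ?q n)\<^sup>2 \<ge> (e / 2 * real (k n))\<^sup>2}"
    have "prob ?A \<le> expectation (\<lambda>w. (?N n w - real n * ?q n)\<^sup>2) / (e / 2 * real (k n))\<^sup>2"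
      using e elim(3) by (intro integral_Markov_inequality_measure[where A = "{}"] m) auto
    also have "\<dots> \<le> (real n * ?q n) / (e / 2 * real (k n))\<^sup>2"
      by (intro divide_right_mono m) auto
    also have "\<dots> = 4 / e\<^sup>2 * (real n * ?q n / real (k n)) * inverse (real (k n))"
      using e elim(3) by (simp add: power2_eq_square field_simps)
    finally have pA: "prob ?A \<le> \<eta>" using elim(1) by simp
    have mA: "?A \<in> events"
      using borel_measurable_integrable[OF m(2)] by measurable
    have "\<bar>?N n w / real (k n) - c\<bar> \<le> e" if "w \<in> space M - ?A" for w
    proof -
      have sq: "\<bar>?N n w - real n * ?q n\<bar>\<^sup>2 < (e / 2 * real (k n))\<^sup>2"
      proof (rule ccontr)
        assume "\<not> ?thesis"
        then have "w \<in> ?A" using that unfolding power2_abs not_less by blast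
        then show False using that by blast
      qed
      have "0 \<le> e / 2 * real (k n)" using e by simp
      from power2_less_imp_less[OF sq this]
      have "\<bar>?N n w - real n * ?q n\<bar> < e / 2 * real (k n)" .
      then have "\<bar>?N n w - real n * ?q n\<bar> / real (k n) < e / 2" using elim(3) by (simp add: field_simps)
      moreover have "\<bar>?N n w - real n * ?q n\<bar> / real (k n) = \<bar>?N n w / real (k n) - real n * ?q n / real (k n)\<bar>"
        using elim(3) by (simp add: diff_divide_distrib[symmetric])
      ultimately have 1: "\<bar>?N n w / real (k n) - real n * ?q n / real (k n)\<bar> < e / 2" by (simp only:)
      have "\<bar>x - c\<bar> \<le> e" if "\<bar>x - y\<bar> < e / 2" "\<bar>y - c\<bar> < e / 2" for x y
        using that by linarith
      from this[OF 1 elim(2)] show ?thesis .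
    qed
    then show ?case using mA pA by blast
  qed
qed

end

section \<open>Order statistic and quantile\<close>

locale top_order_statistics = prob_space M + regular_tail H G C
  for M :: "'a measure" and H G :: "real \<Rightarrow> real" and C :: "real set" +
  fixes X :: "'a \<Rightarrow> 'b::euclidean_space" and Xs :: "nat \<Rightarrow> 'a \<Rightarrow> 'b" and k :: "nat \<Rightarrow> nat"
    and t :: "nat \<Rightarrow> real"
  assumes H_eq: "\<And>s. H s = prob {w\<in>space M. s < norm (X w)}"
    and X_meas: "X \<in> borel_measurable M"
    and indep: "indep_vars (\<lambda>_. borel) Xs UNIV"
    and law: "\<And>i. distr M borel (Xs i) = distr M borel X"
    and k: "filterlim k at_top sequentially" "(\<lambda>n. real (k n) / real n) \<longlonglongrightarrow> 0"
    and t: "\<And>n. t n = norm_quantile M X (1 - real (k n) / real n)"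
begin

lemma Xs_meas [measurable]: "Xs i \<in> borel_measurable M"
  using indep by (auto simp: indep_vars_def)

lemma k_range: "\<forall>\<^sub>F n in sequentially. 0 < k n \<and> k n < n"
proof -
  have "\<forall>\<^sub>F n in sequentially. 1 \<le> k n" using k(1) by (auto simp: filterlim_at_top)
  moreover have "\<forall>\<^sub>F n in sequentially. real (k n) / real n < 1" using k(2) by (intro order_tendstoD) auto
  ultimately show ?thesis using eventually_gt_at_top[of 0]
    by eventually_elim (auto simp: divide_less_eq)
qed

text \<open>The norm may have an atom at \<open>t n\<close>, so \<open>H (t n)\<close> need not
  equal \<open>k n / n\<close>; what survives are bounds strictly on either side of the
  quantile.\<close>

lemma quantile_tail:
  assumes "0 < k n" "k n < n"
  shows "t n < y \<Longrightarrow> H y \<le> real (k n) / real n" and "y < t n \<Longrightarrow> real (k n) / real n < H y"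
proof -
  note [measurable] = X_meas
  let ?q = "1 - real (k n) / real n"
  let ?F = "\<lambda>r. prob {w\<in>space M. norm (X w) \<le> r}"
  let ?S = "{r. ?q \<le> ?F r}"
  have q: "0 < ?q" "?q < 1" using assms by auto
  have F: "?F r = 1 - H r" for r
  proof -
    have "?F r = 1 - prob {w\<in>space M. \<not> norm (X w) \<le> r}" by (subst prob_neg) auto
    then show ?thesis by (simp add: H_eq not_le)
  qed
  interpret N: real_distribution "distr M borel (\<lambda>w. norm (X w))" by (rule real_distribution_distr) simp
  have "?F r = cdf (distr M borel (\<lambda>w. norm (X w))) r" for r
    by (simp add: cdf_def measure_distr vimage_def Int_def conj_commute)
  then have "(?F \<longlongrightarrow> 1) at_top" using N.cdf_lim_at_top_prob by simp
  from order_tendstoD(1)[OF this q(2)] obtain r where "?q < ?F r"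
    by (auto simp: eventually_at_top_linorder)
  then have ne: "?S \<noteq> {}" by (auto intro: less_imp_le)
  have "0 \<le> r" if "r \<in> ?S" for r
  proof (rule ccontr)
    assume "\<not> 0 \<le> r"
    then have "\<not> norm (X w) \<le> r" for w using norm_ge_zero[of "X w"] by linarith
    then have "{w\<in>space M. norm (X w) \<le> r} = {}" by blast
    then have "?F r = 0" by (simp only: measure_empty)
    then show False using that q by simp
  qed
  then have bdd: "bdd_below ?S" by (intro bdd_belowI)
  have tS: "t n = Inf ?S" by (simp add: t norm_quantile_def)
  show "H y \<le> real (k n) / real n" if y: "t n < y"
  proof -
    obtain r where "r \<in> ?S" "r < y" using cInf_lessD[OF ne y[unfolded tS]] by blast
    then show ?thesis using anti[of r y] F[of r] by simp
  qed
  show "real (k n) / real n < H y" if "y < t n"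
  proof -
    have "y \<notin> ?S" using that bdd cInf_lower[of y ?S] unfolding tS by force
    then show ?thesis using F[of y] by simp
  qed
qed

lemma t_at_top: "filterlim t at_top sequentially"
  unfolding filterlim_at_top
proof
  fix Z :: real
  have "\<forall>\<^sub>F n in sequentially. real (k n) / real n < H (Z + 1)"
    using k(2) pos by (intro order_tendstoD)
  then show "\<forall>\<^sub>F n in sequentially. Z \<le> t n" using k_range
  proof eventually_elim
    case (elim n)
    then show ?case using quantile_tail(1)[of n "Z + 1"] by force
  qed
qed

lemma ratio_lim_quantile:
  assumes "ratio_lim H s c"
  shows "(\<lambda>n. H (s * t n) / H (t n)) \<longlonglongrightarrow> c"
  using assms filterlim_compose[OF _ t_at_top] by (auto simp: ratio_lim_def)

text \<open>For \<open>s\<close> just above 1 the tail is at most \<open>k n / n\<close> at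
  \<open>s * t n\<close> and larger than it at \<open>t n / s\<close>. By
  \<open>ratio_lim_near_1\<close> the tail changes only by a factor close to 1 in between, so a jump
  at \<open>t n\<close> is asymptotically negligible.\<close>

lemma tail_at_quantile: "(\<lambda>n. real n * H (t n) / real (k n)) \<longlonglongrightarrow> 1"
proof -
  let ?a = "\<lambda>n. real n * H (t n) / real (k n)"
  have tpos: "\<forall>\<^sub>F n in sequentially. 0 < t n" using t_at_top[unfolded filterlim_at_top_dense] by (rule spec)
  have up: "\<forall>\<^sub>F n in sequentially. ?a n < 1 + e" if e: "e > 0" for e
  proof -
    have "1 - 1 / (1 + e) > 0" using e by simp
    then obtain s c where s: "s > 1" "ratio_lim H s c" "1 - (1 - 1 / (1 + e)) < c"
      using ratio_lim_near_1 by blast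
    have "\<forall>\<^sub>F n in sequentially. 1 / (1 + e) < H (s * t n) / H (t n)"
      using s(3) by (intro order_tendstoD(1)[OF ratio_lim_quantile[OF s(2)]]) simp
    then show ?thesis using k_range tpos
    proof eventually_elim
      case (elim n)
      have "H (s * t n) \<le> real (k n) / real n"
        using elim s(1) by (intro quantile_tail) (auto simp: mult_less_cancel_right2)
      then have "real n * H (s * t n) \<le> real (k n)" using elim by (simp add: field_simps)
      moreover have "H (t n) < (1 + e) * H (s * t n)" using elim(1) pos[of "t n"] e by (simp add: field_simps)
      then have "real n * H (t n) < (1 + e) * (real n * H (s * t n))"
        using elim by (simp add: mult.left_commute)
      ultimately have "real n * H (t n) < (1 + e) * real (k n)"
        using e by (smt (verit) mult_left_mono)
      then show ?case using elim by (simp add: field_simps)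
    qed
  qed
  have low: "\<forall>\<^sub>F n in sequentially. 1 - e < ?a n" if e: "e > 0" for e
  proof -
    \<comment> \<open>The minimum with 1/2 keeps the lower bound for \<open>c\<close> positive, so
      that its reciprocal can be used.\<close>
    obtain s c where s: "s > 1" "ratio_lim H s c" "1 - min e (1/2) < c"
      using ratio_lim_near_1[of "min e (1/2)"] e by auto
    have c0: "c > 0" using s by (simp add: ratio_lim_def)
    have "\<forall>\<^sub>F n in sequentially. H (1 / s * t n) / H (t n) < 1 / (1 - min e (1/2))"
      using s(3) c0 by (intro order_tendstoD(2)[OF ratio_lim_quantile[OF ratio_lim_inverse[OF s(2)]]])
        (simp add: frac_less2)
    then show ?thesis using k_range tpos
    proof eventually_elim
      case (elim n)
      let ?m = "1 - min e (1/2)"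
      have m: "?m > 0" by auto
      have "real (k n) / real n < H (1 / s * t n)"
        using elim s(1) by (intro quantile_tail) (auto simp: field_simps)
      then have "real (k n) < real n * H (1 / s * t n)" using elim by (simp add: field_simps)
      moreover have "?m * H (1 / s * t n) < H (t n)" using elim(1) pos[of "t n"] m by (simp add: field_simps)
      then have "?m * (real n * H (1 / s * t n)) \<le> real n * H (t n)"
        by (metis less_imp_le mult.left_commute mult_left_mono of_nat_0_le_iff)
      ultimately have "?m * real (k n) < real n * H (t n)"
        using m by (smt (verit) mult_strict_left_mono)
      then have "?m < ?a n" using elim by (simp add: field_simps)
      moreover have "1 - e \<le> ?m" by simp
      ultimately show ?case by linarith
    qed
  qed
  show ?thesis
  proof (rule tendstoI)
    fix e :: real assume "e > 0"
    from up[OF this] low[OF this] show "\<forall>\<^sub>F n in sequentially. dist (?a n) 1 < e"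
      by eventually_elim (auto simp: dist_real_def)
  qed
qed

definition T :: "nat \<Rightarrow> 'a \<Rightarrow> real" where "T n w = norm_order_stat n (k n) (\<lambda>i. Xs i w)"

definition E :: "nat \<Rightarrow> 'a \<Rightarrow> nat set" where "E n w = exceed n (k n) (\<lambda>i. Xs i w)"

lemma whp_count_quantile:
  assumes s: "ratio_lim H s c" and e: "e > 0"
  shows "whp (\<lambda>n w. \<bar>real (card {i\<in>{..<n}. s * t n < norm (Xs i w)}) / real (k n) - c\<bar> \<le> e)"
proof -
  have "(\<lambda>n. (real n * H (t n) / real (k n)) * (H (s * t n) / H (t n))) \<longlonglongrightarrow> 1 * c"
    by (intro tendsto_mult tail_at_quantile ratio_lim_quantile[OF s])
  then have "(\<lambda>n. real n * prob {w\<in>space M. X w \<in> {x. s * t n < norm x}} / real (k n)) \<longlonglongrightarrow> c"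
    by (simp add: mult_ac flip: H_eq)
  from whp_count[OF indep law X_meas _ k(1) this e] show ?thesis by simp
qed

text \<open>About \<open>c * k n\<close> points exceed \<open>s * t n\<close>, and
  \<open>c < 1\<close> since \<open>s > 1\<close>; hence at most \<open>k n\<close> do.\<close>

lemma whp_T_le:
  assumes "ratio_lim H s c" "s > 1"
  shows "whp (\<lambda>n w. T n w \<le> s * t n)"
proof -
  have c: "c < 1" using assms by (rule ratio_lim_less_1)
  show ?thesis
  proof (rule whp_mono[OF whp_count_quantile[OF assms(1), of "1 - c"]])
    show "0 < 1 - c" using c by simp
    show "\<forall>\<^sub>F n in sequentially. \<forall>w\<in>space M.
      \<bar>real (card {i\<in>{..<n}. s * t n < norm (Xs i w)}) / real (k n) - c\<bar> \<le> 1 - c \<longrightarrow> T n w \<le> s * t n"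
      using k_range
    proof eventually_elim
      case (elim n)
      show ?case
      proof (intro ballI impI)
        fix w assume "\<bar>real (card {i\<in>{..<n}. s * t n < norm (Xs i w)}) / real (k n) - c\<bar> \<le> 1 - c"
        then have "real (card {i\<in>{..<n}. s * t n < norm (Xs i w)}) / real (k n) \<le> 1" by linarith
        then have "card {i\<in>{..<n}. s * t n < norm (Xs i w)} \<le> k n" using elim by simp
        then show "T n w \<le> s * t n" unfolding T_def using elim by (simp add: norm_order_stat_le_iff)
      qed
    qed
  qed
qed

lemma whp_T_gt:
  assumes "ratio_lim H s c" "s < 1"
  shows "whp (\<lambda>n w. s * t n < T n w)"
proof -
  have c: "1 < c" using assms by (rule ratio_lim_greater_1)
  show ?thesis
  \<comment> \<open>A margin of half of \<open>c - 1\<close> is kept because here the count must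
    exceed \<open>k n\<close> strictly; the upper bound on \<open>T\<close> tolerates
    equality.\<close>
  proof (rule whp_mono[OF whp_count_quantile[OF assms(1), of "(c - 1) / 2"]])
    show "0 < (c - 1) / 2" using c by simp
    show "\<forall>\<^sub>F n in sequentially. \<forall>w\<in>space M.
      \<bar>real (card {i\<in>{..<n}. s * t n < norm (Xs i w)}) / real (k n) - c\<bar> \<le> (c - 1) / 2 \<longrightarrow> s * t n < T n w"
      using k_range
    proof eventually_elim
      case (elim n)
      show ?case
      proof (intro ballI impI)
        fix w assume "\<bar>real (card {i\<in>{..<n}. s * t n < norm (Xs i w)}) / real (k n) - c\<bar> \<le> (c - 1) / 2"
        then have "c - (c - 1) / 2 \<le> real (card {i\<in>{..<n}. s * t n < norm (Xs i w)}) / real (k n)" by linarith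
        moreover have "1 < c - (c - 1) / 2" using c by (simp add: field_simps)
        ultimately have "1 < real (card {i\<in>{..<n}. s * t n < norm (Xs i w)}) / real (k n)" by linarith
        then have "\<not> card {i\<in>{..<n}. s * t n < norm (Xs i w)} \<le> k n" using elim by (simp add: field_simps)
        then have "\<not> T n w \<le> s * t n" unfolding T_def using elim by (simp add: norm_order_stat_le_iff)
        then show "s * t n < T n w" by simp
      qed
    qed
  qed
qed

lemma whp_T_near:
  assumes e: "0 < e"
  shows "whp (\<lambda>n w. (1 - e) * t n \<le> T n w \<and> T n w \<le> (1 + e) * t n)"
proof -
  obtain s1 where s1: "s1 \<in> C" "1 < s1" "s1 < 1 + e" using C_dense[of 1 "1 + e"] e by auto
  \<comment> \<open>The bound 1/2 keeps the scale positive even if \<open>e\<close> is 1 or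
    more.\<close>
  obtain s2 where s2: "s2 \<in> C" "max (1/2) (1 - e) < s2" "s2 < 1"
    using C_dense[of "max (1/2) (1 - e)" 1] e by (auto simp: less_max_iff_disj)
  have "\<forall>\<^sub>F n in sequentially. 0 < t n" using t_at_top[unfolded filterlim_at_top_dense] by (rule spec)
  then show ?thesis
  proof (intro whp_mono[OF whp_conj[OF whp_T_le whp_T_gt], OF ratio_lim_C[OF s1(1)] s1(2) ratio_lim_C[OF s2(1)] s2(3)],
      eventually_elim)
    case (elim n)
    have "(1 - e) * t n \<le> s2 * t n" "s1 * t n \<le> (1 + e) * t n"
      using elim s1 s2 by (auto intro!: mult_right_mono)
    then show ?case by auto
  qed
qed

lemma whp_T_large: "whp (\<lambda>n w. Z \<le> T n w)"
proof -
  have "\<forall>\<^sub>F n in sequentially. 2 * Z \<le> t n" using t_at_top by (auto simp: filterlim_at_top)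
  then show ?thesis
    by (intro whp_mono[OF whp_T_near[of "1/2"]]) (auto elim!: eventually_mono)
qed

text \<open>Ties at \<open>T\<close> can lower the number of exceedances. With high probability
  \<open>T n w \<le> s * t n\<close> for \<open>s\<close> just above 1, so all exceedances of
  \<open>s * t n\<close> are included, and those number about \<open>c * k n\<close> with
  \<open>c\<close> close to 1.\<close>

lemma whp_card_E:
  assumes e: "0 < e"
  shows "whp (\<lambda>n w. 1 - e \<le> real (card (E n w)) / real (k n))"
proof -
  obtain s c where s: "1 < s" "ratio_lim H s c" "1 - e / 2 < c" using ratio_lim_near_1[of "e / 2"] e by auto
  show ?thesis
  proof (rule whp_mono[OF whp_conj[OF whp_T_le[OF s(2,1)] whp_count_quantile[OF s(2), of "e / 2"]]])
    show "\<forall>\<^sub>F n in sequentially. \<forall>w\<in>space M. T n w \<le> s * t n \<and>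
        \<bar>real (card {i\<in>{..<n}. s * t n < norm (Xs i w)}) / real (k n) - c\<bar> \<le> e / 2 \<longrightarrow>
        1 - e \<le> real (card (E n w)) / real (k n)"
    proof (intro always_eventually allI ballI impI)
      fix n w
      assume a: "T n w \<le> s * t n \<and> \<bar>real (card {i\<in>{..<n}. s * t n < norm (Xs i w)}) / real (k n) - c\<bar> \<le> e / 2"
      have "card {i\<in>{..<n}. s * t n < norm (Xs i w)} \<le> card (E n w)"
        using a by (intro card_mono) (auto simp: E_def exceed_def T_def)
      then have "real (card {i\<in>{..<n}. s * t n < norm (Xs i w)}) / real (k n) \<le> real (card (E n w)) / real (k n)"
        by (intro divide_right_mono) auto
      then show "1 - e \<le> real (card (E n w)) / real (k n)" using a s(3) by linarith
    qed
  qed (use e in simp)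
qed

end

section \<open>A central limit theorem for exceedances\<close>

lemma exp_minus_approx:
  fixes x :: real
  assumes "0 \<le> x"
  shows "\<bar>(1 - x) - exp (- x)\<bar> \<le> x\<^sup>2"
proof -
  have "1 - x \<le> exp (- x)" using exp_ge_add_one_self[of "- x"] by simp
  moreover have "exp (- x) \<le> 1 - x + x\<^sup>2"
  proof -
    have "1 + x \<le> exp x" by (rule exp_ge_add_one_self)
    then have "exp (- x) \<le> 1 / (1 + x)" using assms by (simp add: exp_minus field_simps)
    also have "\<dots> \<le> 1 - x + x\<^sup>2"
    proof -
      have "(1 - x + x\<^sup>2) * (1 + x) = 1 + x ^ 3" by (simp add: algebra_simps power2_eq_square power3_eq_cube)
      then show ?thesis using assms by (simp add: pos_divide_le_eq)
    qed
    finally show ?thesis .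
  qed
  ultimately show ?thesis by (simp add: abs_le_iff)
qed

lemma exp_minus_lipschitz:
  fixes a b :: real
  assumes "0 \<le> a" "0 \<le> b"
  shows "\<bar>exp (- a) - exp (- b)\<bar> \<le> \<bar>a - b\<bar>"
proof -
  have *: "exp (- x) - exp (- y) \<le> y - x" if "0 \<le> x" "x \<le> y" for x y :: real
  proof -
    have "exp (- x) - exp (- y) = exp (- x) * (1 - exp (- (y - x)))" by (simp add: algebra_simps flip: exp_add)
    also have "\<dots> \<le> 1 * (y - x)"
    proof (rule mult_mono)
      show "1 - exp (- (y - x)) \<le> y - x" using exp_ge_add_one_self[of "- (y - x)"] by linarith
    qed (use that in auto)
    finally show ?thesis by simp
  qed
  show ?thesis
  proof (cases "a \<le> b")
    case True
    then have "exp (- b) \<le> exp (- a)" by simp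
    then show ?thesis using *[of a b] assms True by simp
  next
    case False
    then have "exp (- a) \<le> exp (- b)" by simp
    then show ?thesis using *[of b a] assms False by simp
  qed
qed

context top_order_statistics
begin

lemma X_meas' [measurable]: "X \<in> borel_measurable M" by (rule X_meas)

lemma prob_space_cond_above: "prob_space (cond_above M X s)"
  unfolding cond_above_def
  by (rule prob_space_uniform_measure) (use pos[of s] in \<open>simp_all add: H_eq emeasure_eq_measure\<close>)

lemma sets_cond_above [measurable_cong]: "sets (cond_above M X s) = events"
  by (simp add: cond_above_def)

lemma integral_cond_above:
  fixes f :: "'a \<Rightarrow> 'c::{banach, second_countable_topology}"
  assumes [measurable]: "f \<in> borel_measurable M"
  shows "(\<integral>w. f w \<partial>cond_above M X s) = (\<integral>w. indicat_real {w\<in>space M. s < norm (X w)} w *\<^sub>R f w \<partial>M) /\<^sub>R H s"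
proof -
  let ?A = "{w\<in>space M. s < norm (X w)}"
  have [measurable]: "?A \<in> events" by measurable
  have "cond_above M X s = density M (\<lambda>w. ennreal (indicator ?A w / H s))"
    unfolding cond_above_def uniform_measure_def
    by (intro density_cong) (use pos[of s] in \<open>auto simp: H_eq emeasure_eq_measure divide_ennreal indicator_def simp flip: ennreal_1\<close>)
  then have "(\<integral>w. f w \<partial>cond_above M X s) = (\<integral>w. (indicator ?A w / H s) *\<^sub>R f w \<partial>M)"
    using pos[of s] by (simp add: integral_density)
  also have "\<dots> = (\<integral>w. (1 / H s) *\<^sub>R (indicat_real ?A w *\<^sub>R f w) \<partial>M)" by (intro Bochner_Integration.integral_cong) auto
  also have "\<dots> = (1 / H s) *\<^sub>R (\<integral>w. indicat_real ?A w *\<^sub>R f w \<partial>M)" by (rule integral_scaleR_right)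
  finally show ?thesis by (simp add: inverse_eq_divide)
qed

lemma integral_cond_above_distr:
  fixes g :: "'b \<Rightarrow> 'c::{banach, real_normed_field, second_countable_topology}"
  assumes [measurable]: "g \<in> borel_measurable borel"
  shows "(\<integral>x. g x * indicator {x. s < norm x} x \<partial>distr M borel X) /
      of_real (measure (distr M borel X) {x\<in>space (distr M borel X). s < norm x})
    = (\<integral>w. g (X w) \<partial>cond_above M X s)"
proof -
  have "{x::'b. s < norm x} \<in> sets borel" by measurable
  then have 1: "measure (distr M borel X) {x\<in>space (distr M borel X). s < norm x} = H s"
    by (simp add: measure_distr H_eq vimage_def Int_def conj_commute)
  have "(\<integral>x. g x * indicator {x. s < norm x} x \<partial>distr M borel X) = (\<integral>w. g (X w) * indicator {x. s < norm x} (X w) \<partial>M)"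
    by (rule integral_distr) measurable
  also have "\<dots> = (\<integral>w. indicat_real {w\<in>space M. s < norm (X w)} w *\<^sub>R g (X w) \<partial>M)"
    by (intro Bochner_Integration.integral_cong) (auto simp: indicator_def)
  finally show ?thesis
    unfolding 1 by (subst integral_cond_above) (auto simp: scaleR_conv_of_real divide_inverse mult.commute)
qed

lemma T_meas: "k n < n \<Longrightarrow> T n \<in> borel_measurable M"
  unfolding T_def[abs_def] by (rule measurable_norm_order_stat) auto

lemma card_E_eq: "real (card (E n w)) = (\<Sum>i<n. of_bool (T n w < norm (Xs i w)))"
  by (simp add: E_def exceed_def T_def of_bool_def sum.If_cases Int_def)

lemma card_E_meas: "k n < n \<Longrightarrow> (\<lambda>w. real (card (E n w))) \<in> borel_measurable M"
  unfolding card_E_eq using T_meas[of n] by measurable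

lemma card_E_le: "k n < n \<Longrightarrow> card (E n w) \<le> k n"
  unfolding E_def by (rule card_exceed_le)

context
  fixes f :: "'b \<Rightarrow> real" and B :: real
  assumes f_meas [measurable]: "f \<in> borel_measurable borel" and f_bound: "\<And>x. \<bar>f x\<bar> \<le> B"
begin

definition cond_mean :: "real \<Rightarrow> real" where
  "cond_mean s = (\<integral>w. f (X w) \<partial>cond_above M X s)"

definition cond_var :: "real \<Rightarrow> real" where
  "cond_var s = (\<integral>w. (f (X w) - cond_mean s)\<^sup>2 \<partial>cond_above M X s)"

lemma B_nonneg: "0 \<le> B"
  using f_bound[of 0] by linarith

lemma cond_mean_bound: "\<bar>cond_mean s\<bar> \<le> B"
proof -
  interpret Q: prob_space "cond_above M X s" by (rule prob_space_cond_above)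
  have "\<bar>cond_mean s\<bar> \<le> (\<integral>w. \<bar>f (X w)\<bar> \<partial>cond_above M X s)"
    unfolding cond_mean_def by (rule integral_abs_bound)
  also have "\<dots> \<le> B"
    using f_bound by (intro Q.integral_le_const Q.integrable_const_bound[of _ B]) auto
  finally show ?thesis .
qed

lemma centered_bound: "\<bar>f x - cond_mean s\<bar> \<le> 2 * B"
  using f_bound[of x] cond_mean_bound[of s] by linarith

lemma cond_mean_meas [measurable]: "cond_mean \<in> borel_measurable borel"
proof -
  have "(\<lambda>s. (\<integral>x. f x * indicator {x. s < norm x} x \<partial>distr M borel X) /
      of_real (measure (distr M borel X) {x\<in>space (distr M borel X). s < norm x})) \<in> borel_measurable borel"
    by (rule measurable_cond_expectation) (auto intro: prob_space_distr)
  then show ?thesis by (subst (asm) integral_cond_above_distr) (auto simp: cond_mean_def[abs_def])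
qed

lemma cond_var_meas [measurable]: "cond_var \<in> borel_measurable borel"
proof -
  have "(\<lambda>s. (\<integral>x. (f x - cond_mean s)\<^sup>2 * indicator {x. s < norm x} x \<partial>distr M borel X) /
      of_real (measure (distr M borel X) {x\<in>space (distr M borel X). s < norm x})) \<in> borel_measurable borel"
    by (rule measurable_cond_expectation) (auto intro: prob_space_distr)
  then show ?thesis by (subst (asm) integral_cond_above_distr) (auto simp: cond_var_def[abs_def])
qed

lemma cond_var_range: "0 \<le> cond_var s" "cond_var s \<le> 4 * B\<^sup>2"
proof -
  interpret Q: prob_space "cond_above M X s" by (rule prob_space_cond_above)
  show "0 \<le> cond_var s" unfolding cond_var_def by (rule integral_nonneg_AE) simp
  have b: "(f (X w) - cond_mean s)\<^sup>2 \<le> 4 * B\<^sup>2" for w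
    using power_mono[OF centered_bound[of "X w" s], of 2] by (simp add: power_mult_distrib)
  then show "cond_var s \<le> 4 * B\<^sup>2"
    unfolding cond_var_def by (intro Q.integral_le_const Q.integrable_const_bound[of _ "4 * B\<^sup>2"]) auto
qed

definition cond_char :: "real \<Rightarrow> real \<Rightarrow> complex" where
  "cond_char a s = (\<integral>w. iexp (a * (f (X w) - cond_mean s)) \<partial>cond_above M X s)"

lemma cond_char_le_1: "norm (cond_char a s) \<le> 1"
proof -
  interpret Q: prob_space "cond_above M X s" by (rule prob_space_cond_above)
  have "norm (cond_char a s) \<le> (\<integral>w. norm (iexp (a * (f (X w) - cond_mean s))) \<partial>cond_above M X s)"
    unfolding cond_char_def by (rule integral_norm_bound)
  then show ?thesis by (simp add: Q.prob_space)
qed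

text \<open>Two errors add up: the Taylor remainder of the characteristic function, with
  \<open>(2 * B) ^ 3\<close> bounding the cubed centered variable, and the passage from 1 - v to
  exp(-v), with v at most \<open>2 * B\<^sup>2 * a\<^sup>2\<close>.\<close>

lemma cond_char_approx:
  "norm (cond_char a s - exp (- (a\<^sup>2 * cond_var s / 2))) \<le> 8 * B ^ 3 * \<bar>a\<bar> ^ 3 + 4 * B ^ 4 * a ^ 4"
proof -
  interpret Q: prob_space "cond_above M X s" by (rule prob_space_cond_above)
  let ?Y = "\<lambda>w. f (X w) - cond_mean s"
  have int: "integrable (cond_above M X s) (\<lambda>w. f (X w))" "integrable (cond_above M X s) ?Y"
    "integrable (cond_above M X s) (\<lambda>w. (?Y w)\<^sup>2)"
  proof -
    show "integrable (cond_above M X s) (\<lambda>w. f (X w))"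
      by (rule Q.integrable_const_bound[of _ B]) (use f_bound in auto)
    then show "integrable (cond_above M X s) ?Y" by simp
    show "integrable (cond_above M X s) (\<lambda>w. (?Y w)\<^sup>2)"
      by (rule Q.integrable_const_bound[of _ "4 * B\<^sup>2"])
        (use power_mono[OF centered_bound, of _ s 2] in auto)
  qed
  have mean0: "Q.expectation ?Y = 0" using int(1) by (simp add: cond_mean_def Q.prob_space)
  have char: "char (distr (cond_above M X s) borel ?Y) a = cond_char a s"
    unfolding char_def cond_char_def by (subst integral_distr) auto
  have "norm (char (distr (cond_above M X s) borel ?Y) a - (1 - a\<^sup>2 * cond_var s / 2)) \<le>
      (a\<^sup>2 / 6) * Q.expectation (\<lambda>w. min (6 * (?Y w)\<^sup>2) (\<bar>a\<bar> * \<bar>?Y w\<bar> ^ 3))"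
  proof (rule Q.char_approx3')
    show "Q.variance ?Y = cond_var s" unfolding mean0 by (simp add: cond_var_def)
  qed (use int mean0 in auto)
  also have "\<dots> \<le> (a\<^sup>2 / 6) * (\<bar>a\<bar> * (2 * B) ^ 3)"
  proof (intro mult_left_mono Q.integral_le_const)
    have "min (6 * (?Y w)\<^sup>2) (\<bar>a\<bar> * \<bar>?Y w\<bar> ^ 3) \<le> \<bar>a\<bar> * (2 * B) ^ 3" for w
      using power_mono[OF centered_bound[of "X w" s], of 3] by (intro min.coboundedI2 mult_left_mono) auto
    then show "AE w in cond_above M X s. min (6 * (?Y w)\<^sup>2) (\<bar>a\<bar> * \<bar>?Y w\<bar> ^ 3) \<le> \<bar>a\<bar> * (2 * B) ^ 3" by simp
    show "integrable (cond_above M X s) (\<lambda>w. min (6 * (?Y w)\<^sup>2) (\<bar>a\<bar> * \<bar>?Y w\<bar> ^ 3))"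
    proof (rule Bochner_Integration.integrable_bound)
      show "integrable (cond_above M X s) (\<lambda>w. 6 * (?Y w)\<^sup>2)" using int(3) by simp
    qed auto
  qed simp
  also have "\<dots> \<le> 8 * B ^ 3 * \<bar>a\<bar> ^ 3"
  proof -
    have "(a\<^sup>2 / 6) * (\<bar>a\<bar> * (2 * B) ^ 3) = 8 / 6 * B ^ 3 * \<bar>a\<bar> ^ 3"
      by (simp add: power2_eq_square power3_eq_cube algebra_simps abs_mult_self_eq flip: power2_abs[of a])
    also have "\<dots> \<le> 8 * B ^ 3 * \<bar>a\<bar> ^ 3" using B_nonneg by (intro mult_right_mono) auto
    finally show ?thesis .
  qed
  finally have 1: "norm (cond_char a s - complex_of_real (1 - a\<^sup>2 * cond_var s / 2)) \<le> 8 * B ^ 3 * \<bar>a\<bar> ^ 3"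
    unfolding char by simp
  let ?v = "a\<^sup>2 * cond_var s / 2"
  have v: "0 \<le> ?v" "?v \<le> 2 * B\<^sup>2 * a\<^sup>2"
    using cond_var_range[of s] mult_left_mono[of "cond_var s" "4 * B\<^sup>2" "a\<^sup>2"] by (simp_all add: mult_ac)
  have "norm (complex_of_real (1 - ?v) - complex_of_real (exp (- ?v))) = \<bar>(1 - ?v) - exp (- ?v)\<bar>"
    by (metis norm_of_real of_real_diff)
  also have "\<dots> \<le> ?v\<^sup>2" by (rule exp_minus_approx[OF v(1)])
  also have "\<dots> \<le> (2 * B\<^sup>2 * a\<^sup>2)\<^sup>2" by (rule power_mono[OF v(2,1)])
  also have "\<dots> = 4 * B ^ 4 * a ^ 4" by (simp add: power_mult_distrib flip: power_mult)
  finally have 2: "norm (complex_of_real (1 - ?v) - complex_of_real (exp (- ?v))) \<le> 4 * B ^ 4 * a ^ 4" .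
  show ?thesis using norm_triangle_mono[OF 1 2] by simp
qed

lemma exceedance_sum_char:
  assumes lim: "(cond_var \<longlongrightarrow> \<sigma>2) at_top"
  shows "(\<lambda>n. \<integral>w. iexp ((\<Sum>i\<in>E n w. f (Xs i w) - cond_mean (T n w)) / sqrt (real (k n))) \<partial>M)
    \<longlonglongrightarrow> complex_of_real (exp (- \<sigma>2 / 2))"
proof -
  define a where "a n = 1 / sqrt (real (k n))" for n
  have kr: "filterlim (\<lambda>n. real (k n)) at_top sequentially"
    by (rule filterlim_compose[OF filterlim_real_sequentially k(1)])
  \<comment> \<open>Gaussian substitute for the power of the conditional characteristic function. It
    is still random through the threshold and the number of exceedances, which both settle down in
    probability.\<close>
  define r where "r n w = exp (- (real (card (E n w)) / real (k n) * cond_var (T n w) / 2))" for n w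
  have \<sigma>2: "0 \<le> \<sigma>2"
    using cond_var_range by (intro tendsto_lowerbound[OF lim]) auto
  have r01: "0 \<le> r n w" "r n w \<le> 1" for n w
    using cond_var_range[of "T n w"] by (auto simp: r_def)
  have r_meas: "r n \<in> borel_measurable M" if "k n < n" for n
    unfolding r_def[abs_def] using T_meas[OF that] card_E_meas[OF that] by measurable
  have main: "(\<integral>w. iexp ((\<Sum>i\<in>E n w. f (Xs i w) - cond_mean (T n w)) / sqrt (real (k n))) \<partial>M)
     = (\<integral>w. cond_char (a n) (T n w) ^ card (E n w) \<partial>M)" if kn: "k n < n" for n
  proof -
    let ?\<phi> = "\<lambda>x s. iexp (a n * (f x - cond_mean s))"
    have H: "measure (distr M borel X) {x\<in>space (distr M borel X). s < norm x} = H s" for s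
    proof -
      have "{x::'b. s < norm x} \<in> sets borel" by measurable
      then show ?thesis by (simp add: measure_distr H_eq vimage_def Int_def conj_commute)
    qed
    have "iexp ((\<Sum>i\<in>E n w. f (Xs i w) - cond_mean (T n w)) / sqrt (real (k n))) = (\<Prod>i\<in>E n w. ?\<phi> (Xs i w) (T n w))" for w
      unfolding a_def by (subst exp_sum[symmetric]) (auto simp: E_def sum_divide_distrib sum_distrib_left)
    then have "(\<integral>w. iexp ((\<Sum>i\<in>E n w. f (Xs i w) - cond_mean (T n w)) / sqrt (real (k n))) \<partial>M)
      = (\<integral>w. (\<Prod>i\<in>E n w. ?\<phi> (Xs i w) (T n w)) \<partial>M)" by simp
    also have "\<dots> = (\<integral>w. ((\<integral>x. ?\<phi> x (T n w) * indicator {x. T n w < norm x} x \<partial>distr M borel X) /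
        measure (distr M borel X) {x\<in>space (distr M borel X). T n w < norm x}) ^ card (E n w) \<partial>M)"
      unfolding E_def T_def
    proof (rule exceed_product_identity[OF indep law kn])
      show "(\<lambda>(x, s). ?\<phi> x s) \<in> borel_measurable (borel \<Otimes>\<^sub>M borel)" by measurable
      show "norm (?\<phi> x s) \<le> 1" for x s by simp
      show "0 < measure (distr M borel X) {x\<in>space (distr M borel X). s < norm x}" for s
        unfolding H by (rule pos)
    qed
    also have "\<dots> = (\<integral>w. cond_char (a n) (T n w) ^ card (E n w) \<partial>M)"
      unfolding cond_char_def by (subst integral_cond_above_distr) simp_all
    finally show ?thesis .
  qed
  \<comment> \<open>At most \<open>k n\<close> factors each contribute the error of
    \<open>cond_char_approx\<close> at \<open>a n\<close>; the square \<open>(a n)\<^sup>2\<close>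
    taken out of that error cancels \<open>k n\<close>.\<close>
  define b where "b n = 8 * B ^ 3 * a n + 4 * B ^ 4 * (a n)\<^sup>2" for n
  have a0: "a \<longlonglongrightarrow> 0"
  proof -
    have "filterlim (\<lambda>n. sqrt (real (k n))) at_top sequentially"
      by (rule filterlim_compose[OF sqrt_at_top kr])
    from tendsto_inverse_0_at_top[OF this] show ?thesis by (simp add: a_def[abs_def] inverse_eq_divide)
  qed
  have b0: "b \<longlonglongrightarrow> 0"
    unfolding b_def[abs_def] using a0 by (auto intro!: tendsto_eq_intros)
  have approx: "norm (cond_char (a n) (T n w) ^ card (E n w) - complex_of_real (r n w)) \<le> b n"
    if kn: "0 < k n" "k n < n" for n w
  proof -
    let ?e = "exp (- ((a n)\<^sup>2 * cond_var (T n w) / 2))"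
    have an: "0 < a n" "(a n)\<^sup>2 = 1 / real (k n)" using kn by (auto simp: a_def real_sqrt_pow2 power_divide)
    have "r n w = ?e ^ card (E n w)"
      unfolding r_def an by (simp flip: exp_of_nat_mult)
    then have "norm (cond_char (a n) (T n w) ^ card (E n w) - complex_of_real (r n w))
      = norm (cond_char (a n) (T n w) ^ card (E n w) - complex_of_real ?e ^ card (E n w))" by simp
    also have "\<dots> \<le> card (E n w) * norm (cond_char (a n) (T n w) - complex_of_real ?e)"
    proof (rule norm_power_diff[OF cond_char_le_1])
      show "norm (complex_of_real ?e) \<le> 1" using cond_var_range(1)[of "T n w"] by simp
    qed
    also have "\<dots> \<le> real (k n) * (8 * B ^ 3 * \<bar>a n\<bar> ^ 3 + 4 * B ^ 4 * (a n) ^ 4)"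
      using card_E_le[OF kn(2), of w] cond_char_approx[of "a n" "T n w"] by (intro mult_mono) auto
    also have "\<dots> = real (k n) * (a n)\<^sup>2 * b n"
      using an(1) unfolding b_def by (simp add: algebra_simps power2_eq_square power3_eq_cube power4_eq_xxxx)
    also have "\<dots> = b n" using kn an by simp
    finally show ?thesis .
  qed
  have cmeas: "(\<lambda>w. cond_char (a n) (T n w) ^ card (E n w)) \<in> borel_measurable M" if kn: "k n < n" for n
  proof -
    have [measurable]: "cond_char (a n) \<in> borel_measurable borel"
    proof -
      have "(\<lambda>s. (\<integral>x. iexp (a n * (f x - cond_mean s)) * indicator {x. s < norm x} x \<partial>distr M borel X) /
          of_real (measure (distr M borel X) {x\<in>space (distr M borel X). s < norm x})) \<in> borel_measurable borel"
        by (rule measurable_cond_expectation) (auto intro: prob_space_distr)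
      then show ?thesis by (subst (asm) integral_cond_above_distr) (auto simp: cond_char_def[abs_def])
    qed
    have "card (E n w) = (\<Sum>i<n. of_bool (T n w < norm (Xs i w)))" for w
      by (simp add: E_def exceed_def T_def of_bool_def sum.If_cases Int_def)
    then have [measurable]: "(\<lambda>w. card (E n w)) \<in> measurable M (count_space UNIV)"
      using T_meas[OF kn] by simp
    show ?thesis using T_meas[OF kn] by measurable
  qed
  have d1: "(\<lambda>n. (\<integral>w. cond_char (a n) (T n w) ^ card (E n w) \<partial>M) - (\<integral>w. complex_of_real (r n w) \<partial>M)) \<longlonglongrightarrow> 0"
  proof (rule Lim_null_comparison[OF _ b0])
    show "\<forall>\<^sub>F n in sequentially. norm ((\<integral>w. cond_char (a n) (T n w) ^ card (E n w) \<partial>M) - (\<integral>w. complex_of_real (r n w) \<partial>M)) \<le> b n"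
      using k_range
    proof eventually_elim
      case (elim n)
      note [measurable] = cmeas[of n] r_meas[of n]
      have i: "integrable M (\<lambda>w. cond_char (a n) (T n w) ^ card (E n w))" "integrable M (\<lambda>w. complex_of_real (r n w))"
        using elim r01 cond_char_le_1 by (auto intro!: integrable_const_bound[of _ 1] simp: norm_power power_le_one)
      have "norm ((\<integral>w. cond_char (a n) (T n w) ^ card (E n w) \<partial>M) - (\<integral>w. complex_of_real (r n w) \<partial>M))
        = norm (\<integral>w. cond_char (a n) (T n w) ^ card (E n w) - complex_of_real (r n w) \<partial>M)" using i by simp
      also have "\<dots> \<le> (\<integral>w. norm (cond_char (a n) (T n w) ^ card (E n w) - complex_of_real (r n w)) \<partial>M)"
        by (rule integral_norm_bound)
      also have "\<dots> \<le> b n"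
        using i approx[of n] elim by (intro integral_le_const integrable_norm Bochner_Integration.integrable_diff) auto
      finally show ?case .
    qed
  qed
  have d2: "(\<lambda>n. \<integral>w. r n w - exp (- \<sigma>2 / 2) \<partial>M) \<longlonglongrightarrow> 0"
  proof (rule expectation_tendsto_0[where B = 1])
    show "\<forall>\<^sub>F n in sequentially. (\<lambda>w. r n w - exp (- \<sigma>2 / 2)) \<in> borel_measurable M"
      using k_range by eventually_elim (use r_meas in measurable)
    have "0 \<le> exp (- \<sigma>2 / 2)" "exp (- \<sigma>2 / 2) \<le> 1" using \<sigma>2 by auto
    then show "\<bar>r n w - exp (- \<sigma>2 / 2)\<bar> \<le> 1" for n w using r01[of n w] by linarith
    fix e :: real assume e: "e > 0"
    \<comment> \<open>Chosen so that a shortfall of at most \<open>d\<close> in the fraction of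
      exceedances costs at most \<open>e\<close> when the variance is bounded by
      \<open>4 * B\<^sup>2\<close>.\<close>
    define d where "d = e / (4 * B\<^sup>2 + 1)"
    have d: "d > 0" using e by (auto simp: d_def intro!: divide_pos_pos add_nonneg_pos)
    have de: "d * (4 * B\<^sup>2 + 1) = e" by (simp add: d_def add_nonneg_eq_0_iff)
    obtain Z where Z: "\<And>s. s \<ge> Z \<Longrightarrow> \<bar>cond_var s - \<sigma>2\<bar> < e"
      using tendstoD[OF lim e] by (auto simp: eventually_at_top_linorder dist_real_def)
    have "whp (\<lambda>n w. \<bar>r n w - exp (- \<sigma>2 / 2)\<bar> \<le> e)"
    proof (rule whp_mono[OF whp_conj[OF whp_card_E[OF d] whp_T_large[of Z]]])
      show "\<forall>\<^sub>F n in sequentially. \<forall>w\<in>space M. 1 - d \<le> real (card (E n w)) / real (k n) \<and> Z \<le> T n w \<longrightarrow>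
          \<bar>r n w - exp (- \<sigma>2 / 2)\<bar> \<le> e"
        using k_range
      proof eventually_elim
        case (elim n)
        show ?case
        proof (intro ballI impI)
          fix w assume *: "1 - d \<le> real (card (E n w)) / real (k n) \<and> Z \<le> T n w"
          let ?q = "real (card (E n w)) / real (k n)" and ?v = "cond_var (T n w)"
          have q: "0 \<le> ?q" "?q \<le> 1" using card_E_le[of n w] elim by auto
          have "\<bar>r n w - exp (- \<sigma>2 / 2)\<bar> \<le> \<bar>?q * ?v / 2 - \<sigma>2 / 2\<bar>"
            unfolding r_def minus_divide_left[symmetric]
            using q \<sigma>2 cond_var_range(1)[of "T n w"] by (intro exp_minus_lipschitz) auto
          also have "\<dots> = \<bar>(?v - \<sigma>2) - (1 - ?q) * ?v\<bar> / 2"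
          proof -
            have "q * v / 2 - \<sigma>2 / 2 = ((v - \<sigma>2) - (1 - q) * v) / 2" for q v
              by (simp add: algebra_simps diff_divide_distrib)
            then show ?thesis by (simp only: abs_divide abs_numeral)
          qed
          also have "\<dots> \<le> (\<bar>?v - \<sigma>2\<bar> + (1 - ?q) * ?v) / 2"
            using q cond_var_range(1)[of "T n w"] abs_triangle_ineq4[of "?v - \<sigma>2" "(1 - ?q) * ?v"]
            by (simp add: abs_mult)
          also have "(1 - ?q) * ?v \<le> d * (4 * B\<^sup>2)"
            using * q d cond_var_range[of "T n w"] by (intro mult_mono) auto
          also have "\<dots> \<le> e" using de d by (simp add: algebra_simps)
          also have "\<bar>?v - \<sigma>2\<bar> \<le> e" using Z[of "T n w"] * by auto
          finally show "\<bar>r n w - exp (- \<sigma>2 / 2)\<bar> \<le> e" by simp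
        qed
      qed
    qed
    then show "holds_up_to e (\<lambda>n w. \<bar>r n w - exp (- \<sigma>2 / 2)\<bar> \<le> e)" using e by (simp add: whp_def)
  qed
  have "(\<lambda>n. \<integral>w. r n w \<partial>M) \<longlonglongrightarrow> exp (- \<sigma>2 / 2)"
  proof (rule LIM_zero_cancel, rule Lim_transform_eventually[OF d2])
    show "\<forall>\<^sub>F n in sequentially. (\<integral>w. r n w - exp (- \<sigma>2 / 2) \<partial>M) = (\<integral>w. r n w \<partial>M) - exp (- \<sigma>2 / 2)"
      using k_range
    proof eventually_elim
      case (elim n)
      then have "integrable M (r n)"
        using r01 r_meas[of n] by (intro integrable_const_bound[of _ 1]) auto
      then show ?case by (simp add: prob_space)
    qed
  qed
  then have "(\<lambda>n. \<integral>w. complex_of_real (r n w) \<partial>M) \<longlonglongrightarrow> complex_of_real (exp (- \<sigma>2 / 2))"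
    by (simp add: tendsto_of_real_iff)
  from tendsto_add[OF d1 this]
  have "(\<lambda>n. \<integral>w. cond_char (a n) (T n w) ^ card (E n w) \<partial>M) \<longlonglongrightarrow> complex_of_real (exp (- \<sigma>2 / 2))" by simp
  moreover have "\<forall>\<^sub>F n in sequentially. (\<integral>w. cond_char (a n) (T n w) ^ card (E n w) \<partial>M) =
      (\<integral>w. iexp ((\<Sum>i\<in>E n w. f (Xs i w) - cond_mean (T n w)) / sqrt (real (k n))) \<partial>M)"
    using k_range by eventually_elim (use main in simp)
  ultimately show ?thesis by (rule Lim_transform_eventually)
qed

end

end

section \<open>The excess risk\<close>

text \<open>The scaled vector is bounded only almost surely, whereas the central limit theorem above
  and the test functions of \<open>theta_limit\<close> require a bound everywhere. Clipping supplies
  it and preserves continuity.\<close>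

definition clip :: "real \<Rightarrow> real \<Rightarrow> real" where "clip B y = max (- B) (min B y)"

lemma clip_bound: "0 \<le> B \<Longrightarrow> \<bar>clip B y\<bar> \<le> B"
  by (auto simp: clip_def)

lemma clip_id: "\<bar>y\<bar> \<le> B \<Longrightarrow> clip B y = y"
  by (auto simp: clip_def)

lemma continuous_clip [continuous_intros]: "continuous_on S f \<Longrightarrow> continuous_on S (\<lambda>x. clip B (f x))"
  unfolding clip_def by (intro continuous_intros)

lemma measurable_clip [measurable]:
  assumes [measurable]: "f \<in> borel_measurable M"
  shows "(\<lambda>x. clip B (f x)) \<in> borel_measurable M"
  unfolding clip_def by measurable

lemma norm_outer: "norm (outer v) = (norm v)\<^sup>2"
proof -
  have "outer v \<bullet> outer v = (v \<bullet> v)\<^sup>2"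
    by (simp add: inner_outer outer_mult power2_eq_square)
  then show ?thesis by (simp add: norm_eq_sqrt_inner)
qed

lemma continuous_outer [continuous_intros]: "continuous_on S f \<Longrightarrow> continuous_on S (\<lambda>x. outer (f x))"
  unfolding outer_def by (intro continuous_intros)

lemma measurable_outer [measurable]: "f \<in> borel_measurable M \<Longrightarrow> (\<lambda>x. outer (f x)) \<in> borel_measurable M"
  by (rule borel_measurable_continuous_on[OF continuous_outer[OF continuous_on_id]])

lemma (in prob_space) cov_quadratic:
  assumes I: "finite I" and Y: "\<And>a. a \<in> I \<Longrightarrow> integrable M (Y a)"
    "\<And>a b. a \<in> I \<Longrightarrow> b \<in> I \<Longrightarrow> integrable M (\<lambda>w. Y a w * Y b w)"
  shows "expectation (\<lambda>w. ((\<Sum>a\<in>I. c a * Y a w) - expectation (\<lambda>w. \<Sum>a\<in>I. c a * Y a w))\<^sup>2)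
    = (\<Sum>a\<in>I. \<Sum>b\<in>I. c a * c b * cov M (Y a) (Y b))"
proof -
  define D where "D a w = Y a w - expectation (Y a)" for a w
  have D: "integrable M (\<lambda>w. D a w * D b w)" if "a \<in> I" "b \<in> I" for a b
    using Y that by (simp add: D_def algebra_simps)
  have "expectation (\<lambda>w. \<Sum>a\<in>I. c a * Y a w) = (\<Sum>a\<in>I. c a * expectation (Y a))"
    using Y(1) by (subst Bochner_Integration.integral_sum) auto
  then have "((\<Sum>a\<in>I. c a * Y a w) - expectation (\<lambda>w. \<Sum>a\<in>I. c a * Y a w))\<^sup>2
      = (\<Sum>a\<in>I. \<Sum>b\<in>I. c a * c b * (D a w * D b w))" for w
    by (simp add: D_def sum_subtractf[symmetric] right_diff_distrib[symmetric] power2_eq_square sum_product mult_ac)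
  then show ?thesis
    using D by (simp add: Bochner_Integration.integral_sum cov_def flip: D_def)
qed

lemma inner_matrix_sum: "(A::real^'n^'m) \<bullet> B = (\<Sum>(i, j)\<in>UNIV. B $ i $ j * A $ i $ j)"
  by (simp add: inner_vec_def mult.commute flip: sum.cartesian_product UNIV_Times_UNIV)

lemma centered_normal_moments:
  assumes M: "prob_space M" and Z: "centered_normal M Z"
  shows "integrable M Z" "(\<integral>w. Z w \<partial>M) = 0" "integrable M (\<lambda>w. (Z w)\<^sup>2)"
    "(\<integral>w. iexp (Z w) \<partial>M) = exp (- (\<integral>w. (Z w)\<^sup>2 \<partial>M) / 2)"
proof -
  interpret prob_space M by fact
  have [measurable]: "Z \<in> borel_measurable M" using Z by (simp add: centered_normal_def)
  have "integrable M Z \<and> (\<integral>w. Z w \<partial>M) = 0 \<and> integrable M (\<lambda>w. (Z w)\<^sup>2) \<and>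
    (\<integral>w. iexp (Z w) \<partial>M) = exp (- (\<integral>w. (Z w)\<^sup>2 \<partial>M) / 2)"
  proof (cases "AE w in M. Z w = 0")
    case True
    have "integrable M Z \<longleftrightarrow> integrable M (\<lambda>_. 0::real)" by (rule integrable_cong_AE) (use True in auto)
    moreover have "integrable M (\<lambda>w. (Z w)\<^sup>2) \<longleftrightarrow> integrable M (\<lambda>_. 0::real)"
      by (rule integrable_cong_AE) (use True in auto)
    moreover have "(\<integral>w. Z w \<partial>M) = (\<integral>w. 0 \<partial>M)" by (rule integral_cong_AE) (use True in auto)
    moreover have "(\<integral>w. (Z w)\<^sup>2 \<partial>M) = (\<integral>w. 0 \<partial>M)" by (rule integral_cong_AE) (use True in auto)
    moreover have "(\<integral>w. iexp (Z w) \<partial>M) = (\<integral>w. 1 \<partial>M)" by (rule integral_cong_AE) (use True in auto)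
    ultimately show ?thesis by (simp add: prob_space)
  next
    case False
    then obtain \<sigma> where \<sigma>: "\<sigma> > 0" and d: "distributed M lborel Z (normal_density 0 \<sigma>)"
      using Z by (auto simp: centered_normal_def)
    have i2: "integrable M (\<lambda>w. (Z w - 0) ^ 2)"
      using distributed_integrable[OF d, of "\<lambda>x. (x - 0) ^ 2"] integrable_normal_moment[OF \<sigma>, of 0 2] by simp
    have mean: "expectation Z = 0" by (rule normal_distributed_expectation[OF \<sigma> d])
    have var: "expectation (\<lambda>w. (Z w)\<^sup>2) = \<sigma>\<^sup>2"
      using normal_distributed_variance[OF \<sigma> d] mean by simp
    have i1: "integrable M Z" by (rule square_integrable_imp_integrable) (use i2 in auto)
    have "distributed M lborel (\<lambda>w. (Z w - 0) / \<sigma>) std_normal_density"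
      using d \<sigma> by (subst (asm) normal_standard_normal_convert) auto
    then have dd: "distr M lborel (\<lambda>w. Z w / \<sigma>) = std_normal_distribution"
      by (simp add: distributed_def)
    have "(\<integral>w. iexp (Z w) \<partial>M) = (\<integral>w. iexp (\<sigma> * (Z w / \<sigma>)) \<partial>M)" using \<sigma> by simp
    also have "\<dots> = char (distr M lborel (\<lambda>w. Z w / \<sigma>)) \<sigma>"
      unfolding char_def by (subst integral_distr) auto
    also have "\<dots> = exp (- (\<sigma>\<^sup>2) / 2)" unfolding dd char_std_normal_distribution by simp
    finally show ?thesis using i1 i2 mean var by simp
  qed
  then show "integrable M Z" "(\<integral>w. Z w \<partial>M) = 0" "integrable M (\<lambda>w. (Z w)\<^sup>2)"
    "(\<integral>w. iexp (Z w) \<partial>M) = exp (- (\<integral>w. (Z w)\<^sup>2 \<partial>M) / 2)" by auto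
qed

text \<open>Entries are themselves linear functionals, hence square integrable, so the variance of
  \<open>U u \<bullet> A\<close> expands into the covariances of the entries.\<close>

lemma centered_gaussian_char:
  fixes U :: "'u \<Rightarrow> real^'d^'d"
  assumes M: "prob_space M" and U: "centered_gaussian M U"
  shows "(\<integral>u. iexp (U u \<bullet> A) \<partial>M) = exp (- (\<Sum>(i, j)\<in>UNIV. \<Sum>(i', j')\<in>UNIV. A $ i $ j * A $ i' $ j' *
      cov M (\<lambda>u. U u $ i $ j) (\<lambda>u. U u $ i' $ j')) / 2)"
proof -
  interpret prob_space M by fact
  have n: "centered_normal M (\<lambda>u. U u \<bullet> A)" for A using U by (simp add: centered_gaussian_def)
  have entry: "U u $ i $ j = U u \<bullet> axis i (axis j 1)" for u i j
    by (simp add: inner_axis)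
  have i1: "integrable M (\<lambda>u. U u $ i $ j)" and s: "integrable M (\<lambda>u. (U u $ i $ j)\<^sup>2)" for i j
    unfolding entry using centered_normal_moments[OF M n] by auto
  have i2: "integrable M (\<lambda>u. U u $ i $ j * U u $ i' $ j')" for i j i' j'
  proof (rule Bochner_Integration.integrable_bound)
    show "integrable M (\<lambda>u. (U u $ i $ j)\<^sup>2 + (U u $ i' $ j')\<^sup>2)" using s by simp
    have "\<bar>x * y\<bar> \<le> x\<^sup>2 + y\<^sup>2" for x y :: real
    proof -
      have "2 * (\<bar>x\<bar> * \<bar>y\<bar>) \<le> x\<^sup>2 + y\<^sup>2" using sum_squares_bound[of "\<bar>x\<bar>" "\<bar>y\<bar>"] by (simp add: mult.assoc)
      moreover have "0 \<le> \<bar>x\<bar> * \<bar>y\<bar>" by simp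
      ultimately show ?thesis unfolding abs_mult by linarith
    qed
    then show "AE u in M. norm (U u $ i $ j * U u $ i' $ j') \<le> norm ((U u $ i $ j)\<^sup>2 + (U u $ i' $ j')\<^sup>2)" by simp
    show "(\<lambda>u. U u $ i $ j * U u $ i' $ j') \<in> borel_measurable M"
      using i1[THEN borel_measurable_integrable] by measurable
  qed
  define Y where "Y a u = U u $ fst a $ snd a" for a u
  have UA: "U u \<bullet> A = (\<Sum>a\<in>UNIV. A $ fst a $ snd a * Y a u)" for u
    unfolding inner_matrix_sum by (simp add: Y_def split_beta')
  have "expectation (\<lambda>u. (U u \<bullet> A)\<^sup>2) = expectation (\<lambda>u. (U u \<bullet> A - expectation (\<lambda>u. U u \<bullet> A))\<^sup>2)"
    using centered_normal_moments(2)[OF M n, of A] by simp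
  also have "\<dots> = (\<Sum>a\<in>UNIV. \<Sum>b\<in>UNIV. A $ fst a $ snd a * A $ fst b $ snd b * cov M (Y a) (Y b))"
    unfolding UA by (rule cov_quadratic) (auto simp: Y_def i1 i2)
  finally show ?thesis
    using centered_normal_moments(4)[OF M n, of A] by (simp add: Y_def[abs_def] split_beta')
qed

section \<open>Moments of the exceedance matrices and their limits\<close>

locale exceedance_matrices = top_order_statistics M H G C X Xs k t
  for M :: "'a measure" and H G C and X :: "'a \<Rightarrow> real^'d" and Xs k t +
  fixes \<nu> :: "(real^'d) measure" and \<omega> :: "real^'d \<Rightarrow> real" and c0 :: real
  assumes \<omega>_meas [measurable]: "\<omega> \<in> borel_measurable borel"
    and theta_bound: "AE w in M. norm (theta \<omega> (X w)) \<le> c0"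
    and theta_lim: "theta_limit M X \<nu> \<omega>"
    and sets_\<nu>: "sets \<nu> = sets (restrict_space borel (- {0}))"
begin

lemma theta_meas [measurable]: "theta \<omega> \<in> borel_measurable borel"
  unfolding theta_def[abs_def] by measurable

abbreviation L :: "(real^'d) measure" where "L \<equiv> limit_model \<nu>"

lemma theta_meas_L [measurable]: "theta \<omega> \<in> borel_measurable L"
proof -
  have "theta \<omega> \<in> borel_measurable (restrict_space borel (- {0}))"
    by (rule measurable_restrict_space1) simp
  then have "theta \<omega> \<in> borel_measurable \<nu>" using measurable_cong_sets[OF sets_\<nu> refl] by blast
  then show ?thesis unfolding limit_model_def by (rule measurable_restrict_space1)
qed

lemma theta_limD:
  assumes "continuous_on UNIV f" "\<And>v. \<bar>f v\<bar> \<le> (b::real)"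
  shows "((\<lambda>s. \<integral>w. f (theta \<omega> (X w)) \<partial>cond_above M X s) \<longlongrightarrow> (\<integral>x. f (theta \<omega> x) \<partial>L)) at_top"
  using theta_lim assms unfolding theta_limit_def bounded_iff by auto

lemma c0_nonneg: "0 \<le> c0"
proof -
  have "AE w in M. 0 \<le> c0" using theta_bound by eventually_elim (meson norm_ge_zero order_trans)
  then show ?thesis by (simp add: AE_const)
qed

text \<open>The constant test function in \<open>theta_limit\<close> shows that the limit model has
  total mass 1.\<close>

lemma prob_space_L: "prob_space L"
proof -
  have "((\<lambda>s. \<integral>w. 1 \<partial>cond_above M X s) \<longlongrightarrow> (\<integral>x. (1::real) \<partial>L)) at_top"
    by (rule theta_limD[of "\<lambda>_. 1" 1]) auto
  moreover have "(\<integral>w. 1 \<partial>cond_above M X s) = (1::real)" for s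
    using prob_space.prob_space[OF prob_space_cond_above[of s]] by simp
  ultimately have "((\<lambda>s. 1) \<longlongrightarrow> (\<integral>x. (1::real) \<partial>L)) (at_top :: real filter)" by simp
  then have "(\<integral>x. 1 \<partial>L) = (1::real)" by (intro tendsto_unique[OF _ _ tendsto_const]) auto
  then have "measure L (space L) = 1" by simp
  \<comment> \<open>An infinite total mass would make \<open>measure\<close> equal to 0.\<close>
  moreover from this have "emeasure L (space L) \<noteq> \<top>" by (auto simp: measure_def)
  ultimately show ?thesis by (intro prob_spaceI) (simp add: emeasure_eq_ennreal_measure)
qed

lemma AE_cond_above:
  assumes "AE w in M. P w"
  shows "AE w in cond_above M X s. P w"
  unfolding cond_above_def by (rule AE_uniform_measureI) (use assms in auto)

text \<open>The test function \<open>f\<close> is continuous and bounded and vanishes exactly on the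
  ball of radius \<open>c0\<close>, so the almost sure bound passes to the limit.\<close>

lemma theta_bound_L: "AE x in L. norm (theta \<omega> x) \<le> c0"
proof -
  interpret L: prob_space L by (rule prob_space_L)
  define f where "f v = min 1 (max 0 (norm v - c0))" for v :: "real^'d"
  have fc: "continuous_on UNIV f" unfolding f_def by (intro continuous_intros)
  then have [measurable]: "f \<in> borel_measurable borel" by (rule borel_measurable_continuous_onI)
  have f01: "0 \<le> f v" "f v \<le> 1" for v by (auto simp: f_def)
  have "(\<integral>w. f (theta \<omega> (X w)) \<partial>cond_above M X s) = 0" for s
    by (rule integral_eq_zero_AE, rule AE_cond_above) (use theta_bound in \<open>auto simp: f_def\<close>)
  then have "((\<lambda>s. 0) \<longlongrightarrow> (\<integral>x. f (theta \<omega> x) \<partial>L)) (at_top :: real filter)"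
    using theta_limD[OF fc, of 1] f01 by (simp add: abs_le_iff order.trans[of _ 0])
  then have "(\<integral>x. f (theta \<omega> x) \<partial>L) = 0" by (intro tendsto_unique[OF _ _ tendsto_const]) auto
  then have "AE x in L. f (theta \<omega> x) = 0"
    using f01 by (subst (asm) integral_nonneg_eq_0_iff_AE) (auto intro!: L.integrable_const_bound[of _ 1])
  then show ?thesis by eventually_elim (auto simp: f_def min_def max_def split: if_splits)
qed

definition tensor :: "real^'d \<Rightarrow> real^'d^'d" where "tensor x = outer (theta \<omega> x)"

text \<open>The level is the Cauchy-Schwarz bound for \<open>tensor x \<bullet> A\<close>, so that
  clipping changes nothing almost surely.\<close>

definition tensor_clip :: "real^'d^'d \<Rightarrow> real^'d \<Rightarrow> real" where
  "tensor_clip A x = clip (c0\<^sup>2 * norm A) (tensor x \<bullet> A)"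

lemma tensor_meas [measurable]: "tensor \<in> borel_measurable borel" "tensor \<in> borel_measurable L"
  unfolding tensor_def[abs_def] by measurable

lemma tensor_clip_meas [measurable]: "tensor_clip A \<in> borel_measurable borel"
  unfolding tensor_clip_def[abs_def] by measurable

lemma tensor_clip_bound: "\<bar>tensor_clip A x\<bar> \<le> c0\<^sup>2 * norm A"
  unfolding tensor_clip_def by (rule clip_bound) simp

lemma norm_tensor_le: "norm (theta \<omega> x) \<le> c0 \<Longrightarrow> norm (tensor x) \<le> c0\<^sup>2"
  unfolding tensor_def norm_outer by (intro power_mono) auto

lemma tensor_clip_eq: "norm (theta \<omega> x) \<le> c0 \<Longrightarrow> tensor_clip A x = tensor x \<bullet> A"
  unfolding tensor_clip_def
  by (intro clip_id order.trans[OF Cauchy_Schwarz_ineq2] mult_right_mono norm_tensor_le) auto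

lemma theta_bound_Xs: "AE w in M. norm (theta \<omega> (Xs i w)) \<le> c0"
proof -
  have "AE x in distr M borel X. norm (theta \<omega> x) \<le> c0"
    using theta_bound by (subst AE_distr_iff) auto
  then have "AE x in distr M borel (Xs i). norm (theta \<omega> x) \<le> c0" unfolding law .
  then show ?thesis by (subst (asm) AE_distr_iff) auto
qed

lemma integrable_tensor: "integrable (cond_above M X s) (\<lambda>w. tensor (X w))"
proof -
  interpret Q: prob_space "cond_above M X s" by (rule prob_space_cond_above)
  show ?thesis
  proof (rule Q.integrable_const_bound[of _ "c0\<^sup>2"])
    show "AE w in cond_above M X s. norm (tensor (X w)) \<le> c0\<^sup>2"
      using AE_cond_above[OF theta_bound, of s] by eventually_elim (rule norm_tensor_le)
  qed measurable
qed

lemma integrable_tensor_L: "integrable L tensor"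
proof -
  interpret L: prob_space L by (rule prob_space_L)
  show ?thesis
  proof (rule L.integrable_const_bound[of _ "c0\<^sup>2"])
    show "AE x in L. norm (tensor x) \<le> c0\<^sup>2"
      using theta_bound_L by eventually_elim (rule norm_tensor_le)
  qed measurable
qed

lemma Sigma_above_eq: "Sigma_above M X \<omega> s = (\<integral>w. tensor (X w) \<partial>cond_above M X s)"
  by (simp add: Sigma_above_def tensor_def)

lemma Sigma_inf_eq: "Sigma_inf \<nu> \<omega> = (\<integral>x. tensor x \<partial>L)"
  by (simp add: Sigma_inf_def tensor_def)

lemma Sigma_sym: "transpose (Sigma_above M X \<omega> s) = Sigma_above M X \<omega> s"
  "transpose (Sigma_inf \<nu> \<omega>) = Sigma_inf \<nu> \<omega>"
  unfolding Sigma_above_eq Sigma_inf_eq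
  using integral_bounded_linear[OF bounded_linear_transpose integrable_tensor[of s]]
    integral_bounded_linear[OF bounded_linear_transpose integrable_tensor_L]
  by (simp_all add: tensor_def[abs_def])

lemma cond_mean_eq: "cond_mean (tensor_clip A) s = Sigma_above M X \<omega> s \<bullet> A"
proof -
  have "cond_mean (tensor_clip A) s = (\<integral>w. tensor (X w) \<bullet> A \<partial>cond_above M X s)"
    unfolding cond_mean_def[OF tensor_clip_meas tensor_clip_bound]
  proof (rule integral_cong_AE)
    show "AE w in cond_above M X s. tensor_clip A (X w) = tensor (X w) \<bullet> A"
      using AE_cond_above[OF theta_bound, of s] by eventually_elim (rule tensor_clip_eq)
  qed measurable
  then show ?thesis unfolding Sigma_above_eq by (simp add: integrable_tensor)
qed

lemma true_risk_eq: "true_risk M X \<omega> s P = Sigma_above M X \<omega> s \<bullet> P"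
  unfolding true_risk_def Sigma_above_eq
  by (simp add: integrable_tensor flip: integral_inner_left) (simp add: tensor_def inner_commute[of _ P] inner_outer)

lemma continuous_tensor_clip:
  "continuous_on UNIV (\<lambda>v. clip b (outer v \<bullet> A))"
  by (intro continuous_intros)

lemma Sigma_above_tendsto: "(Sigma_above M X \<omega> \<longlongrightarrow> Sigma_inf \<nu> \<omega>) at_top"
proof -
  have "((\<lambda>s. Sigma_above M X \<omega> s \<bullet> A) \<longlongrightarrow> Sigma_inf \<nu> \<omega> \<bullet> A) at_top" for A
  proof -
    let ?f = "\<lambda>v. clip (c0\<^sup>2 * norm A) (outer v \<bullet> A)"
    have "((\<lambda>s. \<integral>w. ?f (theta \<omega> (X w)) \<partial>cond_above M X s) \<longlongrightarrow> (\<integral>x. ?f (theta \<omega> x) \<partial>L)) at_top"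
      by (rule theta_limD[OF continuous_tensor_clip]) (auto intro: clip_bound)
    moreover have "(\<integral>w. ?f (theta \<omega> (X w)) \<partial>cond_above M X s) = Sigma_above M X \<omega> s \<bullet> A" for s
      using cond_mean_eq[of A s] unfolding cond_mean_def[OF tensor_clip_meas tensor_clip_bound]
      by (simp add: tensor_clip_def tensor_def)
    moreover have "(\<integral>x. ?f (theta \<omega> x) \<partial>L) = Sigma_inf \<nu> \<omega> \<bullet> A"
    proof -
      have "(\<integral>x. ?f (theta \<omega> x) \<partial>L) = (\<integral>x. tensor x \<bullet> A \<partial>L)"
      proof (rule integral_cong_AE)
        show "AE x in L. ?f (theta \<omega> x) = tensor x \<bullet> A"
          using theta_bound_L by eventually_elim (use tensor_clip_eq in \<open>simp add: tensor_clip_def tensor_def\<close>)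
      qed measurable
      then show ?thesis unfolding Sigma_inf_eq by (simp add: integrable_tensor_L)
    qed
    ultimately show ?thesis by simp
  qed
  then show ?thesis by (subst tendsto_componentwise_iff) auto
qed

definition lim_var :: "real^'d^'d \<Rightarrow> real" where
  "lim_var A = (\<Sum>(i, j)\<in>UNIV. \<Sum>(i', j')\<in>UNIV. A $ i $ j * A $ i' $ j' *
      cov L (\<lambda>x. theta \<omega> x $ i * theta \<omega> x $ j) (\<lambda>x. theta \<omega> x $ i' * theta \<omega> x $ j'))"

lemma lim_var_eq: "lim_var A = (\<integral>x. (tensor x \<bullet> A)\<^sup>2 \<partial>L) - (Sigma_inf \<nu> \<omega> \<bullet> A)\<^sup>2"
proof -
  interpret L: prob_space L by (rule prob_space_L)
  define Y where "Y a x = theta \<omega> x $ fst a * theta \<omega> x $ snd a" for a x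
  have Yt: "Y a x = tensor x \<bullet> axis (fst a) (axis (snd a) 1)" for a x
    by (simp add: Y_def tensor_def outer_def inner_axis)
  have TA: "tensor x \<bullet> A = (\<Sum>a\<in>UNIV. A $ fst a $ snd a * Y a x)" for x
    unfolding inner_matrix_sum by (simp add: Y_def tensor_def outer_def split_beta')
  have Yi: "integrable L (Y a)" for a unfolding Yt using integrable_tensor_L by simp
  have bound: "AE x in L. \<bar>(tensor x \<bullet> A) * (tensor x \<bullet> B)\<bar> \<le> (c0\<^sup>2 * norm A) * (c0\<^sup>2 * norm B)" for A B
    using theta_bound_L
  proof eventually_elim
    case (elim x)
    have "\<bar>tensor x \<bullet> A\<bar> \<le> c0\<^sup>2 * norm A" for A
      by (intro order.trans[OF Cauchy_Schwarz_ineq2] mult_right_mono norm_tensor_le elim) auto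
    then show ?case unfolding abs_mult by (intro mult_mono) auto
  qed
  have prod: "integrable L (\<lambda>x. (tensor x \<bullet> A) * (tensor x \<bullet> B))" for A B
    by (rule L.integrable_const_bound[of _ "(c0\<^sup>2 * norm A) * (c0\<^sup>2 * norm B)"]) (use bound[of A B] in auto)
  have Yii: "integrable L (\<lambda>x. Y a x * Y b x)" for a b unfolding Yt by (rule prod)
  have sq: "integrable L (\<lambda>x. (tensor x \<bullet> A)\<^sup>2)" using prod[of A A] by (simp add: power2_eq_square)
  have m: "L.expectation (\<lambda>x. tensor x \<bullet> A) = Sigma_inf \<nu> \<omega> \<bullet> A"
    unfolding Sigma_inf_eq by (simp add: integrable_tensor_L)
  have "lim_var A = (\<Sum>a\<in>UNIV. \<Sum>b\<in>UNIV. A $ fst a $ snd a * A $ fst b $ snd b * cov L (Y a) (Y b))"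
    by (simp add: lim_var_def split_beta' Y_def[abs_def])
  also have "\<dots> = L.expectation (\<lambda>x. (tensor x \<bullet> A - L.expectation (\<lambda>x. tensor x \<bullet> A))\<^sup>2)"
    unfolding TA by (rule L.cov_quadratic[symmetric]) (auto intro: Yi Yii)
  also have "\<dots> = L.expectation (\<lambda>x. (tensor x \<bullet> A)\<^sup>2) - (L.expectation (\<lambda>x. tensor x \<bullet> A))\<^sup>2"
    by (rule L.variance_eq) (use sq integrable_tensor_L in auto)
  finally show ?thesis unfolding m .
qed

text \<open>Variance as second moment minus squared mean: after clipping, the second moment is a
  bounded continuous function of the scaled vector, and the mean converges by
  \<open>Sigma_above_tendsto\<close>.\<close>

lemma cond_var_tendsto: "(cond_var (tensor_clip A) \<longlongrightarrow> lim_var A) at_top"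
proof -
  let ?f = "\<lambda>v. (clip (c0\<^sup>2 * norm A) (outer v \<bullet> A))\<^sup>2"
  let ?m = "cond_mean (tensor_clip A)"
  note b = tensor_clip_meas[of A] tensor_clip_bound[of A]
  have 1: "cond_var (tensor_clip A) s = (\<integral>w. ?f (theta \<omega> (X w)) \<partial>cond_above M X s) - (Sigma_above M X \<omega> s \<bullet> A)\<^sup>2" for s
  proof -
    interpret Q: prob_space "cond_above M X s" by (rule prob_space_cond_above)
    have "integrable (cond_above M X s) (\<lambda>w. tensor_clip A (X w))"
      by (rule Q.integrable_const_bound[of _ "c0\<^sup>2 * norm A"]) (use tensor_clip_bound in auto)
    moreover have "integrable (cond_above M X s) (\<lambda>w. (tensor_clip A (X w))\<^sup>2)"
      by (rule Q.integrable_const_bound[of _ "(c0\<^sup>2 * norm A)\<^sup>2"])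
        (use tensor_clip_bound in \<open>auto simp: abs_le_square_iff[symmetric] abs_mult c0_nonneg\<close>)
    ultimately have "Q.expectation (\<lambda>w. (tensor_clip A (X w) - Q.expectation (\<lambda>w. tensor_clip A (X w)))\<^sup>2)
      = Q.expectation (\<lambda>w. (tensor_clip A (X w))\<^sup>2) - (Q.expectation (\<lambda>w. tensor_clip A (X w)))\<^sup>2"
      by (rule Q.variance_eq)
    then show ?thesis
      unfolding cond_var_def[OF b] cond_mean_eq[symmetric] cond_mean_def[OF b]
      by (simp add: tensor_clip_def tensor_def)
  qed
  have "\<bar>?f v\<bar> \<le> (c0\<^sup>2 * norm A)\<^sup>2" for v
    using clip_bound[of "c0\<^sup>2 * norm A" "outer v \<bullet> A"] by (simp add: abs_le_square_iff[symmetric] abs_mult c0_nonneg)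
  moreover have "continuous_on UNIV ?f" by (intro continuous_intros continuous_tensor_clip)
  ultimately have "((\<lambda>s. \<integral>w. ?f (theta \<omega> (X w)) \<partial>cond_above M X s) \<longlongrightarrow> (\<integral>x. ?f (theta \<omega> x) \<partial>L)) at_top"
    by (intro theta_limD)
  moreover have "(\<integral>x. ?f (theta \<omega> x) \<partial>L) = (\<integral>x. (tensor x \<bullet> A)\<^sup>2 \<partial>L)"
  proof (rule integral_cong_AE)
    show "AE x in L. ?f (theta \<omega> x) = (tensor x \<bullet> A)\<^sup>2"
      using theta_bound_L by eventually_elim (use tensor_clip_eq in \<open>simp add: tensor_clip_def tensor_def\<close>)
  qed measurable
  ultimately show ?thesis
    unfolding 1[abs_def] lim_var_eq using Sigma_above_tendsto by (auto intro!: tendsto_intros)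
qed

end

lemma max_proj_scaleR:
  fixes A :: "real^'d^'d"
  assumes "max_proj p A P" "0 < c"
  shows "max_proj p (c *\<^sub>R A) P"
  using assms by (simp add: max_proj_def)

text \<open>A crude comparison whose factor depends only on the dimensions; it transfers Condition
  (B) from the operator norm to \<open>norm\<close>.\<close>

lemma norm_matrix_le_onorm:
  fixes A :: "real^'n^'m"
  shows "norm A \<le> real (CARD('m) * CARD('n)) * onorm ((*v) A)"
proof -
  have "norm A \<le> (\<Sum>i\<in>UNIV. norm (A $ i))" unfolding norm_vec_def[of A] by (rule L2_set_le_sum) simp
  also have "\<dots> \<le> (\<Sum>i\<in>(UNIV::'m set). \<Sum>j\<in>(UNIV::'n set). onorm ((*v) A))"
  proof (intro sum_mono)
    fix i
    have "norm (A $ i) \<le> (\<Sum>j\<in>UNIV. \<bar>A $ i $ j\<bar>)" by (rule norm_le_l1_cart)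
    also have "\<dots> \<le> (\<Sum>j\<in>(UNIV::'n set). onorm ((*v) A))" by (intro sum_mono matrix_component_le_onorm)
    finally show "norm (A $ i) \<le> (\<Sum>j\<in>(UNIV::'n set). onorm ((*v) A))" .
  qed
  finally show ?thesis by simp
qed

lemma norm_matrix_square: "(norm (A::real^'n^'m))\<^sup>2 = (\<Sum>(i, j)\<in>UNIV. (A $ i $ j)\<^sup>2)"
  unfolding power2_norm_eq_inner inner_matrix_sum by (simp add: power2_eq_square)

section \<open>Limit of the centered exceedance matrix\<close>

locale pca_limit = exceedance_matrices M H G C X Xs k t \<nu> \<omega> c0
  for M :: "'a measure" and H G C and X :: "'a \<Rightarrow> real^'d" and Xs k t \<nu> \<omega> c0 +
  fixes M' :: "'u measure" and U :: "'u \<Rightarrow> real^'d^'d"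
  assumes M': "prob_space M'" and U: "centered_gaussian M' U"
    and cov_U: "\<And>i j i' j'. cov M' (\<lambda>u. U u $ i $ j) (\<lambda>u. U u $ i' $ j') =
         cov (limit_model \<nu>) (\<lambda>x. theta \<omega> x $ i * theta \<omega> x $ j) (\<lambda>x. theta \<omega> x $ i' * theta \<omega> x $ j')"
begin

abbreviation Sig :: "real \<Rightarrow> real^'d^'d" where "Sig s \<equiv> Sigma_above M X \<omega> s"

text \<open>For \<open>k n \<ge> n\<close> the order statistic is a junk value, whose measurability is thus avoided.\<close>

definition S :: "nat \<Rightarrow> 'a \<Rightarrow> real^'d^'d" where
  "S n w = (if k n < n then (1 / sqrt (real (k n))) *\<^sub>R (\<Sum>i\<in>E n w. tensor (Xs i w) - Sig (T n w)) else 0)"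

lemma E_eq: "E n w = {i\<in>{..<n}. T n w < norm (Xs i w)}"
  by (simp add: E_def exceed_def T_def)

lemma U_meas [measurable]: "U \<in> borel_measurable M'"
  using U by (simp add: centered_gaussian_def)

lemma U_char: "(\<integral>u. iexp (U u \<bullet> A) \<partial>M') = exp (- lim_var A / 2)"
  unfolding centered_gaussian_char[OF M' U] cov_U lim_var_def ..

lemma Sig_meas [measurable]: "Sig \<in> borel_measurable borel"
proof -
  have "(\<lambda>s. \<integral>w. (if s < norm (X w) then 1 else 0) *\<^sub>R tensor (X w) \<partial>M) \<in> borel_measurable borel"
    by (rule borel_measurable_lebesgue_integral) measurable
  moreover have "(\<lambda>s. \<integral>w. (if s < norm (X w) then 1 else 0 :: real) \<partial>M) \<in> borel_measurable borel"
    by (rule borel_measurable_lebesgue_integral) measurable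
  moreover have "(\<integral>w. (if s < norm (X w) then 1 else 0 :: real) \<partial>M) = H s" for s
  proof -
    have [measurable]: "{w\<in>space M. s < norm (X w)} \<in> events" by measurable
    have "(\<integral>w. (if s < norm (X w) then 1 else 0 :: real) \<partial>M) = (\<integral>w. indicator {w\<in>space M. s < norm (X w)} w \<partial>M)"
      by (intro Bochner_Integration.integral_cong) auto
    also have "\<dots> = H s" by (simp add: H_eq)
    finally show ?thesis .
  qed
  moreover have "Sig s = (\<integral>w. (if s < norm (X w) then 1 else 0) *\<^sub>R tensor (X w) \<partial>M) /\<^sub>R H s" for s
    unfolding Sigma_above_eq
    by (subst integral_cond_above) (auto intro!: arg_cong[where f = "\<lambda>x. x /\<^sub>R H s"] Bochner_Integration.integral_cong)
  ultimately show ?thesis by simp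
qed

lemma S_meas [measurable]: "S n \<in> borel_measurable M"
proof (cases "k n < n")
  case True
  note [measurable] = T_meas[OF True]
  have "S n w = (1 / sqrt (real (k n))) *\<^sub>R
      (\<Sum>i<n. (if T n w < norm (Xs i w) then 1 else 0) *\<^sub>R (tensor (Xs i w) - Sig (T n w)))" for w
  proof -
    have "(\<Sum>i<n. (if T n w < norm (Xs i w) then 1 else 0) *\<^sub>R (tensor (Xs i w) - Sig (T n w)))
      = (\<Sum>i<n. if T n w < norm (Xs i w) then tensor (Xs i w) - Sig (T n w) else 0)"
      by (intro sum.cong) auto
    also have "\<dots> = (\<Sum>i\<in>E n w. tensor (Xs i w) - Sig (T n w))"
      unfolding E_eq by (rule sum.inter_filter[symmetric]) simp
    finally show ?thesis using True by (simp add: S_def)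
  qed
  then show ?thesis by (subst measurable_cong) measurable
next
  case False
  then have "S n = (\<lambda>_. 0)" by (simp add: S_def fun_eq_iff)
  then show ?thesis by simp
qed

text \<open>The central limit theorem for \<open>tensor_clip A\<close> with \<open>A\<close> fixed;
  almost surely, clipping is the identity at all sample points simultaneously.\<close>

lemma S_char: "(\<lambda>n. \<integral>w. iexp (S n w \<bullet> A) \<partial>M) \<longlonglongrightarrow> (\<integral>u. iexp (U u \<bullet> A) \<partial>M')"
  unfolding U_char
proof (rule Lim_transform_eventually[OF exceedance_sum_char[OF tensor_clip_meas tensor_clip_bound cond_var_tendsto]])
  show "\<forall>\<^sub>F n in sequentially.
      (\<integral>w. iexp ((\<Sum>i\<in>E n w. tensor_clip A (Xs i w) - cond_mean (tensor_clip A) (T n w)) / sqrt (real (k n))) \<partial>M)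
      = (\<integral>w. iexp (S n w \<bullet> A) \<partial>M)"
    using k_range
  proof eventually_elim
    case (elim n)
    have eq: "(\<Sum>i\<in>E n w. tensor_clip A (Xs i w) - cond_mean (tensor_clip A) (T n w)) / sqrt (real (k n)) = S n w \<bullet> A"
      if "\<And>i. norm (theta \<omega> (Xs i w)) \<le> c0" for w
      using elim that by (simp add: S_def tensor_clip_eq cond_mean_eq inner_sum_left inner_diff_left)
    have "AE w in M. \<forall>i. norm (theta \<omega> (Xs i w)) \<le> c0"
      unfolding AE_all_countable using theta_bound_Xs by blast
    then have "AE w in M. (\<Sum>i\<in>E n w. tensor_clip A (Xs i w) - cond_mean (tensor_clip A) (T n w)) / sqrt (real (k n)) = S n w \<bullet> A"
      by eventually_elim (use eq in blast)
    then have "AE w in M. iexp ((\<Sum>i\<in>E n w. tensor_clip A (Xs i w) - cond_mean (tensor_clip A) (T n w)) / sqrt (real (k n)))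
        = iexp (S n w \<bullet> A)"
      by eventually_elim (simp only:)
    moreover have 1: "(\<lambda>w. iexp ((\<Sum>i\<in>E n w. tensor_clip A (Xs i w) - cond_mean (tensor_clip A) (T n w)) / sqrt (real (k n))))
        \<in> borel_measurable M"
    proof -
      note [measurable] = T_meas[OF conjunct2[OF elim]] cond_mean_meas[OF tensor_clip_meas[of A] tensor_clip_bound]
      have "(\<lambda>w. (\<Sum>i<n. if T n w < norm (Xs i w) then tensor_clip A (Xs i w) - cond_mean (tensor_clip A) (T n w) else 0)) \<in> borel_measurable M"
        by measurable
      then have [measurable]: "(\<lambda>w. (\<Sum>i\<in>E n w. tensor_clip A (Xs i w) - cond_mean (tensor_clip A) (T n w))) \<in> borel_measurable M"
        unfolding E_eq by (subst sum.inter_filter) simp_all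
      show ?thesis by measurable
    qed
    moreover have 2: "(\<lambda>w. iexp (S n w \<bullet> A)) \<in> borel_measurable M" by measurable
    ultimately show ?case by (intro integral_cong_AE[OF 1 2])
  qed
qed

text \<open>A linear combination of the functionals given by the \<open>A l\<close> is again such a
  functional, so \<open>S_char\<close> supplies the input of
  \<open>gauss_mixture_conv\<close>.\<close>

lemma S_laplace:
  fixes A :: "'i \<Rightarrow> real^'d^'d"
  assumes "finite I"
  shows "(\<lambda>n. \<integral>w. exp (- (\<Sum>l\<in>I. (S n w \<bullet> A l)\<^sup>2) / 2) \<partial>M) \<longlonglongrightarrow> (\<integral>u. exp (- (\<Sum>l\<in>I. (U u \<bullet> A l)\<^sup>2) / 2) \<partial>M')"
proof (rule gauss_mixture_conv[OF prob_space_axioms M' assms])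
  fix g :: "'i \<Rightarrow> real"
  have "(\<Sum>l\<in>I. g l * (Y \<bullet> A l)) = Y \<bullet> (\<Sum>l\<in>I. g l *\<^sub>R A l)" for Y by (simp add: inner_sum_right)
  then show "(\<lambda>n. \<integral>w. iexp (\<Sum>l\<in>I. g l * (S n w \<bullet> A l)) \<partial>M) \<longlonglongrightarrow> (\<integral>u. iexp (\<Sum>l\<in>I. g l * (U u \<bullet> A l)) \<partial>M')"
    using S_char[of "\<Sum>l\<in>I. g l *\<^sub>R A l"] by simp
qed measurable

lemma S_norm_laplace:
  assumes "0 \<le> c"
  shows "(\<lambda>n. \<integral>w. exp (- (c * (norm (S n w))\<^sup>2) / 2) \<partial>M) \<longlonglongrightarrow> (\<integral>u. exp (- (c * (norm (U u))\<^sup>2) / 2) \<partial>M')"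
proof -
  have "(\<Sum>(i, j)\<in>UNIV. (Y \<bullet> (sqrt c *\<^sub>R axis i (axis j 1)))\<^sup>2) = c * (norm Y)\<^sup>2" for Y :: "real^'d^'d"
    unfolding norm_matrix_square using assms
    by (simp add: inner_axis power_mult_distrib sum_distrib_left split_beta')
  then show ?thesis
    using S_laplace[of "UNIV :: ('d \<times> 'd) set" "\<lambda>(i, j). sqrt c *\<^sub>R axis i (axis j 1)"]
    by (simp add: split_beta')
qed

text \<open>Tightness is read off the Laplace transform of \<open>(norm (S n w))\<^sup>2\<close>:
  for a small parameter its limit is close to 1, which leaves little room for large norms.\<close>

lemma S_tight:
  assumes \<eta>: "0 < \<eta>"
  shows "\<exists>K>0. holds_up_to \<eta> (\<lambda>n w. norm (S n w) \<le> K)"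
proof -
  interpret M': prob_space M' by (rule M')
  have "(\<lambda>m. \<integral>u. exp (- (1 / real (Suc m) * (norm (U u))\<^sup>2) / 2) \<partial>M') \<longlonglongrightarrow> (\<integral>u. exp (- (0 * (norm (U u))\<^sup>2) / 2) \<partial>M')"
  proof (rule integral_dominated_convergence[where w = "\<lambda>_. 1"])
    have z: "(\<lambda>m. 1 / real (Suc m)) \<longlonglongrightarrow> 0" using LIMSEQ_inverse_real_of_nat by (simp add: inverse_eq_divide)
    show "AE u in M'. (\<lambda>m. exp (- (1 / real (Suc m) * (norm (U u))\<^sup>2) / 2)) \<longlonglongrightarrow> exp (- (0 * (norm (U u))\<^sup>2) / 2)"
      by (intro AE_I2 tendsto_intros z) simp
  qed auto
  then have "(\<lambda>m. \<integral>u. exp (- (1 / real (Suc m) * (norm (U u))\<^sup>2) / 2) \<partial>M') \<longlonglongrightarrow> 1" by (simp add: M'.prob_space)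
  from order_tendstoD(1)[OF this, of "1 - \<eta> / 4"] \<eta> obtain m where
    m: "1 - \<eta> / 4 < (\<integral>u. exp (- (1 / real (Suc m) * (norm (U u))\<^sup>2) / 2) \<partial>M')"
    by (auto simp: eventually_sequentially)
  define c where "c = 1 / real (Suc m)"
  have c: "c > 0" by (simp add: c_def)
  \<comment> \<open>Beyond this radius the exponential is at most \<open>exp (- 1)\<close>, so the
    deficit from 1 is at least 1/2; Markov's inequality then costs a factor 2 on the mean deficit
    \<open>\<eta> / 4\<close>.\<close>
  define K where "K = sqrt (2 / c)"
  have K: "K > 0" using c by (simp add: K_def)
  have "\<forall>\<^sub>F n in sequentially. 1 - \<eta> / 4 < (\<integral>w. exp (- (c * (norm (S n w))\<^sup>2) / 2) \<partial>M)"
    using m c by (intro order_tendstoD(1)[OF S_norm_laplace]) (auto simp: c_def)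
  then have "holds_up_to \<eta> (\<lambda>n w. norm (S n w) \<le> K)"
    unfolding holds_up_to_def
  proof eventually_elim
    case (elim n)
    let ?u = "\<lambda>w. 1 - exp (- (c * (norm (S n w))\<^sup>2) / 2)"
    let ?A = "{w\<in>space M. 1 / 2 \<le> ?u w}"
    have i: "integrable M (\<lambda>w. exp (- (c * (norm (S n w))\<^sup>2) / 2))"
      using c by (intro integrable_const_bound[of _ 1]) auto
    have "prob ?A \<le> expectation ?u / (1 / 2)"
      using c i by (intro integral_Markov_inequality_measure[where A = "{}"]) auto
    also have "\<dots> = 2 * (1 - expectation (\<lambda>w. exp (- (c * (norm (S n w))\<^sup>2) / 2)))"
      using i by (simp add: prob_space)
    also have "\<dots> \<le> \<eta>" using elim \<eta> by simp
    finally have "prob ?A \<le> \<eta>" .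
    moreover have "?A \<in> events" by measurable
    moreover have "norm (S n w) \<le> K" if w: "w \<in> space M - ?A" for w
    proof (rule ccontr)
      assume "\<not> norm (S n w) \<le> K"
      then have "K\<^sup>2 \<le> (norm (S n w))\<^sup>2" using K by (intro power_mono) auto
      then have "2 \<le> c * (norm (S n w))\<^sup>2" using c by (simp add: K_def field_simps)
      then have "exp (- (c * (norm (S n w))\<^sup>2) / 2) \<le> exp (- 1)" by simp
      also have "\<dots> \<le> 1 / 2" using exp_ge_add_one_self[of 1] by (simp add: exp_minus field_simps)
      finally have "w \<in> ?A" using w by simp
      then show False using w by blast
    qed
    ultimately show ?case by blast
  qed
  with K show ?thesis by blast
qed

end

section \<open>Comparison of the loss with the quadratic form\<close>

locale pca_risk = pca_limit M H G C X Xs k t \<nu> \<omega> c0 M' U +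
    spectral_decomposition "Sigma_inf \<nu> \<omega>" Pr \<mu> D J p
  for M :: "'a measure" and H G C and X :: "'a \<Rightarrow> real^'d" and Xs k t \<nu> \<omega> c0
    and M' :: "'u measure" and U :: "'u \<Rightarrow> real^'d^'d" and Pr \<mu> D J p +
  fixes Ps :: "nat \<Rightarrow> real^'d^'d" and Ph :: "nat \<Rightarrow> 'a \<Rightarrow> real^'d^'d"
  assumes Ps: "\<And>n. max_proj p (Sigma_above M X \<omega> (t n)) (Ps n)"
    and Ph: "\<And>n w. w \<in> space M \<Longrightarrow> Ph n w \<in> proj_rank p"
      "\<And>n w. w \<in> space M \<Longrightarrow> 0 < k n \<Longrightarrow> k n < n \<Longrightarrow> max_proj p (\<Sum>i\<in>E n w. tensor (Xs i w)) (Ph n w)"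
    and Ph_meas [measurable]: "\<And>n. Ph n \<in> borel_measurable M"
    and cond_B: "\<exists>\<epsilon>>0. \<forall>c>0. \<forall>\<^sub>F n in sequentially. \<forall>s\<in>{1 - \<epsilon>..1 + \<epsilon>}.
              onorm ((*v) (Sigma_above M X \<omega> (s * t n) - Sigma_above M X \<omega> (t n)))
                \<le> c * real (k n) powr (- 1 / 2)"
begin

definition Y :: "nat \<Rightarrow> 'a \<Rightarrow> real" where
  "Y n w = real (k n) * (Sig (t n) \<bullet> (Ps n - Ph n w))"

lemma Y_meas [measurable]: "Y n \<in> borel_measurable M"
  unfolding Y_def[abs_def] by measurable

lemma Y_nonneg: "w \<in> space M \<Longrightarrow> 0 \<le> Y n w"
  using Ps[of n] Ph(1)[of w n] by (simp add: Y_def max_proj_def inner_diff_right)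

lemma continuous_loss_form: "continuous_on UNIV loss_form"
  unfolding continuous_on_def by (auto intro: tendsto_loss_form)

lemma loss_form_meas [measurable]: "loss_form \<in> borel_measurable borel"
  by (rule borel_measurable_continuous_onI[OF continuous_loss_form])

lemma whp_Sig_T:
  assumes e: "0 < e"
  shows "whp (\<lambda>n w. sqrt (real (k n)) * norm (Sig (T n w) - Sig (t n)) \<le> e)"
proof -
  obtain \<epsilon> where \<epsilon>: "\<epsilon> > 0" and B: "\<And>c. c > 0 \<Longrightarrow> \<forall>\<^sub>F n in sequentially. \<forall>s\<in>{1 - \<epsilon>..1 + \<epsilon>}.
      onorm ((*v) (Sig (s * t n) - Sig (t n))) \<le> c * real (k n) powr (- 1 / 2)"
    using cond_B by blast
  define d where "d = real (CARD('d) * CARD('d))"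
  have d: "d > 0" by (simp add: d_def)
  have tpos: "\<forall>\<^sub>F n in sequentially. 0 < t n" using t_at_top[unfolded filterlim_at_top_dense] by (rule spec)
  show ?thesis
  proof (rule whp_mono[OF whp_T_near[OF \<epsilon>]])
    have "e / d > 0" using e d by simp
    from B[OF this] tpos k_range
    show "\<forall>\<^sub>F n in sequentially. \<forall>w\<in>space M. (1 - \<epsilon>) * t n \<le> T n w \<and> T n w \<le> (1 + \<epsilon>) * t n \<longrightarrow>
      sqrt (real (k n)) * norm (Sig (T n w) - Sig (t n)) \<le> e"
    proof eventually_elim
      case (elim n)
      show ?case
      proof (intro ballI impI)
        fix w assume w: "(1 - \<epsilon>) * t n \<le> T n w \<and> T n w \<le> (1 + \<epsilon>) * t n"
        \<comment> \<open>Condition (B) is uniform over the interval of scales, so it may be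
          evaluated at this random scale.\<close>
        let ?s = "T n w / t n"
        have "?s \<in> {1 - \<epsilon>..1 + \<epsilon>}" "?s * t n = T n w"
          using w elim(2) by (auto simp: field_simps)
        then have "onorm ((*v) (Sig (T n w) - Sig (t n))) \<le> e / d * real (k n) powr (- 1 / 2)"
          using elim(1) by metis
        also have "real (k n) powr (- 1 / 2) = 1 / sqrt (real (k n))"
          using elim(3) by (simp add: powr_minus_divide powr_half_sqrt)
        finally have o: "onorm ((*v) (Sig (T n w) - Sig (t n))) \<le> e / d * (1 / sqrt (real (k n)))" .
        have "norm (Sig (T n w) - Sig (t n)) \<le> d * onorm ((*v) (Sig (T n w) - Sig (t n)))"
          unfolding d_def by (rule norm_matrix_le_onorm)
        also have "\<dots> \<le> d * (e / d * (1 / sqrt (real (k n))))" using o d by (intro mult_left_mono) auto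
        also have "\<dots> = e / sqrt (real (k n))" using d by simp
        finally show "sqrt (real (k n)) * norm (Sig (T n w) - Sig (t n)) \<le> e"
          using elim(3) by (simp add: field_simps)
      qed
    qed
  qed
qed

text \<open>The empirical second moment matrix is normalised by the number of exceedances. In the presence
  of ties this number can be smaller than \<open>k\<close>, but the maximisers do not depend on the normalisation.\<close>

lemma risk_approx:
  assumes \<eta>: "0 < \<eta>"
  shows "holds_up_to \<eta> (\<lambda>n w. \<bar>Y n w - loss_form (S n w)\<bar> \<le> \<eta>)"
proof -
  obtain K where K: "K > 0" and tight: "holds_up_to (\<eta> / 2) (\<lambda>n w. norm (S n w) \<le> K)"
    using S_tight[of "\<eta> / 2"] \<eta> by auto
  have "uniformly_continuous_on (cball 0 (K + 1)) loss_form"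
    by (intro compact_uniformly_continuous continuous_on_subset[OF continuous_loss_form]) auto
  then obtain \<delta>' where \<delta>': "\<delta>' > 0" "\<And>x y. x \<in> cball 0 (K + 1) \<Longrightarrow> y \<in> cball 0 (K + 1) \<Longrightarrow> dist y x < \<delta>' \<Longrightarrow>
      dist (loss_form y) (loss_form x) < \<eta> / 2"
    using \<eta> unfolding uniformly_continuous_on_def by (meson half_gt_zero)
  define \<delta> where "\<delta> = min \<delta>' 1"
  have \<delta>: "0 < \<delta>" "\<delta> \<le> 1" "\<delta> \<le> \<delta>'" using \<delta>' by (auto simp: \<delta>_def)
  have "\<eta> / 2 > 0" using \<eta> by simp
  from loss_uniform[OF this, of "K + 1"] obtain \<gamma> where \<gamma>: "\<gamma> > 0"
    "\<And>A d E P Q. norm (A - Sigma_inf \<nu> \<omega>) < \<gamma> \<Longrightarrow> 0 < d \<Longrightarrow> d < \<gamma> \<Longrightarrow> norm E \<le> K + 1 \<Longrightarrow>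
    transpose A = A \<Longrightarrow> transpose E = E \<Longrightarrow> max_proj p A P \<Longrightarrow> max_proj p (A + d *\<^sub>R E) Q \<Longrightarrow>
    \<bar>A \<bullet> (P - Q) / d\<^sup>2 - loss_form E\<bar> \<le> \<eta> / 2"
    by blast
  \<comment> \<open>Allowed shortfall in the fraction of exceedances. It makes the effect
    \<open>2 * e * K\<close> of normalising by their number at most \<open>\<delta> / 3\<close>, and
    1/2 is the range in which 1/(1 - e) is at most 1 + 2e.\<close>
  define e where "e = min (1 / 2) (\<delta> / (6 * (K + 1)))"
  have e: "0 < e" "e \<le> 1 / 2" using \<delta> K by (auto simp: e_def)
  have eK: "2 * e * K \<le> \<delta> / 3"
  proof -
    have "e * (6 * (K + 1)) \<le> \<delta>" using K by (simp add: e_def min_def pos_le_divide_eq)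
    moreover have "e * K \<le> e * (K + 1)" using e by simp
    ultimately show ?thesis by (simp add: algebra_simps)
  qed
  have kr: "filterlim (\<lambda>n. real (k n)) at_top sequentially"
    by (rule filterlim_compose[OF filterlim_real_sequentially k(1)])
  have "(\<lambda>n. inverse (sqrt (real (k n)))) \<longlonglongrightarrow> 0"
    by (rule tendsto_inverse_0_at_top[OF filterlim_compose[OF sqrt_at_top kr]])
  then have ev1: "\<forall>\<^sub>F n in sequentially. inverse (sqrt (real (k n))) < \<gamma>"
    using \<gamma>(1) by (intro order_tendstoD(2))
  have "(\<lambda>n. Sig (t n)) \<longlonglongrightarrow> Sigma_inf \<nu> \<omega>"
    by (rule filterlim_compose[OF Sigma_above_tendsto t_at_top])
  then have ev2: "\<forall>\<^sub>F n in sequentially. norm (Sig (t n) - Sigma_inf \<nu> \<omega>) < \<gamma>"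
    using \<gamma>(1) by (auto dest!: tendstoD simp: dist_norm)
  have \<delta>3: "\<delta> / 3 > 0" using \<delta> by simp
  show ?thesis
  proof (rule holds_up_to_mono[OF holds_up_to_whp[OF tight whp_conj[OF whp_Sig_T[OF \<delta>3] whp_card_E[OF e(1)]]]])
    show "\<eta> / 2 < \<eta>" using \<eta> by simp
    show "\<forall>\<^sub>F n in sequentially. \<forall>w\<in>space M. norm (S n w) \<le> K \<and>
        sqrt (real (k n)) * norm (Sig (T n w) - Sig (t n)) \<le> \<delta> / 3 \<and> 1 - e \<le> real (card (E n w)) / real (k n) \<longrightarrow>
        \<bar>Y n w - loss_form (S n w)\<bar> \<le> \<eta>"
      using ev1 ev2 k_range
    proof eventually_elim
      case (elim n)
      show ?case
      proof (intro ballI impI)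
        fix w assume w: "w \<in> space M"
        assume *: "norm (S n w) \<le> K \<and> sqrt (real (k n)) * norm (Sig (T n w) - Sig (t n)) \<le> \<delta> / 3 \<and>
          1 - e \<le> real (card (E n w)) / real (k n)"
        define q where "q = real (card (E n w))"
        define d where "d = inverse (sqrt (real (k n)))"
        have kn: "0 < real (k n)" "k n < n" using elim by auto
        have d: "0 < d" "d < \<gamma>" "d * d = 1 / real (k n)"
          using elim kn by (auto simp: d_def inverse_eq_divide simp flip: real_sqrt_mult)
        have sk: "sqrt (real (k n)) = 1 / d" by (simp add: d_def divide_inverse)
        have q: "(1 - e) * real (k n) \<le> q" "q \<le> real (k n)"
          using * kn card_E_le[OF kn(2), of w] by (simp_all add: q_def pos_le_divide_eq)
        have "0 < (1 - e) * real (k n)" using e kn by simp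
        then have q0: "0 < q" using q(1) by linarith
        let ?R = "\<Sum>i\<in>E n w. tensor (Xs i w)"
        \<comment> \<open>The direction for which \<open>Sig (t n) + d *\<^sub>R F\<close> is
          exactly the sum \<open>?R\<close> divided by the number of exceedances. It differs from
          \<open>S n w\<close> by the drift of the centering and by the factor
          \<open>real (k n) / q\<close>.\<close>
        define F where "F = (1 / d) *\<^sub>R ((1 / q) *\<^sub>R ?R - Sig (t n))"
        have R: "?R = (1 / d) *\<^sub>R S n w + q *\<^sub>R Sig (T n w)"
          using kn d by (simp add: S_def sk q_def sum_subtractf sum_constant_scaleR del: sum_constant)
        have dq: "(1 / d) * (1 / q) * (1 / d) = real (k n) / q"
        proof -
          have "(1 / d) * (1 / q) * (1 / d) = 1 / (d * d) / q" by (simp add: mult_ac)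
          then show ?thesis unfolding d(3) by simp
        qed
        have "F = (1 / d) *\<^sub>R (Sig (T n w) - Sig (t n)) + (real (k n) / q) *\<^sub>R S n w"
          unfolding F_def R using q0 by (simp add: scaleR_add_right scaleR_diff_right dq[symmetric])
        then have FS: "F - S n w = (1 / d) *\<^sub>R (Sig (T n w) - Sig (t n)) + (real (k n) / q - 1) *\<^sub>R S n w"
          by (simp add: scaleR_diff_left)
        have kq: "0 \<le> real (k n) / q - 1" "real (k n) / q - 1 \<le> 2 * e"
        proof -
          show "0 \<le> real (k n) / q - 1" using q q0 by simp
          have "1 \<le> (1 + 2 * e) * (1 - e)" using e mult_left_mono[OF e(2), of e] by (simp add: algebra_simps)
          then have "1 * real (k n) \<le> (1 + 2 * e) * (1 - e) * real (k n)" by (rule mult_right_mono) simp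
          also have "\<dots> \<le> (1 + 2 * e) * q" using q(1) e by (simp add: mult.assoc)
          finally have "real (k n) / q \<le> 1 + 2 * e" using q0 by (simp only: pos_divide_le_eq mult_1)
          then show "real (k n) / q - 1 \<le> 2 * e" by simp
        qed
        have "norm (F - S n w) \<le> norm ((1 / d) *\<^sub>R (Sig (T n w) - Sig (t n))) + norm ((real (k n) / q - 1) *\<^sub>R S n w)"
          unfolding FS by (rule norm_triangle_ineq)
        also have "\<dots> \<le> \<delta> / 3 + 2 * e * K"
          using * kq d K by (intro add_mono) (auto simp: sk intro!: mult_mono)
        also have "\<dots> < \<delta>" using eK \<delta> by simp
        finally have near: "norm (F - S n w) < \<delta>" .
        have FK: "norm F \<le> K + 1" using near * \<delta>(2) norm_triangle_sub[of F "S n w"] by simp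
        have "max_proj p (Sig (t n) + d *\<^sub>R F) (Ph n w)"
        proof -
          have "Sig (t n) + d *\<^sub>R F = (1 / q) *\<^sub>R ?R" using d by (simp add: F_def)
          then show ?thesis using max_proj_scaleR[OF Ph(2)[OF w], of n "1 / q"] elim q0 by simp
        qed
        moreover have "transpose F = F"
          by (simp add: F_def transpose_simps Sigma_sym tensor_def)
        ultimately have "\<bar>Sig (t n) \<bullet> (Ps n - Ph n w) / d\<^sup>2 - loss_form F\<bar> \<le> \<eta> / 2"
          using elim d FK Ps Sigma_sym by (intro \<gamma>(2)) auto
        moreover have "Sig (t n) \<bullet> (Ps n - Ph n w) / d\<^sup>2 = Y n w"
          using d by (simp add: Y_def power2_eq_square)
        moreover have "dist (loss_form F) (loss_form (S n w)) < \<eta> / 2"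
          using near * \<delta> FK by (intro \<delta>'(2)) (auto simp: dist_norm)
        ultimately show "\<bar>Y n w - loss_form (S n w)\<bar> \<le> \<eta>" unfolding dist_real_def by linarith
      qed
    qed
  qed
qed

text \<open>The entries of \<open>Pr j ** F ** Pr m\<close> are inner products of \<open>F\<close>
  with \<open>Pr j ** axis a (axis b 1) ** Pr m\<close>. The 2 under the root matches the 1/2 in the
  Gaussian exponent.\<close>

lemma loss_form_squares:
  assumes c: "0 \<le> c"
  shows "\<exists>(I :: ((nat \<times> nat) \<times> ('d \<times> 'd)) set) A. finite I \<and> (\<forall>F. c * loss_form F = (\<Sum>l\<in>I. (F \<bullet> A l)\<^sup>2) / 2)"
proof (intro exI conjI allI)
  let ?I = "({1..J} \<times> {J+1..D}) \<times> (UNIV :: ('d \<times> 'd) set)"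
  define A where "A = (\<lambda>((j, m), (a, b)). sqrt (2 * c / (\<mu> j - \<mu> m)) *\<^sub>R
      (Pr j ** axis a (axis b 1) ** Pr m :: real^'d^'d))"
  show "finite ?I" by simp
  fix F
  have entry: "((X::real^'d^'d) $ a $ b) = X \<bullet> axis a (axis b 1)" for X a b by (simp add: inner_axis)
  have "(\<Sum>l\<in>?I. (F \<bullet> A l)\<^sup>2) = (\<Sum>j=1..J. \<Sum>m=J+1..D. \<Sum>(a, b)\<in>UNIV. (F \<bullet> A ((j, m), (a, b)))\<^sup>2)"
  proof -
    have "(\<Sum>l\<in>?I. h l) = (\<Sum>j=1..J. \<Sum>m=J+1..D. \<Sum>y\<in>UNIV. h ((j, m), y))" for h :: "_ \<Rightarrow> real"
    proof -
      have "(\<Sum>l\<in>?I. h l) = (\<Sum>x\<in>{1..J} \<times> {J+1..D}. \<Sum>y\<in>UNIV. h (x, y))"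
        unfolding sum.cartesian_product by (simp add: split_beta')
      also have "\<dots> = (\<Sum>j=1..J. \<Sum>m=J+1..D. \<Sum>y\<in>UNIV. h ((j, m), y))"
        unfolding sum.cartesian_product[of _ "{J+1..D}"] by (simp add: split_beta')
      finally show ?thesis .
    qed
    then show ?thesis by (simp add: split_beta')
  qed
  also have "\<dots> = (\<Sum>j=1..J. \<Sum>m=J+1..D. 2 * c / (\<mu> j - \<mu> m) * (norm (Pr j ** F ** Pr m))\<^sup>2)"
  proof (intro sum.cong refl)
    fix j m assume jm: "j \<in> {1..J}" "m \<in> {J+1..D}"
    have pos: "0 \<le> 2 * c / (\<mu> j - \<mu> m)" using \<mu>_dec[of j m] jm c by simp
    have sym: "transpose (Pr j) = Pr j" "transpose (Pr m) = Pr m" using jm J by (auto intro: Pr_sym)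
    have "F \<bullet> A ((j, m), (a, b)) = sqrt (2 * c / (\<mu> j - \<mu> m)) * ((Pr j ** F ** Pr m) $ a $ b)" for a b
      unfolding entry A_def
      using inner_mult_right[of "Pr j ** F" "Pr m" "axis a (axis b 1)"] inner_mult_left[of "Pr j" F "axis a (axis b 1) ** Pr m"]
      by (simp add: sym matrix_mul_assoc)
    then show "(\<Sum>(a, b)\<in>UNIV. (F \<bullet> A ((j, m), (a, b)))\<^sup>2) = 2 * c / (\<mu> j - \<mu> m) * (norm (Pr j ** F ** Pr m))\<^sup>2"
      unfolding norm_matrix_square using pos
      by (simp add: power_mult_distrib sum_distrib_left split_beta')
  qed
  also have "\<dots> = 2 * (c * loss_form F)"
    by (simp add: loss_form_def sum_distrib_left mult_ac)
  finally show "c * loss_form F = (\<Sum>l\<in>?I. (F \<bullet> A l)\<^sup>2) / 2" by simp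
qed

text \<open>A multiple of \<open>loss_form\<close> is half a sum of squares, so
  \<open>S_laplace\<close> gives the limit of its Laplace transform at \<open>S n\<close>; the error
  of replacing it by \<open>Y n\<close> vanishes by \<open>risk_approx\<close>.\<close>

lemma risk_weak_conv: "weak_conv_m (\<lambda>n. distr M borel (Y n)) (distr M' borel (\<lambda>u. loss_form (U u)))"
proof (rule nonneg_laplace_weak_conv[OF prob_space_axioms M'])
  show "AE w in M. 0 \<le> Y n w" for n using Y_nonneg by auto
  show "AE u in M'. 0 \<le> loss_form (U u)" using loss_form_nonneg by auto
  fix m :: nat assume m: "0 < m"
  obtain I :: "((nat \<times> nat) \<times> ('d \<times> 'd)) set" and A where "finite I"
    and IA: "\<And>F. real m * loss_form F = (\<Sum>l\<in>I. (F \<bullet> A l)\<^sup>2) / 2"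
    using loss_form_squares[of "real m"] by auto
  from S_laplace[OF this(1), of A]
  have 1: "(\<lambda>n. \<integral>w. exp (- (real m * loss_form (S n w))) \<partial>M) \<longlonglongrightarrow> (\<integral>u. exp (- (real m * loss_form (U u))) \<partial>M')"
    unfolding IA by simp
  have 2: "(\<lambda>n. \<integral>w. exp (- (real m * Y n w)) - exp (- (real m * loss_form (S n w))) \<partial>M) \<longlonglongrightarrow> 0"
  proof (rule expectation_tendsto_0[where B = 1])
    show "\<forall>\<^sub>F n in sequentially. (\<lambda>w. exp (- (real m * Y n w)) - exp (- (real m * loss_form (S n w)))) \<in> borel_measurable M"
      by (intro always_eventually allI) measurable
    show "\<bar>exp (- (real m * Y n w)) - exp (- (real m * loss_form (S n w)))\<bar> \<le> 1" if "w \<in> space M" for n w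
    proof -
      have "exp (- (real m * Y n w)) \<le> 1" "exp (- (real m * loss_form (S n w))) \<le> 1"
        using Y_nonneg[OF that, of n] loss_form_nonneg[of "S n w"] by simp_all
      moreover have "0 < exp (- (real m * Y n w))" "0 < exp (- (real m * loss_form (S n w)))" by simp_all
      ultimately show ?thesis by linarith
    qed
    fix e :: real assume e: "e > 0"
    \<comment> \<open>The exponent is \<open>m\<close> times the argument, so an accuracy of
      \<open>e / m\<close> is requested; the probability level \<open>e / m\<close> is relaxed to
      \<open>e\<close> afterwards.\<close>
    have "holds_up_to (e / m) (\<lambda>n w. \<bar>Y n w - loss_form (S n w)\<bar> \<le> e / m)"
      using e m by (intro risk_approx) simp
    then have "holds_up_to (e / m) (\<lambda>n w. \<bar>exp (- (real m * Y n w)) - exp (- (real m * loss_form (S n w)))\<bar> \<le> e)"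
    proof (rule holds_up_to_mono, intro always_eventually allI ballI impI)
      fix n w assume w: "w \<in> space M" "\<bar>Y n w - loss_form (S n w)\<bar> \<le> e / m"
      have "\<bar>exp (- (real m * Y n w)) - exp (- (real m * loss_form (S n w)))\<bar> \<le> \<bar>real m * Y n w - real m * loss_form (S n w)\<bar>"
        using Y_nonneg[OF w(1), of n] loss_form_nonneg[of "S n w"] by (intro exp_minus_lipschitz) auto
      also have "\<dots> = real m * \<bar>Y n w - loss_form (S n w)\<bar>" by (simp add: abs_mult flip: right_diff_distrib)
      also have "\<dots> \<le> e" using w(2) m by (simp add: field_simps)
      finally show "\<bar>exp (- (real m * Y n w)) - exp (- (real m * loss_form (S n w)))\<bar> \<le> e" .
    qed
    moreover have "e / m \<le> e" using m e by (simp add: field_simps)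
    ultimately show "holds_up_to e (\<lambda>n w. \<bar>exp (- (real m * Y n w)) - exp (- (real m * loss_form (S n w)))\<bar> \<le> e)"
      unfolding holds_up_to_def by (auto elim!: eventually_mono intro: order_trans)
  qed
  have "(\<integral>w. exp (- (real m * Y n w)) - exp (- (real m * loss_form (S n w))) \<partial>M) =
      (\<integral>w. exp (- (real m * Y n w)) \<partial>M) - (\<integral>w. exp (- (real m * loss_form (S n w))) \<partial>M)" for n
    using Y_nonneg loss_form_nonneg
    by (intro Bochner_Integration.integral_diff integrable_const_bound[of _ 1]) auto
  with tendsto_add[OF 2 1]
  show "(\<lambda>n. \<integral>w. exp (- (real m * Y n w)) \<partial>M) \<longlonglongrightarrow> (\<integral>u. exp (- (real m * loss_form (U u))) \<partial>M')"
    by simp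
qed measurable

end

theorem corollary4p2:
  fixes M :: "'a measure" and X :: "'a \<Rightarrow> real^'d" and Xs :: "nat \<Rightarrow> 'a \<Rightarrow> real^'d"
    and \<nu> :: "(real^'d) measure" and \<omega> :: "real^'d \<Rightarrow> real"
    and k :: "nat \<Rightarrow> nat" and t :: "nat \<Rightarrow> real"
    and M' :: "'u measure" and U :: "'u \<Rightarrow> real^'d^'d"
    and ev \<mu> :: "nat \<Rightarrow> real" and N :: "nat \<Rightarrow> nat" and D J p :: nat
    and W :: "nat \<Rightarrow> (real^'d) set"
    and Vstar :: "nat \<Rightarrow> (real^'d) set" and Vhat :: "nat \<Rightarrow> 'a \<Rightarrow> (real^'d) set"
  assumes M: "prob_space M"
    and rv: "regularly_varying M X \<nu>"
    and iid: "prob_space.indep_vars M (\<lambda>_. borel) Xs UNIV"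
      "\<And>i. distr M borel (Xs i) = distr M borel X"
    and \<omega>: "\<omega> \<in> borel_measurable borel" "\<And>x. 0 < \<omega> x"
      "\<exists>C. AE w in M. norm (theta \<omega> (X w)) \<le> C"
      "theta_limit M X \<nu> \<omega>"
    and k: "filterlim k at_top sequentially" "(\<lambda>n. real (k n) / real n) \<longlonglongrightarrow> 0"
    and t: "\<And>n. t n = norm_quantile M X (1 - real (k n) / real n)"
    and U: "prob_space M'" "centered_gaussian M' U" "AE u in M'. transpose (U u) = U u"
      "\<And>i j i' j'. cov M' (\<lambda>u. U u $ i $ j) (\<lambda>u. U u $ i' $ j') =
         cov (limit_model \<nu>) (\<lambda>x. theta \<omega> x $ i * theta \<omega> x $ j) (\<lambda>x. theta \<omega> x $ i' * theta \<omega> x $ j')"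
    and eigenvalues: "ordered_eigenvalues (Sigma_inf \<nu> \<omega>) ev"
    and distinct: "\<mu> ` {1..D} = ev ` {1..CARD('d)}"
      "\<And>i j. 1 \<le> i \<Longrightarrow> i < j \<Longrightarrow> j \<le> D \<Longrightarrow> \<mu> j < \<mu> i"
    and N: "N 0 = 0" "\<And>j. j < D \<Longrightarrow> N j < N (Suc j)" "N D = CARD('d)"
      "\<And>j m. 1 \<le> j \<Longrightarrow> j \<le> D \<Longrightarrow> N (j - 1) < m \<Longrightarrow> m \<le> N j \<Longrightarrow> ev m = \<mu> j"
    and W: "\<And>j. W j = eigenspace (Sigma_inf \<nu> \<omega>) (\<mu> j)"
    and Vstar: "\<And>n. is_arg_max (\<lambda>V. true_risk M X \<omega> (t n) (orth_proj V))
                    (\<lambda>V. V \<in> subspaces_dim p) (Vstar n)"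
    and Vhat: "\<And>n w. w \<in> space M \<Longrightarrow>
                  is_arg_max (\<lambda>V. emp_risk n (k n) \<omega> (\<lambda>i. Xs i w) (orth_proj V))
                    (\<lambda>V. V \<in> subspaces_dim p) (Vhat n w)"
      "\<And>n. (\<lambda>w. orth_proj (Vhat n w)) \<in> borel_measurable M"
    and J: "1 \<le> J" "J < D" "p = N J"
    and B: "\<exists>\<epsilon>>0. \<forall>c>0. \<forall>\<^sub>F n in sequentially. \<forall>s\<in>{1 - \<epsilon>..1 + \<epsilon>}.
              onorm ((*v) (Sigma_above M X \<omega> (s * t n) - Sigma_above M X \<omega> (t n)))
                \<le> c * real (k n) powr (- 1 / 2)"
  shows "weak_conv_m
    (\<lambda>n. distr M borel (\<lambda>w. real (k n) *
       (true_risk M X \<omega> (t n) (orth_proj (Vstar n)) - true_risk M X \<omega> (t n) (orth_proj (Vhat n w)))))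
    (distr M' borel (\<lambda>u. \<Sum>j = 1..J. \<Sum>m = J + 1..D.
       1 / (\<mu> j - \<mu> m) * (hs_norm (orth_proj (W j) ** U u ** orth_proj (W m)))\<^sup>2))"
proof -
  interpret M: prob_space M by (rule M)
  interpret M': prob_space M' by (rule U(1))
  obtain G C where tail: "regular_tail (\<lambda>s. measure M {w\<in>space M. s < norm (X w)}) G C"
    using M.regularly_varying_tail[OF rv] by blast
  obtain c0 where c0: "AE w in M. norm (theta \<omega> (X w)) \<le> c0" using \<omega>(3) by blast
  have X: "X \<in> borel_measurable M" and sets: "sets \<nu> = sets (restrict_space borel (- {0}))"
    using rv by (auto simp: regularly_varying_def)
  let ?H = "\<lambda>s. measure M {w\<in>space M. s < norm (X w)}"
  interpret regular_tail ?H G C by (rule tail)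
  interpret pca_limit M ?H G C X Xs k t \<nu> \<omega> c0 M' U
    by (unfold_locales; rule refl X iid k t \<omega> c0 sets U)
  let ?Pr = "\<lambda>j. orth_proj (eigenspace (Sigma_inf \<nu> \<omega>) (\<mu> j))"
  interpret spectral_decomposition "Sigma_inf \<nu> \<omega>" ?Pr \<mu> D J p
    by (rule spectral_decomposition_eigenspaces[OF Sigma_sym(2) eigenvalues distinct(2) N J])
  \<comment> \<open>Multiplying by \<open>k n\<close> turns the empirical risk into the inner
    product with the raw exceedance sum, in the form that \<open>is_arg_max_max_proj\<close>
    expects.\<close>
  have emp: "real (k n) * emp_risk n (k n) \<omega> (\<lambda>i. Xs i w) P = (\<Sum>i\<in>E n w. tensor (Xs i w)) \<bullet> P"
    if "0 < k n" for n w P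
  proof -
    have "(\<Sum>i\<in>E n w. tensor (Xs i w)) \<bullet> P = (\<Sum>i\<in>E n w. theta \<omega> (Xs i w) \<bullet> (P *v theta \<omega> (Xs i w)))"
      by (simp add: inner_sum_left tensor_def inner_commute[of "outer _" P] inner_outer)
    also have "\<dots> = (\<Sum>i<n. if T n w < norm (Xs i w) then theta \<omega> (Xs i w) \<bullet> (P *v theta \<omega> (Xs i w)) else 0)"
      unfolding E_eq by (rule sum.inter_filter) simp
    also have "\<dots> = (\<Sum>i<n. theta \<omega> (Xs i w) \<bullet> (P *v theta \<omega> (Xs i w)) * of_bool (T n w < norm (Xs i w)))"
      by (intro sum.cong) auto
    finally show ?thesis using that by (simp add: emp_risk_def T_def)
  qed
  interpret pca_risk M ?H G C X Xs k t \<nu> \<omega> c0 M' U ?Pr \<mu> D J p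
    "\<lambda>n. orth_proj (Vstar n)" "\<lambda>n w. orth_proj (Vhat n w)"
  proof unfold_locales
    show "max_proj p (Sigma_above M X \<omega> (t n)) (orth_proj (Vstar n))" for n
      by (rule is_arg_max_max_proj[OF Vstar, where c = 1]) (simp_all add: true_risk_eq)
    fix n w assume w: "w \<in> space M"
    show "orth_proj (Vhat n w) \<in> proj_rank p"
      using Vhat(1)[OF w, of n] orth_proj_in_proj_rank by (auto simp: is_arg_max_def subspaces_dim_def)
    assume "0 < k n" "k n < n"
    then show "max_proj p (\<Sum>i\<in>E n w. tensor (Xs i w)) (orth_proj (Vhat n w))"
      by (intro is_arg_max_max_proj[OF Vhat(1)[OF w], where c = "real (k n)"] emp) auto
  qed (rule Vhat(2) B)+
  show ?thesis
    using risk_weak_conv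
    by (simp add: Y_def[abs_def] true_risk_eq inner_diff_right loss_form_def hs_norm_eq_norm W)
qed

end
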